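(* Let $(\Omega,\mathcal F,\mu,T)$ be an ergodic probability-preserving invertible dynamical system, $c:\Omega\to\,]0,+\infty[$ a measurable function, and let $(S_n)_{n\ge 0}$ be the associated random walk among conductances on $\mathbb Z$ (see context). Suppose that at least one of the functions $\overline c$ and $1/c$ is $\mu$-integrable. Then for $\mu$-almost every $\omega\in\Omega$ and for every $x\in 2\mathbb Z$, $$\lim_{n\to+\infty}\sqrt{2n}\,\frac{\mathbb P_0^\omega[S_{2n}=x]}{\overline c(x)(\omega)}=\begin{cases}\dfrac{1}{\sqrt\pi}\sqrt{\dfrac{\int \frac1c\,d\mu}{\int\overline c\,d\mu}} & \text{if } \overline c \text{ and } 1/c \text{ are integrable},\\[2mm] 0 & \text{if } 1/c \text{ is integrable and } \int\overline c\,d\mu=+\infty,\\[1mm] +\infty & \text{if } \int\frac1c\,d\mu=+\infty \text{ and } \overline c \text{ is integrable}.\end{cases}$$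
   Context: $\mu$ is a probability measure on the measurable space $(\Omega,\mathcal F)$, and $T:\Omega\to\Omega$ is invertible, bi-measurable, preserves $\mu$, and is ergodic (every invariant measurable set has measure $0$ or $1$). For $\omega\in\Omega$ (the environment) and $x\in\mathbb Z$, the conductance of the edge $\{x,x+1\}$ is $c(x,x+1)(\omega)=c(x+1,x)(\omega):=c(T^x\omega)$. Put $\overline c(x)(\omega):=c(x-1,x)(\omega)+c(x,x+1)(\omega)$. As a function on $\Omega$, $\overline c$ denotes $\omega\mapsto\overline c(0)(\omega)=c(T^{-1}\omega)+c(\omega)$. For fixed $\omega$ and $x_0\in\mathbb Z$, under $\mathbb P^\omega_{x_0}$, $(S_n)_{n\ge0}$ is the Markov chain on $\mathbb Z$ with $S_0=x_0$ and transition probabilities $\mathbb P^\omega_{x_0}[S_{n+1}=x\pm1\mid S_n=x]=c(x,x\pm1)(\omega)/\overline c(x)(\omega)$. "Integrable" means $\mu$-integrable. *)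

theory Defs
  imports "HOL-Probability.Probability"
begin

locale ergodic_system = prob_space M for M :: "'a measure" +
  fixes T :: "'a \<Rightarrow> 'a"
  assumes bij: "bij_betw T (space M) (space M)"
    and meas: "T \<in> measurable M M"
    and meas_inv: "inv_into (space M) T \<in> measurable M M"
    and preserving: "distr M M T = M"
    and ergodic: "\<And>A. A \<in> sets M \<Longrightarrow> T -` A \<inter> space M = A \<Longrightarrow> prob A = 0 \<or> prob A = 1"

definition iterate :: "'a measure \<Rightarrow> ('a \<Rightarrow> 'a) \<Rightarrow> int \<Rightarrow> 'a \<Rightarrow> 'a" where
  "iterate M T x \<omega> =
     (if 0 \<le> x then (T ^^ nat x) \<omega> else (inv_into (space M) T ^^ nat (- x)) \<omega>)"

(* Non-neighbouring sites carry no edge and get conductance 0. *)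
definition conductance ::
    "'a measure \<Rightarrow> ('a \<Rightarrow> 'a) \<Rightarrow> ('a \<Rightarrow> real) \<Rightarrow> 'a \<Rightarrow> int \<Rightarrow> int \<Rightarrow> real" where
  "conductance M T c \<omega> x y =
     (if y = x + 1 then c (iterate M T x \<omega>)
      else if y = x - 1 then c (iterate M T y \<omega>)
      else 0)"

definition cbar ::
    "'a measure \<Rightarrow> ('a \<Rightarrow> 'a) \<Rightarrow> ('a \<Rightarrow> real) \<Rightarrow> int \<Rightarrow> 'a \<Rightarrow> real" where
  "cbar M T c x \<omega> = conductance M T c \<omega> (x - 1) x + conductance M T c \<omega> x (x + 1)"

definition walk_trans ::
    "'a measure \<Rightarrow> ('a \<Rightarrow> 'a) \<Rightarrow> ('a \<Rightarrow> real) \<Rightarrow> 'a \<Rightarrow> int \<Rightarrow> int \<Rightarrow> real" where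
  "walk_trans M T c \<omega> x y = conductance M T c \<omega> x y / cbar M T c x \<omega>"

(* S is, under the probability measure P, a Markov chain with transition matrix p
   started at x0.  The Markov property is conditioned on histories of positive
   probability only, since cond_prob is 0 by convention on null events. *)
definition markov_chain ::
    "'p measure \<Rightarrow> (nat \<Rightarrow> 'p \<Rightarrow> 's) \<Rightarrow> 's \<Rightarrow> ('s \<Rightarrow> 's \<Rightarrow> real) \<Rightarrow> bool" where
  "markov_chain P S x0 p \<longleftrightarrow>
     prob_space P \<and>
     (\<forall>n. S n \<in> measurable P (count_space UNIV)) \<and>
     (AE w in P. S 0 w = x0) \<and>
     (\<forall>n s y. \<P>(w in P. \<forall>i\<le>n. S i w = s i) > 0 \<longrightarrow>
        \<P>(w in P. S (Suc n) w = y \<bar> \<forall>i\<le>n. S i w = s i) = p (s n) y)"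

end

theory Submission
  imports Defs "HOL-Real_Asymp.Real_Asymp"
begin

text \<open>
For almost every environment the claim is a statement about one fixed sequence of conductances: by
Birkhoff's ergodic theorem (\<open>birkhoff\<close>, \<open>AE_two_sided_mean\<close>) the site weights (the sums
of two adjacent conductances), the resistances \<open>1 / c\<close>, and the truncations of both have means along
the orbit, in both directions and from every starting point, as far as they are integrable. The rest is deterministic.

Let \<open>q x n y\<close> be the probability that the walk goes from \<open>x\<close> to \<open>y\<close> in \<open>n\<close> steps, divided by the
weight of \<open>y\<close>. It is symmetric in \<open>x\<close> and \<open>y\<close>, and \<open>q x (2 * n) x\<close> decreases in \<open>n\<close>, since it is a
squared norm to which a self-adjoint contraction is applied.

Suppose that the mean resistance \<open>\<rho>\<close> is finite. The generating function of \<open>q x n x\<close> at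
\<open>s = 1 / (1 + \<mu>)\<close> is, up to a negligible term, the reciprocal of the sum of the effective conductances
of the two half-lines at \<open>x\<close>, in a network where current leaks at rate \<open>\<mu>\<close> times the weight. The
effective conductance is bounded above by the Dirichlet principle and below by the Thomson principle
(\<open>ray_dirichlet_principle\<close>, \<open>ray_thomson_principle\<close>). Exponential test functions in the resistance
and in the weight, respectively, give the same leading term \<open>sqrt (\<mu> M / \<rho>)\<close> for mean weight \<open>M\<close>; if
the weight has infinite mean, truncated weights show that the effective conductance is of larger
order than \<open>sqrt \<mu>\<close> (\<open>green_limit\<close>). Since the return kernel is monotone, a Tauberian theorem
(\<open>tauberian_sqrt\<close>) turns this into its asymptotics. Endpoints other than the starting point are
reached by a maximum principle (\<open>local_limit_of_returns\<close>).

If the mean resistance is infinite, the generating function no longer determines the size of the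
return kernel. Instead, a solution of the Poisson equation that grows faster than quadratically shows
that the walk at time \<open>n\<close> is within \<open>o(sqrt n)\<close> of its start (\<open>poisson_expectation\<close>). The weight of that
window is \<open>o(sqrt n)\<close>, and Cauchy--Schwarz bounds the return kernel from below by a constant over
this weight (\<open>return_divergence\<close>).
\<close>

section \<open>Birkhoff's ergodic theorem\<close>

text \<open>
The recursion computes the maximum of the first \<open>n + 1\<close> nonempty partial sums of the orbit. It is
the form that makes the difference between step \<open>n + 1\<close> at \<open>w\<close> and step \<open>n\<close> at \<open>T w\<close> explicit.
\<close>

fun birkhoff_max :: "('a \<Rightarrow> 'a) \<Rightarrow> ('a \<Rightarrow> real) \<Rightarrow> nat \<Rightarrow> 'a \<Rightarrow> real" where
  "birkhoff_max T f 0 w = f w"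
| "birkhoff_max T f (Suc n) w = f w + max 0 (birkhoff_max T f n (T w))"

lemma birkhoff_max_mono: "birkhoff_max T f n w \<le> birkhoff_max T f (Suc n) w"
proof (induction n arbitrary: w)
  case (Suc n)
  have "max 0 (birkhoff_max T f n (T w)) \<le> max 0 (birkhoff_max T f (Suc n) (T w))"
    using Suc[of "T w"] by (intro max.mono) auto
  then show ?case by simp
qed simp

lemma birkhoff_sum_le_max: "(\<Sum>i<Suc n. f ((T ^^ i) w)) \<le> birkhoff_max T f n w"
proof (induction n arbitrary: w)
  case (Suc n)
  have "(\<Sum>i<Suc (Suc n). f ((T ^^ i) w)) = f w + (\<Sum>i<Suc n. f ((T ^^ i) (T w)))"
    by (subst sum.lessThan_Suc_shift) (simp add: funpow_swap1)
  also have "\<dots> \<le> f w + max 0 (birkhoff_max T f n (T w))"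
    using Suc[of "T w"] by linarith
  finally show ?case by simp
qed simp

lemma integrable_comp_preserving:
  fixes g :: "'a \<Rightarrow> real"
  assumes "T \<in> measurable M M" "distr M M T = M" "integrable M g"
  shows "integrable M (\<lambda>w. g (T w))" "(\<integral>w. g (T w) \<partial>M) = (\<integral>w. g w \<partial>M)"
proof -
  have g[measurable]: "g \<in> borel_measurable M" using assms(3) by auto
  show "integrable M (\<lambda>w. g (T w))"
    using integrable_distr_eq[OF assms(1) g] assms by simp
  show "(\<integral>w. g (T w) \<partial>M) = (\<integral>w. g w \<partial>M)"
    using integral_distr[OF assms(1) g] assms by simp
qed

text \<open>
Let \<open>A\<close> be the set where the partial sums are unbounded above; it is invariant, so it has measure
0 or 1. With \<open>mx n\<close> the running maximum, \<open>mx (n + 1) - mx n \<circ> T = f + max 0 (- (mx n \<circ> T))\<close> has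
nonnegative integral because \<open>mx\<close> increases and \<open>T\<close> preserves the measure. On \<open>A\<close> the right-hand
side tends to \<open>f\<close>, so \<open>A\<close> of full measure would force the integral of \<open>f\<close> to be nonnegative.
\<close>

lemma (in prob_space) maximal_ergodic:
  fixes f :: "'a \<Rightarrow> real"
  assumes T[measurable]: "T \<in> measurable M M" and pres: "distr M M T = M"
    and ergodic: "\<And>A. A \<in> sets M \<Longrightarrow> T -` A \<inter> space M = A \<Longrightarrow> prob A = 0 \<or> prob A = 1"
    and f: "integrable M f" and neg: "(\<integral>w. f w \<partial>M) < 0"
  shows "AE w in M. \<exists>K. \<forall>n. (\<Sum>i<n. f ((T ^^ i) w)) \<le> K"
proof -
  define mx where "mx = birkhoff_max T f"
  have f'[measurable]: "f \<in> borel_measurable M" using f by auto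
  have int: "integrable M (mx n)" for n
  proof (induction n)
    case 0 then show ?case using f by (simp add: mx_def cong: integrable_cong)
  next
    case (Suc n)
    have "integrable M (\<lambda>w. f w + max 0 (mx n (T w)))"
      using f integrable_comp_preserving(1)[OF T pres Suc] by auto
    then show ?case by (simp add: mx_def cong: integrable_cong)
  qed
  then have m[measurable]: "mx n \<in> borel_measurable M" for n by auto
  have mono: "mx n w \<le> mx k w" if "n \<le> k" for n k w
    using lift_Suc_mono_le[of "\<lambda>n. mx n w" n k] birkhoff_max_mono[of T f _ w] that
    by (simp add: mx_def)
  define A where "A = {w \<in> space M. \<forall>j::nat. \<exists>n. mx n w > real j}"
  have A: "A \<in> sets M" unfolding A_def by measurable
  have step: "mx (Suc n) w = f w + max 0 (mx n (T w))" for n w by (simp add: mx_def)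
  have unb: "(\<forall>j::nat. \<exists>n. mx n w > real j) \<longleftrightarrow> (\<forall>K. \<exists>n. mx n w > K)" for w
    by (meson less_trans reals_Archimedean2)
  have "(\<forall>K. \<exists>n. mx n (T w) > K) \<longleftrightarrow> (\<forall>K. \<exists>n. mx n w > K)" for w
  proof
    assume L: "\<forall>K. \<exists>n. mx n (T w) > K"
    show "\<forall>K. \<exists>n. mx n w > K"
    proof
      fix K obtain n where "mx n (T w) > K - f w" using L by blast
      then have "mx (Suc n) w > K" unfolding step by linarith
      then show "\<exists>n. mx n w > K" by blast
    qed
  next
    assume R: "\<forall>K. \<exists>n. mx n w > K"
    show "\<forall>K. \<exists>n. mx n (T w) > K"
    proof
      fix K obtain n where "mx n w > max 0 K + f w" using R by blast
      then have "mx (Suc n) w > max 0 K + f w" using mono[of n "Suc n" w] by simp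
      then have "mx n (T w) > K" unfolding step by linarith
      then show "\<exists>n. mx n (T w) > K" by blast
    qed
  qed
  then have inv: "T -` A \<inter> space M = A"
    using measurable_space[OF T] unfolding A_def unb by auto
  have "prob A \<noteq> 1"
  proof
    assume "prob A = 1"
    then have ae: "AE w in M. w \<in> A" using A by (simp add: AE_in_set_eq_1)
    have "(\<lambda>n. \<integral>w. f w + max 0 (- mx n (T w)) \<partial>M) \<longlonglongrightarrow> (\<integral>w. f w \<partial>M)"
    proof (rule integral_dominated_convergence[where w = "\<lambda>w. \<bar>f w\<bar> + \<bar>f (T w)\<bar>"])
      show "integrable M (\<lambda>w. \<bar>f w\<bar> + \<bar>f (T w)\<bar>)"
        using f integrable_comp_preserving(1)[OF T pres f] by auto
      show "AE w in M. (\<lambda>n. f w + max 0 (- mx n (T w))) \<longlonglongrightarrow> f w"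
        using ae
      proof eventually_elim
        case (elim w)
        then have "T w \<in> A" using inv by auto
        then have "\<forall>j::nat. \<exists>k. mx k (T w) > real j" by (simp add: A_def)
        from spec[OF this, of 0] obtain k where "mx k (T w) > 0" by auto
        then have "max 0 (- mx n (T w)) = 0" if "n \<ge> k" for n
          using mono[OF that, of "T w"] by simp
        then have "eventually (\<lambda>n. f w + max 0 (- mx n (T w)) = f w) sequentially"
          unfolding eventually_sequentially by auto
        then show ?case by (rule tendsto_eventually)
      qed
      show "AE w in M. norm (f w + max 0 (- mx n (T w))) \<le> \<bar>f w\<bar> + \<bar>f (T w)\<bar>" for n
      proof (rule AE_I2)
        fix w
        have "mx 0 (T w) \<le> mx n (T w)" using mono[of 0 n] by simp
        then have "f (T w) \<le> mx n (T w)" by (simp add: mx_def)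
        then show "norm (f w + max 0 (- mx n (T w))) \<le> \<bar>f w\<bar> + \<bar>f (T w)\<bar>" by auto
      qed
    qed measurable
    moreover have "(\<integral>w. f w + max 0 (- mx n (T w)) \<partial>M) \<ge> 0" for n
    proof -
      have "(\<integral>w. f w + max 0 (- mx n (T w)) \<partial>M) = (\<integral>w. mx (Suc n) w - mx n (T w) \<partial>M)"
        by (rule Bochner_Integration.integral_cong) (auto simp: step max_def)
      also have "\<dots> = (\<integral>w. mx (Suc n) w \<partial>M) - (\<integral>w. mx n w \<partial>M)"
        using int integrable_comp_preserving[OF T pres int] by simp
      also have "\<dots> \<ge> 0" using integral_mono[OF int int, of n "Suc n"] mono[of n "Suc n"] by simp
      finally show ?thesis .
    qed
    ultimately have "(\<integral>w. f w \<partial>M) \<ge> 0" by (meson LIMSEQ_le_const)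
    then show False using neg by simp
  qed
  then have "prob A = 0" using ergodic[OF A inv] by blast
  then have "AE w in M. w \<notin> A" using A by (simp add: prob_eq_0)
  moreover have "AE w in M. w \<in> space M" by (rule AE_space)
  ultimately show ?thesis
  proof eventually_elim
    case (elim w)
    then have "\<exists>j::nat. \<forall>n. mx n w \<le> real j" by (auto simp: A_def not_less)
    then obtain j :: nat where j: "\<And>n. mx n w \<le> real j" by blast
    have "(\<Sum>i<n. f ((T ^^ i) w)) \<le> real j" for n
      using birkhoff_sum_le_max[of f T w "n - 1"] j[of "n-1"]
      by (cases n) (auto simp: mx_def)
    then show ?case by blast
  qed
qed

text \<open>
The preceding bound, applied to \<open>g - \<integral>g - \<delta>\<close> and to \<open>- g + \<integral>g - \<delta>\<close> for \<open>\<delta> = 1 / (j + 1)\<close>,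
gives the ergodic theorem.
\<close>

lemma (in prob_space) birkhoff:
  fixes g :: "'a \<Rightarrow> real"
  assumes T: "T \<in> measurable M M" and pres: "distr M M T = M"
    and ergodic: "\<And>A. A \<in> sets M \<Longrightarrow> T -` A \<inter> space M = A \<Longrightarrow> prob A = 0 \<or> prob A = 1"
    and g: "integrable M g"
  shows "AE w in M. (\<lambda>n. (\<Sum>i<n. g ((T ^^ i) w)) / real n) \<longlonglongrightarrow> (\<integral>w. g w \<partial>M)"
proof -
  define I where "I = (\<integral>w. g w \<partial>M)"
  have up: "AE w in M. \<forall>j::nat. \<exists>K. \<forall>n. (\<Sum>i<n. h ((T ^^ i) w)) \<le> K + real n * (H + 1 / Suc j)"
    if h: "integrable M h" and H: "H = (\<integral>w. h w \<partial>M)" for h :: "'a \<Rightarrow> real" and H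
    unfolding AE_all_countable
  proof
    fix j :: nat
    have "AE w in M. \<exists>K. \<forall>n. (\<Sum>i<n. h ((T ^^ i) w) - (H + 1 / Suc j)) \<le> K"
    proof (rule maximal_ergodic[OF T pres ergodic])
      show "integrable M (\<lambda>w. h w - (H + 1 / Suc j))" using h by auto
      show "(\<integral>w. h w - (H + 1 / Suc j) \<partial>M) < 0" using h by (simp add: H prob_space)
    qed
    then show "AE w in M. \<exists>K. \<forall>n. (\<Sum>i<n. h ((T ^^ i) w)) \<le> K + real n * (H + 1 / Suc j)"
      by eventually_elim (simp add: sum_subtractf algebra_simps)
  qed
  have upper: "AE w in M. \<forall>j::nat. \<exists>K. \<forall>n. (\<Sum>i<n. g ((T ^^ i) w)) \<le> K + real n * (I + 1 / Suc j)"
    by (rule up) (use g in \<open>auto simp: I_def\<close>)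
  have lower: "AE w in M. \<forall>j::nat. \<exists>K. \<forall>n. (\<Sum>i<n. - g ((T ^^ i) w)) \<le> K + real n * (- I + 1 / Suc j)"
    by (rule up) (use g in \<open>auto simp: I_def\<close>)
  show ?thesis using upper lower
  proof eventually_elim
    case (elim w)
    define s where "s = (\<lambda>n. (\<Sum>i<n. g ((T ^^ i) w)))"
    have "(\<lambda>n. s n / real n) \<longlonglongrightarrow> I"
    proof (rule LIMSEQ_I)
      fix e :: real assume "e > 0"
      then obtain j where j: "1 / real (Suc j) < e / 2"
        using reals_Archimedean[of "e/2"] by (auto simp: inverse_eq_divide)
      obtain K where K: "\<And>n. s n \<le> K + real n * (I + 1 / Suc j)"
        using elim(1) unfolding s_def by blast
      obtain K' where K': "\<And>n. - s n \<le> K' + real n * (- I + 1 / Suc j)"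
        using elim(2) unfolding s_def sum_negf by blast
      obtain N where N: "real N > 2 * (\<bar>K\<bar> + \<bar>K'\<bar>) / e" using reals_Archimedean2 by blast
      have "norm (s n / real n - I) < e" if n: "n \<ge> Suc N" for n
      proof -
        have n0: "real n > 0" using n by simp
        have "real n * (e / 2) > \<bar>K\<bar> + \<bar>K'\<bar>"
        proof -
          have "real N * e > 2 * (\<bar>K\<bar> + \<bar>K'\<bar>)" using N \<open>e > 0\<close> by (simp add: field_simps)
          moreover have "real n * e \<ge> real N * e" using n \<open>e > 0\<close> by simp
          ultimately show ?thesis by simp
        qed
        moreover have "real n * (1 / Suc j) \<le> real n * (e / 2)"
          by (rule mult_left_mono) (use j in auto)
        ultimately have "\<bar>s n - real n * I\<bar> < real n * e"
          using K[of n] K'[of n] unfolding distrib_left abs_less_iff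
          by (simp only: mult_minus_right) linarith
        then have "\<bar>s n - real n * I\<bar> / real n < e" using n0 by (simp add: field_simps)
        moreover have "s n / real n - I = (s n - real n * I) / real n" using n0 by (simp add: field_simps)
        ultimately show ?thesis using n0 by simp
      qed
      then show "\<exists>no. \<forall>n\<ge>no. norm (s n / real n - I) < e" by blast
    qed
    then show ?case unfolding s_def I_def .
  qed
qed

text \<open>
The only property of a typical environment that the analysis of the walk uses. All starting points
are included so that the property is invariant under translation by definition.
\<close>

definition two_sided_mean :: "(int \<Rightarrow> real) \<Rightarrow> real \<Rightarrow> bool" where
  "two_sided_mean g \<gamma> \<longleftrightarrow> (\<forall>x.
     (\<lambda>n. (\<Sum>i<n. g (x + int i)) / real n) \<longlonglongrightarrow> \<gamma> \<and>
     (\<lambda>n. (\<Sum>i<n. g (x - int i)) / real n) \<longlonglongrightarrow> \<gamma>)"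

lemma funpow_preserving:
  assumes "T \<in> measurable M M" "distr M M T = M"
  shows "T ^^ n \<in> measurable M M \<and> distr M M (T ^^ n) = M"
proof (induction n)
  case 0
  have "distr M M (\<lambda>x. x) = M" by (rule distr_id2) simp
  then show ?case by (simp add: id_def)
next
  case (Suc n)
  have "distr M M (T \<circ> (T ^^ n)) = distr (distr M M (T ^^ n)) M T"
    using Suc assms by (subst distr_distr) auto
  then show ?case using Suc assms by (simp del: comp_apply)
qed

context ergodic_system
begin

abbreviation "Tinv \<equiv> inv_into (space M) T"

lemma Tinv_space: "w \<in> space M \<Longrightarrow> Tinv w \<in> space M"
  using meas_inv by (rule measurable_space)

lemma T_space: "w \<in> space M \<Longrightarrow> T w \<in> space M"
  using meas by (rule measurable_space)

lemma T_Tinv: "w \<in> space M \<Longrightarrow> T (Tinv w) = w"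
  using bij by (simp add: bij_betw_inv_into_right)

lemma Tinv_T: "w \<in> space M \<Longrightarrow> Tinv (T w) = w"
  using bij by (simp add: bij_betw_inv_into_left)

lemma Tinv_preserving: "distr M M Tinv = M"
proof -
  have "distr M M Tinv = distr (distr M M T) M Tinv" by (simp add: preserving)
  also have "\<dots> = distr M M (\<lambda>w. Tinv (T w))"
    using meas meas_inv by (subst distr_distr) (auto simp: comp_def)
  also have "\<dots> = distr M M (\<lambda>w. w)" by (rule distr_cong) (auto simp: Tinv_T)
  also have "\<dots> = M" by (rule distr_id2) simp
  finally show ?thesis .
qed

lemma Tinv_ergodic:
  assumes "A \<in> sets M" "Tinv -` A \<inter> space M = A"
  shows "prob A = 0 \<or> prob A = 1"
proof (rule ergodic[OF assms(1)])
  have sub: "A \<subseteq> space M" using assms(1) by (rule sets.sets_into_space)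
  have "Tinv w \<in> A \<longleftrightarrow> w \<in> A" if "w \<in> space M" for w
    using assms(2) that by blast
  then have "T w \<in> A \<longleftrightarrow> w \<in> A" if "w \<in> space M" for w
    using that T_space[OF that] Tinv_T[OF that] by metis
  then show "T -` A \<inter> space M = A" using sub by auto
qed

lemma funpow_space:
  assumes "w \<in> space M"
  shows "(T ^^ n) w \<in> space M" "(Tinv ^^ n) w \<in> space M"
  using assms by (induction n) (auto intro: T_space Tinv_space)

lemma iterate_space: "w \<in> space M \<Longrightarrow> iterate M T x w \<in> space M"
  by (simp add: iterate_def funpow_space)

lemma iterate_0: "iterate M T 0 w = w"
  by (simp add: iterate_def)

lemma iterate_succ:
  assumes "w \<in> space M"
  shows "iterate M T (x + 1) w = T (iterate M T x w)"
proof (cases "0 \<le> x")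
  case True
  then have "nat (x + 1) = Suc (nat x)" by simp
  then show ?thesis using True by (simp add: iterate_def)
next
  case False
  then have n: "nat (- x) = Suc (nat (- (x + 1)))" by simp
  have "T (iterate M T x w) = T (Tinv ((Tinv ^^ nat (- (x + 1))) w))"
    using False n by (simp add: iterate_def)
  also have "\<dots> = (Tinv ^^ nat (- (x + 1))) w"
    by (rule T_Tinv[OF funpow_space(2)[OF assms]])
  also have "\<dots> = iterate M T (x + 1) w"
  proof (cases "x + 1 = 0")
    case True
    then show ?thesis by (simp add: iterate_def)
  next
    case F: False
    then have "\<not> 0 \<le> x + 1" using False by linarith
    then show ?thesis unfolding iterate_def by simp
  qed
  finally show ?thesis ..
qed

lemma iterate_pred:
  assumes "w \<in> space M"
  shows "iterate M T (x - 1) w = Tinv (iterate M T x w)"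
  using iterate_succ[OF assms, of "x - 1"] Tinv_T[OF iterate_space[OF assms]] by simp

lemma iterate_add:
  assumes "w \<in> space M"
  shows "iterate M T (x + int i) w = (T ^^ i) (iterate M T x w)"
proof (induction i)
  case (Suc i)
  have "x + int (Suc i) = (x + int i) + 1" by simp
  then have "iterate M T (x + int (Suc i)) w = iterate M T ((x + int i) + 1) w" by (rule arg_cong)
  then show ?case using iterate_succ[OF assms, of "x + int i"] Suc by (simp del: of_nat_Suc)
qed simp

lemma iterate_diff:
  assumes "w \<in> space M"
  shows "iterate M T (x - int i) w = (Tinv ^^ i) (iterate M T x w)"
proof (induction i)
  case (Suc i)
  have "x - int (Suc i) = (x - int i) - 1" by simp
  then have "iterate M T (x - int (Suc i)) w = iterate M T ((x - int i) - 1) w" by (rule arg_cong)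
  then show ?case using iterate_pred[OF assms, of "x - int i"] Suc by (simp del: of_nat_Suc)
qed simp

lemma iterate_preserving: "iterate M T x \<in> measurable M M" "distr M M (iterate M T x) = M"
proof -
  have "iterate M T x = (if 0 \<le> x then T ^^ nat x else Tinv ^^ nat (- x))"
    by (auto simp: iterate_def)
  then show "iterate M T x \<in> measurable M M" "distr M M (iterate M T x) = M"
    using funpow_preserving[OF meas preserving] funpow_preserving[OF meas_inv Tinv_preserving]
    by auto
qed

lemma AE_two_sided_mean:
  fixes g :: "'a \<Rightarrow> real"
  assumes g: "integrable M g"
  shows "AE w in M. two_sided_mean (\<lambda>x. g (iterate M T x w)) (\<integral>w. g w \<partial>M)"
proof -
  have "AE w in distr M M (iterate M T x).
      (\<lambda>n. (\<Sum>i<n. g ((T ^^ i) w)) / real n) \<longlonglongrightarrow> (\<integral>w. g w \<partial>M) \<and>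
      (\<lambda>n. (\<Sum>i<n. g ((Tinv ^^ i) w)) / real n) \<longlonglongrightarrow> (\<integral>w. g w \<partial>M)" for x
    unfolding iterate_preserving(2)
    using birkhoff[OF meas preserving _ g] birkhoff[OF meas_inv Tinv_preserving _ g]
      ergodic Tinv_ergodic by (intro AE_conjI) blast+
  then have "AE w in M. \<forall>x.
      (\<lambda>n. (\<Sum>i<n. g ((T ^^ i) (iterate M T x w))) / real n) \<longlonglongrightarrow> (\<integral>w. g w \<partial>M) \<and>
      (\<lambda>n. (\<Sum>i<n. g ((Tinv ^^ i) (iterate M T x w))) / real n) \<longlonglongrightarrow> (\<integral>w. g w \<partial>M)"
    unfolding AE_all_countable by (intro allI AE_distrD[OF iterate_preserving(1)])
  with AE_space show ?thesis
    by eventually_elim (simp add: two_sided_mean_def iterate_add iterate_diff)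
qed

end

section \<open>A Tauberian theorem for monotone sequences\<close>

lemmas eventually_pos = eventually_at_right_less[of "0::real"]

abbreviation laplace :: "(nat \<Rightarrow> real) \<Rightarrow> real \<Rightarrow> real" where
  "laplace d eps \<equiv> sqrt eps * (\<Sum>n. d n * exp (- eps * real n))"

lemma summable_bounded_exp:
  fixes d :: "nat \<Rightarrow> real"
  assumes "\<And>n. \<bar>d n\<bar> \<le> K" "0 < eps"
  shows "summable (\<lambda>n. d n * exp (- eps * real n))"
proof (rule summable_comparison_test')
  have "summable (\<lambda>n. exp (- eps) ^ n)" using assms by (intro summable_geometric) simp
  then show "summable (\<lambda>n. K * exp (- eps) ^ n)" by (rule summable_mult)
  fix n
  have "\<bar>d n\<bar> * exp (- eps * real n) \<le> K * exp (- eps * real n)"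
    using assms by (intro mult_right_mono) auto
  then show "norm (d n * exp (- eps * real n)) \<le> K * exp (- eps) ^ n"
    by (simp add: abs_mult exp_of_nat_mult[symmetric] mult.commute)
qed

text \<open>
A monomial \<open>x ^ i\<close> in \<open>exp (- eps n)\<close> only replaces \<open>eps\<close> by \<open>(i + 1) eps\<close>, and the scaling by a
square root is homogeneous; so the hypothesis passes from the constant polynomial to all of them.
\<close>

lemma laplace_polynomial:
  fixes d :: "nat \<Rightarrow> real"
  assumes bd: "\<And>n. \<bar>d n\<bar> \<le> K"
    and lim: "(laplace d \<longlongrightarrow> 0) (at_right 0)"
    and p: "p = (\<lambda>x. \<Sum>i\<le>k. c i * x ^ i)"
  shows "((\<lambda>eps. sqrt eps * (\<Sum>n. d n * exp (- eps * real n) * p (exp (- eps * real n)))) \<longlongrightarrow> 0)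
    (at_right 0)"
proof -
  define F where "F = laplace d"
  have "((\<lambda>eps. \<Sum>i\<le>k. c i * (F (real (Suc i) * eps) / sqrt (real (Suc i)))) \<longlongrightarrow> (\<Sum>i\<le>k. c i * (0 / sqrt (real (Suc i)))))
    (at_right 0)"
  proof (intro tendsto_sum tendsto_mult tendsto_const tendsto_divide)
    fix i
    have "filterlim (\<lambda>eps. real (Suc i) * eps) (at_right 0) (at_right 0)"
      unfolding filterlim_at
      by (auto intro!: tendsto_eq_intros eventually_at_rightI[of 0 1])
    then show "((\<lambda>eps. F (real (Suc i) * eps)) \<longlongrightarrow> 0) (at_right 0)"
      using filterlim_compose[OF lim] unfolding F_def by blast
  qed simp
  then have "((\<lambda>eps. \<Sum>i\<le>k. c i * (F (real (Suc i) * eps) / sqrt (real (Suc i)))) \<longlongrightarrow> 0) (at_right 0)"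
    by simp
  moreover have "eventually (\<lambda>eps. (\<Sum>i\<le>k. c i * (F (real (Suc i) * eps) / sqrt (real (Suc i))))
      = sqrt eps * (\<Sum>n. d n * exp (- eps * real n) * p (exp (- eps * real n)))) (at_right 0)"
    using eventually_pos
  proof eventually_elim
    case (elim eps)
    have sm: "summable (\<lambda>n. c i * (d n * exp (- (real (Suc i) * eps) * real n)))" for i
      by (intro summable_mult summable_bounded_exp[OF bd]) (use elim in simp)
    have "(\<Sum>i\<le>k. c i * (F (real (Suc i) * eps) / sqrt (real (Suc i))))
       = (\<Sum>i\<le>k. sqrt eps * (\<Sum>n. c i * (d n * exp (- (real (Suc i) * eps) * real n))))"
    proof (rule sum.cong)
      fix i
      have "(\<Sum>n. c i * (d n * exp (- (real (Suc i) * eps) * real n)))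
          = c i * (\<Sum>n. d n * exp (- (real (Suc i) * eps) * real n))"
        by (intro suminf_mult summable_bounded_exp[OF bd]) (use elim in simp)
      then show "c i * (F (real (Suc i) * eps) / sqrt (real (Suc i)))
         = sqrt eps * (\<Sum>n. c i * (d n * exp (- (real (Suc i) * eps) * real n)))"
        unfolding F_def real_sqrt_mult by (simp add: field_simps del: of_nat_Suc)
    qed simp
    also have "\<dots> = sqrt eps * (\<Sum>n. \<Sum>i\<le>k. c i * (d n * exp (- (real (Suc i) * eps) * real n)))"
      using sm by (subst suminf_sum) (auto simp: sum_distrib_left)
    also have "(\<lambda>n. \<Sum>i\<le>k. c i * (d n * exp (- (real (Suc i) * eps) * real n)))
        = (\<lambda>n. d n * exp (- eps * real n) * p (exp (- eps * real n)))"
    proof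
      fix n
      have "exp (- (real (Suc i) * eps) * real n) = exp (- eps * real n) * exp (- eps * real n) ^ i" for i
        by (simp add: exp_of_nat_mult[symmetric] exp_add[symmetric] algebra_simps)
      then show "(\<Sum>i\<le>k. c i * (d n * exp (- (real (Suc i) * eps) * real n)))
        = d n * exp (- eps * real n) * p (exp (- eps * real n))"
        unfolding p by (simp add: sum_distrib_left mult_ac)
    qed
    finally show ?case .
  qed
  ultimately show ?thesis by (rule Lim_transform_eventually)
qed

text \<open>
Weierstrass approximation: the error is controlled by the Laplace sums of the majorant \<open>h\<close>.
\<close>

lemma laplace_continuous:
  fixes d h :: "nat \<Rightarrow> real"
  assumes dh: "\<And>n. \<bar>d n\<bar> \<le> h n" and hK: "\<And>n. h n \<le> K"
    and lim: "(laplace d \<longlongrightarrow> 0) (at_right 0)"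
    and limh: "(laplace h \<longlongrightarrow> H) (at_right 0)"
    and g: "continuous_on {0..1} (g :: real \<Rightarrow> real)"
  shows "((\<lambda>eps. sqrt eps * (\<Sum>n. d n * exp (- eps * real n) * g (exp (- eps * real n)))) \<longlongrightarrow> 0)
    (at_right 0)"
proof (rule tendstoI)
  fix e :: real assume e: "e > 0"
  have bd: "\<bar>d n\<bar> \<le> K" "\<bar>h n\<bar> \<le> K" for n using dh[of n] hK[of n] by auto
  define \<delta> where "\<delta> = e / (2 * (\<bar>H\<bar> + 1))"
  have \<delta>: "\<delta> > 0" using e by (simp add: \<delta>_def)
  obtain p where p: "real_polynomial_function p" "\<And>x. x \<in> {0..1} \<Longrightarrow> \<bar>g x - p x\<bar> < \<delta>"
    using Stone_Weierstrass_real_polynomial_function[OF _ g \<delta>] by auto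
  obtain c k where ck: "p = (\<lambda>x. \<Sum>i\<le>k. c i * x ^ i)"
    using p(1) unfolding real_polynomial_function_iff_sum by blast
  have "eventually (\<lambda>eps. laplace h eps < \<bar>H\<bar> + 1) (at_right 0)"
    using limh by (rule order_tendstoD) auto
  moreover have "eventually (\<lambda>eps. dist (sqrt eps * (\<Sum>n. d n * exp (- eps * real n) * p (exp (- eps * real n)))) 0 < e/2) (at_right 0)"
    using laplace_polynomial[OF bd(1) lim ck] e by (intro tendstoD) auto
  ultimately show "eventually (\<lambda>eps. dist (sqrt eps * (\<Sum>n. d n * exp (- eps * real n) * g (exp (- eps * real n)))) 0 < e) (at_right 0)"
    using eventually_pos
  proof eventually_elim
    case (elim eps)
    define x where "x n = exp (- eps * real n)" for n
    have x: "x n \<in> {0..1}" "x n > 0" for n using elim by (auto simp: x_def)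
    have "\<exists>G. \<forall>y\<in>{0..1}. \<bar>g y\<bar> \<le> G"
      using compact_imp_bounded[OF compact_continuous_image[OF g]] by (simp add: bounded_iff)
    then obtain G where G: "\<And>y. y \<in> {0..1} \<Longrightarrow> \<bar>g y\<bar> \<le> G" by blast
    have sg: "summable (\<lambda>n. d n * x n * g (x n))"
    proof -
      have "\<bar>d n * g (x n)\<bar> \<le> K * G" for n
        unfolding abs_mult using G[OF x(1)] bd(1)[of n] by (intro mult_mono) auto
      from summable_bounded_exp[OF this elim(3)] show ?thesis by (simp add: x_def mult_ac)
    qed
    have sd: "summable (\<lambda>n. d n * x n * (g (x n) - p (x n)))"
      and b: "\<bar>\<Sum>n. d n * x n * (g (x n) - p (x n))\<bar> \<le> \<delta> * (\<Sum>n. h n * x n)"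
    proof -
      have sh: "summable (\<lambda>n. \<delta> * (h n * x n))"
        using summable_bounded_exp[OF bd(2) elim(3)] unfolding x_def by (rule summable_mult)
      have le: "norm (d n * x n * (g (x n) - p (x n))) \<le> \<delta> * (h n * x n)" for n
      proof -
        have "\<bar>d n\<bar> * (x n * \<bar>g (x n) - p (x n)\<bar>) \<le> h n * (x n * \<delta>)"
          using dh[of n] p(2)[OF x(1), of n] x[of n] by (intro mult_mono) auto
        then show ?thesis using x[of n] by (simp add: abs_mult mult_ac)
      qed
      show "summable (\<lambda>n. d n * x n * (g (x n) - p (x n)))"
        using sh le by (rule summable_comparison_test')
      have "norm (\<Sum>n. d n * x n * (g (x n) - p (x n))) \<le> (\<Sum>n. \<delta> * (h n * x n))"
        using le by (intro order_trans[OF summable_norm] suminf_le sh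
            summable_comparison_test'[OF sh, of 0]) auto
      then show "\<bar>\<Sum>n. d n * x n * (g (x n) - p (x n))\<bar> \<le> \<delta> * (\<Sum>n. h n * x n)"
        using summable_bounded_exp[OF bd(2) elim(3)] unfolding x_def by (simp add: suminf_mult)
    qed
    have "(\<Sum>n. d n * x n * g (x n)) - (\<Sum>n. d n * x n * (g (x n) - p (x n)))
       = (\<Sum>n. d n * x n * g (x n) - d n * x n * (g (x n) - p (x n)))"
      by (rule suminf_diff[OF sg sd])
    also have "\<dots> = (\<Sum>n. d n * x n * p (x n))" by (rule suminf_cong) (simp add: algebra_simps)
    finally have eq: "(\<Sum>n. d n * x n * g (x n)) = (\<Sum>n. d n * x n * p (x n)) + (\<Sum>n. d n * x n * (g (x n) - p (x n)))"
      by simp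
    have se: "sqrt eps > 0" using elim by simp
    have "sqrt eps * \<bar>\<Sum>n. d n * x n * (g (x n) - p (x n))\<bar> \<le> \<delta> * (sqrt eps * (\<Sum>n. h n * x n))"
      using mult_left_mono[OF b, of "sqrt eps"] se by (simp add: mult_ac)
    also have "\<dots> \<le> \<delta> * (\<bar>H\<bar> + 1)"
      using elim(1) \<delta> unfolding x_def by (intro mult_left_mono) auto
    also have "\<dots> = e / 2" by (simp add: \<delta>_def field_simps)
    finally have "sqrt eps * \<bar>\<Sum>n. d n * x n * (g (x n) - p (x n))\<bar> \<le> e / 2" .
    moreover have "sqrt eps * \<bar>\<Sum>n. d n * x n * p (x n)\<bar> < e / 2"
      using elim(2) se by (simp add: x_def dist_real_def abs_mult)
    moreover have "sqrt eps * \<bar>\<Sum>n. d n * x n * g (x n)\<bar> \<le> sqrt eps * \<bar>\<Sum>n. d n * x n * p (x n)\<bar> + sqrt eps * \<bar>\<Sum>n. d n * x n * (g (x n) - p (x n))\<bar>"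
      unfolding eq distrib_left[symmetric] using se by (intro mult_left_mono abs_triangle_ineq) auto
    ultimately show ?case using se by (simp add: x_def dist_real_def abs_mult)
  qed
qed

text \<open>
A tent over the interval between \<open>exp (- \<beta>)\<close> and \<open>exp (- \<alpha>)\<close>: in the variable \<open>exp (- n / N)\<close> it
selects the times \<open>n\<close> between \<open>\<alpha> N\<close> and \<open>\<beta> N\<close>. The last clause says that it sees a positive
fraction of \<open>N\<close> times, which is all that has to be known about its mass.
\<close>

lemma bump_exists:
  fixes \<alpha> \<beta> :: real
  assumes "0 \<le> \<alpha>" "\<alpha> < \<beta>"
  shows "\<exists>(g :: real \<Rightarrow> real) \<kappa>. continuous_on {0..1} g \<and> (\<forall>x. 0 \<le> g x) \<and> (\<forall>x. g x \<le> 1) \<and>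
    (\<forall>t. g (exp (- t)) \<noteq> 0 \<longrightarrow> \<alpha> < t \<and> t < \<beta>) \<and> \<kappa> > 0 \<and>
    eventually (\<lambda>N. \<kappa> * real N \<le>
       (\<Sum>n. exp (- (1 / real N) * real n) * g (exp (- (1 / real N) * real n)))) sequentially"
proof -
  define g where "g x = max 0 (min (x - exp (-\<beta>)) (exp (-\<alpha>) - x))" for x
  define \<alpha>' where "\<alpha>' = (2 * \<alpha> + \<beta>) / 3"
  define \<beta>' where "\<beta>' = (\<alpha> + 2 * \<beta>) / 3"
  have ab: "\<alpha> < \<alpha>'" "\<alpha>' < \<beta>'" "\<beta>' < \<beta>" "0 < \<alpha>'" using assms by (auto simp: \<alpha>'_def \<beta>'_def)
  define \<kappa>0 where "\<kappa>0 = exp (-\<beta>') * min (exp (-\<beta>') - exp (-\<beta>)) (exp (-\<alpha>) - exp (-\<alpha>'))"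
  have \<kappa>0: "\<kappa>0 > 0" using ab by (simp add: \<kappa>0_def)
  have g0: "0 \<le> g x" for x by (simp add: g_def)
  have g1: "g x \<le> 1" for x
  proof -
    have "min (x - exp (-\<beta>)) (exp (-\<alpha>) - x) \<le> 1"
    proof (cases "x \<le> 1")
      case True then show ?thesis using exp_gt_zero[of "-\<beta>"] by linarith
    next
      case False
      moreover have "exp (-\<alpha>) \<le> 1" using assms by simp
      ultimately show ?thesis by linarith
    qed
    then show ?thesis by (simp add: g_def)
  qed
  have low: "exp (-t) * g (exp (-t)) \<ge> \<kappa>0" if "\<alpha>' \<le> t" "t \<le> \<beta>'" for t
  proof -
    have "exp (-t) \<ge> exp (-\<beta>')" "exp (-t) \<le> exp (-\<alpha>')" using that by auto
    then have "g (exp (-t)) \<ge> min (exp (-\<beta>') - exp (-\<beta>)) (exp (-\<alpha>) - exp (-\<alpha>'))"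
      unfolding g_def by linarith
    then show ?thesis unfolding \<kappa>0_def using ab that by (intro mult_mono) auto
  qed
  have ev: "eventually (\<lambda>N. (\<kappa>0 * (\<beta>' - \<alpha>') / 2) * real N \<le>
       (\<Sum>n. exp (- (1 / real N) * real n) * g (exp (- (1 / real N) * real n)))) sequentially"
    using eventually_ge_at_top[of "nat \<lceil>2 / (\<beta>' - \<alpha>')\<rceil>"] eventually_gt_at_top[of 0]
  proof eventually_elim
    case (elim N)
    define w where "w n = exp (- (1 / real N) * real n) * g (exp (- (1 / real N) * real n))" for n
    define A where "A = {nat \<lceil>\<alpha>' * real N\<rceil>..nat \<lfloor>\<beta>' * real N\<rfloor>}"
    have sm: "summable w"
      using summable_bounded_exp[of "\<lambda>n. g (exp (- (1 / real N) * real n))" 1 "1 / real N"] g0 g1 elim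
      by (simp add: w_def[abs_def] mult.commute)
    have "2 / (\<beta>' - \<alpha>') \<le> real N" using elim(1) by linarith
    then have N2: "(\<beta>' - \<alpha>') * real N \<ge> 2" using ab by (simp add: field_simps)
    have nn: "0 \<le> \<alpha>' * real N" "0 \<le> \<beta>' * real N" using ab by auto
    have wA: "w n \<ge> \<kappa>0" if "n \<in> A" for n
    proof -
      have "\<alpha>' * real N \<le> real n" "real n \<le> \<beta>' * real N"
        using that nn unfolding A_def by (auto simp: nat_ceiling_le_eq le_nat_floor) linarith+
      then have "\<alpha>' \<le> real n / real N" "real n / real N \<le> \<beta>'" using elim by (auto simp: field_simps)
      from low[OF this] show ?thesis by (simp add: w_def)
    qed
    have "real (card A) \<ge> (\<beta>' - \<alpha>') * real N - 1"
    proof -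
      have "card A = Suc (nat \<lfloor>\<beta>' * real N\<rfloor>) - nat \<lceil>\<alpha>' * real N\<rceil>" by (simp add: A_def)
      then have "real (card A) \<ge> real (nat \<lfloor>\<beta>' * real N\<rfloor>) + 1 - real (nat \<lceil>\<alpha>' * real N\<rceil>)" by linarith
      moreover have "real (nat \<lfloor>\<beta>' * real N\<rfloor>) \<ge> \<beta>' * real N - 1" using nn by linarith
      moreover have "real (nat \<lceil>\<alpha>' * real N\<rceil>) \<le> \<alpha>' * real N + 1" using nn by linarith
      ultimately show ?thesis using N2 unfolding A_def by (simp add: left_diff_distrib) linarith
    qed
    then have "real (card A) \<ge> (\<beta>' - \<alpha>') * real N / 2" using N2 by linarith
    then have "\<kappa>0 * ((\<beta>' - \<alpha>') * real N / 2) \<le> \<kappa>0 * real (card A)"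
      using \<kappa>0 by (intro mult_left_mono) auto
    also have "\<dots> = (\<Sum>n\<in>A. \<kappa>0)" by simp
    also have "\<dots> \<le> (\<Sum>n\<in>A. w n)" by (rule sum_mono) (rule wA)
    also have "\<dots> \<le> (\<Sum>n. w n)"
      by (rule sum_le_suminf[OF sm]) (auto simp: A_def w_def g0)
    finally show ?case by (simp add: w_def)
  qed
  show ?thesis
  proof (intro exI[of _ g] exI[of _ "\<kappa>0 * (\<beta>' - \<alpha>') / 2"] conjI allI impI)
    show "continuous_on {0..1} g" unfolding g_def by (intro continuous_intros)
    show "\<alpha> < t" "t < \<beta>" if "g (exp (- t)) \<noteq> 0" for t
    proof -
      have "exp (- t) > exp (-\<beta>)" "exp (-\<alpha>) > exp (-t)" using that unfolding g_def by linarith+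
      then show "\<alpha> < t" "t < \<beta>" by simp_all
    qed
    show "\<kappa>0 * (\<beta>' - \<alpha>') / 2 > 0" using \<kappa>0 ab by simp
  qed (use g0 g1 ev in auto)
qed

lemma filterlim_inverse_nat_at_right: "filterlim (\<lambda>N. 1 / real N) (at_right 0) sequentially"
  unfolding filterlim_at
  by (auto intro!: tendsto_eq_intros lim_1_over_n eventually_sequentiallyI[of 1])

text \<open>
Karamata's Tauberian argument without the limit integrals: the sequence \<open>a\<close> is compared with a
sequence \<open>b\<close> whose asymptotics are known. Both have the same bump averages up to the factor \<open>B\<close>,
and monotonicity turns averages over the windows from \<open>\<theta> N\<close> to \<open>N\<close> and from \<open>N\<close> to \<open>\<theta> N\<close> into
pointwise bounds, which meet when \<open>\<theta>\<close> tends to 1.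
\<close>

lemma tauberian_comparison:
  fixes a b :: "nat \<Rightarrow> real"
  assumes a: "decseq a" "\<And>n. 0 \<le> a n" and b: "decseq b" "\<And>n. 0 \<le> b n"
    and B: "0 \<le> B"
    and lima: "(laplace a \<longlongrightarrow> B) (at_right 0)"
    and limb: "(laplace b \<longlongrightarrow> 1) (at_right 0)"
    and asy: "(\<lambda>n. sqrt (real n) * b n) \<longlonglongrightarrow> \<beta>"
  shows "(\<lambda>n. sqrt (real n) * a n) \<longlonglongrightarrow> B * \<beta>"
proof -
  have ba: "\<bar>a n\<bar> \<le> a 0" "\<bar>b n\<bar> \<le> b 0" for n
    using a b by (auto simp: decseq_def)
  define d where "d n = a n - B * b n" for n
  define h where "h n = a n + B * b n" for n
  have dh: "\<bar>d n\<bar> \<le> h n" "h n \<le> a 0 + B * b 0" for n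
  proof -
    have "0 \<le> B * b n" "B * b n \<le> B * b 0" using B b by (auto simp: decseq_def mult_left_mono)
    then show "\<bar>d n\<bar> \<le> h n" "h n \<le> a 0 + B * b 0"
      using a(2)[of n] a(1) by (auto simp: d_def h_def decseq_def add_mono)
  qed
  have lin: "((\<lambda>eps. sqrt eps * (\<Sum>n. (a n + C * b n) * exp (- eps * real n))) \<longlongrightarrow> B + C * 1) (at_right 0)" for C
  proof (rule Lim_transform_eventually)
    show "((\<lambda>eps. laplace a eps + C * laplace b eps)
      \<longlongrightarrow> B + C * 1) (at_right 0)"
      by (intro tendsto_intros lima limb)
    show "eventually (\<lambda>eps. laplace a eps + C * laplace b eps
      = sqrt eps * (\<Sum>n. (a n + C * b n) * exp (- eps * real n))) (at_right 0)"
      using eventually_pos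
    proof eventually_elim
      case (elim eps)
      have sa: "summable (\<lambda>n. a n * exp (- eps * real n))" and sb: "summable (\<lambda>n. b n * exp (- eps * real n))"
        using summable_bounded_exp[OF ba(1) elim] summable_bounded_exp[OF ba(2) elim] by auto
      have "(\<Sum>n. (a n + C * b n) * exp (- eps * real n))
          = (\<Sum>n. a n * exp (- eps * real n) + C * (b n * exp (- eps * real n)))"
        by (rule suminf_cong) (simp add: algebra_simps)
      also have "\<dots> = (\<Sum>n. a n * exp (- eps * real n)) + C * (\<Sum>n. b n * exp (- eps * real n))"
        using suminf_add[OF sa summable_mult[OF sb, of C]] suminf_mult[OF sb, of C] by simp
      finally show ?case by (simp add: algebra_simps)
    qed
  qed
  have limd: "(laplace d \<longlongrightarrow> 0) (at_right 0)"
    using lin[of "-B"] by (simp add: d_def)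
  have limh: "(laplace h \<longlongrightarrow> B + B * 1) (at_right 0)"
    using lin[of B] unfolding h_def .

  \<comment> \<open>Averaging both sequences against the same bump turns the limit for the Laplace sums into an
    inequality between a bound for one sequence and a bound for the other on the time window
    where the bump lives.\<close>
  have window: "\<exists>err. err \<longlonglongrightarrow> 0 \<and>
      (\<forall>u v. eventually (\<lambda>N.
          (\<forall>n. \<alpha> * real N < real n \<and> real n < \<gamma> * real N \<longrightarrow> u N \<le> a n \<and> b n \<le> v N) \<longrightarrow>
            sqrt (real N) * u N \<le> B * (sqrt (real N) * v N) + err N) sequentially) \<and>
      (\<forall>u v. eventually (\<lambda>N.
          (\<forall>n. \<alpha> * real N < real n \<and> real n < \<gamma> * real N \<longrightarrow> a n \<le> u N \<and> v N \<le> b n) \<longrightarrow>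
            B * (sqrt (real N) * v N) \<le> sqrt (real N) * u N + err N) sequentially)"
    if ag: "0 \<le> \<alpha>" "\<alpha> < \<gamma>" for \<alpha> \<gamma> :: real
  proof -
    obtain g \<kappa> where g: "continuous_on {0..1} g" "\<And>x. 0 \<le> g x" "\<And>x. g x \<le> 1"
      "\<And>t. g (exp (- t)) \<noteq> 0 \<Longrightarrow> \<alpha> < t \<and> t < \<gamma>" "\<kappa> > 0"
      "eventually (\<lambda>N. \<kappa> * real N \<le>
         (\<Sum>n. exp (- (1 / real N) * real n) * g (exp (- (1 / real N) * real n)))) sequentially"
      using bump_exists[OF ag] by blast
    define w where "w N n = exp (- (1 / real N) * real n) * g (exp (- (1 / real N) * real n))" for N n
    define D where "D N = (\<Sum>n. d n * w N n)" for N
    define err where "err N = \<bar>sqrt (1 / real N) * D N\<bar> / \<kappa>" for N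
    have "(\<lambda>N. sqrt (1 / real N) * D N) \<longlonglongrightarrow> 0"
      using filterlim_compose[OF laplace_continuous[OF dh limd limh g(1)] filterlim_inverse_nat_at_right]
      by (simp add: D_def w_def mult_ac)
    from tendsto_divide[OF tendsto_rabs[OF this] tendsto_const[of \<kappa>]]
    have "err \<longlonglongrightarrow> 0" using g(5) by (simp add: err_def[abs_def])
    moreover have both: "eventually (\<lambda>N.
          ((\<forall>n. \<alpha> * real N < real n \<and> real n < \<gamma> * real N \<longrightarrow> u N \<le> a n \<and> b n \<le> v N) \<longrightarrow>
            sqrt (real N) * u N \<le> B * (sqrt (real N) * v N) + err N) \<and>
          ((\<forall>n. \<alpha> * real N < real n \<and> real n < \<gamma> * real N \<longrightarrow> a n \<le> u N \<and> v N \<le> b n) \<longrightarrow>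
            B * (sqrt (real N) * v N) \<le> sqrt (real N) * u N + err N)) sequentially" for u v
      using g(6) eventually_gt_at_top[of 0]
    proof eventually_elim
      case (elim N)
      have e: "1 / real N > 0" using elim by simp
      define W where "W = (\<Sum>n. w N n)"
      have W: "\<kappa> * real N \<le> W" using elim(1) by (simp add: W_def w_def)
      have "0 < \<kappa> * real N" using g(5) elim(2) by simp
      then have W0: "W > 0" using W by linarith
      have w0: "w N n \<ge> 0" for n by (simp add: w_def g)
      have supp: "\<alpha> * real N < real n \<and> real n < \<gamma> * real N" if "w N n \<noteq> 0" for n
        using g(4)[of "real n / real N"] that elim by (auto simp: w_def field_simps)
      have sw: "summable (\<lambda>n. f n * w N n)" if "\<And>n. \<bar>f n\<bar> \<le> K" for f K
      proof -
        have "\<bar>f n * g (exp (- (1 / real N) * real n))\<bar> \<le> K * 1" for n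
          unfolding abs_mult using that[of n] g(2,3) by (intro mult_mono) auto
        from summable_bounded_exp[OF this e] show ?thesis by (simp add: w_def mult_ac)
      qed
      have sw1: "summable (w N)" using sw[of "\<lambda>_. 1" 1] by simp
      have sa: "summable (\<lambda>n. a n * w N n)" by (rule sw[OF ba(1)])
      have sb: "summable (\<lambda>n. b n * w N n)" by (rule sw[OF ba(2)])
      have sw1': "summable (\<lambda>n. C * w N n)" and const: "(\<Sum>n. C * w N n) = C * W" for C
        using summable_mult[OF sw1] suminf_mult[OF sw1] by (simp_all add: W_def)
      have avg: "(\<Sum>n. f n * w N n) \<le> (\<Sum>n. f' n * w N n)"
        if "\<And>n. \<alpha> * real N < real n \<and> real n < \<gamma> * real N \<Longrightarrow> f n \<le> f' n"
          "summable (\<lambda>n. f n * w N n)" "summable (\<lambda>n. f' n * w N n)" for f f'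
      proof (rule suminf_le[OF _ that(2,3)])
        show "f n * w N n \<le> f' n * w N n" for n
          using that(1)[of n] supp[of n] w0[of n] by (cases "w N n = 0") (auto intro: mult_right_mono)
      qed
      have D: "D N = (\<Sum>n. a n * w N n) - B * (\<Sum>n. b n * w N n)"
      proof -
        have "D N = (\<Sum>n. a n * w N n - B * (b n * w N n))"
          unfolding D_def by (rule suminf_cong) (simp add: d_def algebra_simps)
        then show ?thesis
          using suminf_diff[OF sa summable_mult[OF sb, of B]] suminf_mult[OF sb, of B] by simp
      qed
      have errW: "sqrt (real N) * (\<bar>D N\<bar> / W) \<le> err N"
      proof -
        have "sqrt (real N) * (\<bar>D N\<bar> / W) \<le> sqrt (real N) * (\<bar>D N\<bar> / (\<kappa> * real N))"
          using W W0 g(5) elim(2) by (intro mult_left_mono divide_left_mono) auto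
        also have "\<dots> = err N"
        proof -
          define r where "r = sqrt (real N)"
          have r: "r > 0" "real N = r * r" using elim(2) by (auto simp: r_def)
          have "sqrt (1 / real N) = 1 / r" by (simp add: r_def real_sqrt_divide)
          then have "err N = (\<bar>D N\<bar> / r) / \<kappa>" using r(1) by (simp add: err_def)
          also have "\<dots> = r * (\<bar>D N\<bar> / (\<kappa> * (r * r)))" using r(1) g(5) by (simp add: field_simps)
          finally show ?thesis unfolding r_def[symmetric] r(2)[symmetric] by simp
        qed
        finally show ?thesis .
      qed
      show ?case
      proof (intro conjI impI)
        assume H: "\<forall>n. \<alpha> * real N < real n \<and> real n < \<gamma> * real N \<longrightarrow> u N \<le> a n \<and> b n \<le> v N"
        have "u N * W \<le> (\<Sum>n. a n * w N n)"
          unfolding const[symmetric] using H by (intro avg sw1' sa) blast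
        moreover have "(\<Sum>n. b n * w N n) \<le> v N * W"
          unfolding const[symmetric] using H by (intro avg sw1' sb) blast
        then have "B * (\<Sum>n. b n * w N n) \<le> B * (v N * W)" using B by (rule mult_left_mono)
        ultimately have "u N * W \<le> B * (v N * W) + \<bar>D N\<bar>" using D by linarith
        then have "u N \<le> B * v N + \<bar>D N\<bar> / W" using W0 by (simp add: field_simps)
        then have "sqrt (real N) * u N \<le> sqrt (real N) * (B * v N + \<bar>D N\<bar> / W)"
          by (rule mult_left_mono) simp
        then show "sqrt (real N) * u N \<le> B * (sqrt (real N) * v N) + err N"
          using errW unfolding distrib_left by (simp add: mult_ac)
      next
        assume H: "\<forall>n. \<alpha> * real N < real n \<and> real n < \<gamma> * real N \<longrightarrow> a n \<le> u N \<and> v N \<le> b n"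
        have "(\<Sum>n. a n * w N n) \<le> u N * W"
          unfolding const[symmetric] using H by (intro avg sw1' sa) blast
        moreover have "v N * W \<le> (\<Sum>n. b n * w N n)"
          unfolding const[symmetric] using H by (intro avg sw1' sb) blast
        then have "B * (v N * W) \<le> B * (\<Sum>n. b n * w N n)" using B by (rule mult_left_mono)
        ultimately have "B * (v N * W) \<le> u N * W + \<bar>D N\<bar>" using D by linarith
        then have "B * v N \<le> u N + \<bar>D N\<bar> / W" using W0 by (simp add: field_simps)
        then have "sqrt (real N) * (B * v N) \<le> sqrt (real N) * (u N + \<bar>D N\<bar> / W)"
          by (rule mult_left_mono) simp
        then show "B * (sqrt (real N) * v N) \<le> sqrt (real N) * u N + err N"
          using errW unfolding distrib_left by (simp add: mult_ac)
      qed
    qed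
    ultimately show ?thesis
      using both[unfolded eventually_conj_iff, THEN conjunct1] both[unfolded eventually_conj_iff, THEN conjunct2]
      by (intro exI[of _ err] conjI allI)
  qed
  have scaled: "(\<lambda>N. sqrt (real N) * b (k N)) \<longlonglongrightarrow> \<beta> / sqrt \<theta>"
    if "\<theta> > 0" "\<And>N. \<bar>real (k N) - \<theta> * real N\<bar> \<le> 1" for \<theta> :: real and k :: "nat \<Rightarrow> nat"
  proof -
    have ratio: "(\<lambda>N. real (k N) / real N) \<longlonglongrightarrow> \<theta>"
    proof (rule LIM_zero_cancel, rule Lim_null_comparison)
      show "eventually (\<lambda>N. norm (real (k N) / real N - \<theta>) \<le> 1 / real N) sequentially"
        using eventually_gt_at_top[of 0]
      proof eventually_elim
        case (elim N)
        then have "real (k N) / real N - \<theta> = (real (k N) - \<theta> * real N) / real N" by (simp add: field_simps)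
        then show ?case using that(2)[of N] elim by (simp add: divide_right_mono)
      qed
      show "(\<lambda>N. 1 / real N) \<longlonglongrightarrow> 0" by (rule lim_1_over_n)
    qed
    have "filterlim (\<lambda>N. real (k N)) at_top sequentially"
    proof (rule filterlim_at_top_mono)
      show "filterlim (\<lambda>N. - 1 + \<theta> * real N) at_top sequentially"
        by (intro filterlim_tendsto_add_at_top[OF tendsto_const]
            filterlim_tendsto_pos_mult_at_top[OF tendsto_const that(1)] filterlim_real_sequentially)
      show "eventually (\<lambda>N. - 1 + \<theta> * real N \<le> real (k N)) sequentially"
        using that(2) by (intro always_eventually allI) (smt (verit))
    qed
    then have kt: "filterlim k at_top sequentially"
      by (simp add: filterlim_sequentially_iff_filterlim_real)
    have "(\<lambda>N. (sqrt (real (k N)) * b (k N)) / sqrt (real (k N) / real N)) \<longlonglongrightarrow> \<beta> / sqrt \<theta>"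
      by (intro tendsto_intros filterlim_compose[OF asy kt] ratio) (use that in auto)
    moreover have "eventually (\<lambda>N. (sqrt (real (k N)) * b (k N)) / sqrt (real (k N) / real N) = sqrt (real N) * b (k N)) sequentially"
      using filterlim_at_top[THEN iffD1, OF kt, THEN spec, of 1]
      by eventually_elim (simp add: real_sqrt_divide)
    ultimately show ?thesis by (rule Lim_transform_eventually)
  qed
  have beta0: "\<beta> \<ge> 0" by (rule LIMSEQ_le_const[OF asy]) (use b in auto)
  have cont: "((\<lambda>\<theta>. B * (\<beta> / sqrt \<theta>)) \<longlongrightarrow> B * (\<beta> / sqrt 1)) (at 1)"
    by (intro tendsto_intros) auto
  show ?thesis
  proof (rule order_tendstoI)
    fix y assume y: "B * \<beta> < y"
    have "eventually (\<lambda>\<theta>. B * (\<beta> / sqrt \<theta>) < y) (at_left 1)"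
      using order_tendstoD(2)[OF cont, of y] y by (simp add: eventually_at_split)
    moreover have "eventually (\<lambda>\<theta>::real. \<theta> \<in> {0<..<1}) (at_left 1)"
      by (rule eventually_at_leftI[of 0]) auto
    ultimately have "\<exists>\<theta>. B * (\<beta> / sqrt \<theta>) < y \<and> \<theta> \<in> {0<..<1}"
      using eventually_happens'[OF trivial_limit_at_left_real eventually_conj] by blast
    then obtain \<theta> where \<theta>: "B * (\<beta> / sqrt \<theta>) < y" "0 < \<theta>" "\<theta> < 1" by auto
    \<comment> \<open>\<open>b (k N)\<close> bounds \<open>b\<close> from above on the window from \<open>\<theta> N\<close> to \<open>N\<close>.\<close>
    define k where "k N = nat \<lfloor>\<theta> * real N\<rfloor>" for N
    have k: "\<bar>real (k N) - \<theta> * real N\<bar> \<le> 1" for N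
    proof -
      have "0 \<le> \<theta> * real N" using \<theta> by simp
      then show ?thesis unfolding k_def by linarith
    qed
    obtain err where err: "err \<longlonglongrightarrow> 0" and W: "\<And>u v. eventually (\<lambda>N.
          (\<forall>n. \<theta> * real N < real n \<and> real n < 1 * real N \<longrightarrow> u N \<le> a n \<and> b n \<le> v N) \<longrightarrow>
            sqrt (real N) * u N \<le> B * (sqrt (real N) * v N) + err N) sequentially"
      using window[OF less_imp_le[OF \<theta>(2)] \<theta>(3)] by blast
    have "(\<lambda>N. B * (sqrt (real N) * b (k N)) + err N) \<longlonglongrightarrow> B * (\<beta> / sqrt \<theta>) + 0"
      by (intro tendsto_intros scaled[OF \<theta>(2) k] err)
    then have "eventually (\<lambda>N. B * (sqrt (real N) * b (k N)) + err N < y) sequentially"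
      by (rule order_tendstoD) (use \<theta> in simp)
    then show "eventually (\<lambda>N. sqrt (real N) * a N < y) sequentially"
      using W[of a "\<lambda>N. b (k N)"]
    proof eventually_elim
      case (elim N)
      have "\<forall>n. \<theta> * real N < real n \<and> real n < 1 * real N \<longrightarrow> a N \<le> a n \<and> b n \<le> b (k N)"
      proof (intro allI impI conjI)
        fix n assume n: "\<theta> * real N < real n \<and> real n < 1 * real N"
        then show "a N \<le> a n" using a(1) by (simp add: decseq_def)
        have "k N \<le> n" unfolding k_def using n by linarith
        then show "b n \<le> b (k N)" using b(1) by (simp add: decseq_def)
      qed
      from mp[OF elim(2) this] elim(1) show ?case by linarith
    qed
  next
    fix y assume y: "y < B * \<beta>"
    have "eventually (\<lambda>\<theta>. B * (\<beta> / sqrt \<theta>) > y) (at_right 1)"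
      using order_tendstoD(1)[OF cont, of y] y by (simp add: eventually_at_split)
    moreover have "eventually (\<lambda>\<theta>::real. \<theta> \<in> {1<..<2}) (at_right 1)"
      by (rule eventually_at_rightI[of _ 2]) auto
    ultimately have "\<exists>\<theta>. B * (\<beta> / sqrt \<theta>) > y \<and> \<theta> \<in> {1<..<2}"
      using eventually_happens'[OF trivial_limit_at_right_real eventually_conj] by blast
    then obtain \<theta> where \<theta>: "B * (\<beta> / sqrt \<theta>) > y" "1 < \<theta>" by auto
    \<comment> \<open>\<open>b (k N)\<close> bounds \<open>b\<close> from below on the window from \<open>N\<close> to \<open>\<theta> N\<close>.\<close>
    define k where "k N = nat \<lceil>\<theta> * real N\<rceil>" for N
    have \<theta>0: "\<theta> > 0" using \<theta> by simp
    have k: "\<bar>real (k N) - \<theta> * real N\<bar> \<le> 1" for N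
    proof -
      have "0 \<le> \<theta> * real N" using \<theta> by simp
      then show ?thesis unfolding k_def by linarith
    qed
    obtain err where err: "err \<longlonglongrightarrow> 0" and W: "\<And>u v. eventually (\<lambda>N.
          (\<forall>n. 1 * real N < real n \<and> real n < \<theta> * real N \<longrightarrow> a n \<le> u N \<and> v N \<le> b n) \<longrightarrow>
            B * (sqrt (real N) * v N) \<le> sqrt (real N) * u N + err N) sequentially"
      using window[OF zero_le_one \<theta>(2)] by blast
    have "(\<lambda>N. B * (sqrt (real N) * b (k N)) - err N) \<longlonglongrightarrow> B * (\<beta> / sqrt \<theta>) - 0"
      by (intro tendsto_intros scaled[OF \<theta>0 k] err)
    then have "eventually (\<lambda>N. B * (sqrt (real N) * b (k N)) - err N > y) sequentially"
      by (rule order_tendstoD) (use \<theta> in simp)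
    then show "eventually (\<lambda>N. sqrt (real N) * a N > y) sequentially"
      using W[of a "\<lambda>N. b (k N)"]
    proof eventually_elim
      case (elim N)
      have "\<forall>n. 1 * real N < real n \<and> real n < \<theta> * real N \<longrightarrow> a n \<le> a N \<and> b (k N) \<le> b n"
      proof (intro allI impI conjI)
        fix n assume n: "1 * real N < real n \<and> real n < \<theta> * real N"
        then show "a n \<le> a N" using a(1) by (simp add: decseq_def)
        have "n \<le> k N" unfolding k_def using n by linarith
        then show "b (k N) \<le> b n" using b(1) by (simp add: decseq_def)
      qed
      from mp[OF elim(2) this] elim(1) show ?case by linarith
    qed
  qed
qed

text \<open>
The comparison sequence consists of the absolute values of the binomial coefficients of exponent
\<open>-1/2\<close>: its generating function is \<open>(1 - z) powr (-1/2)\<close>, and \<open>\<Gamma>(1/2) = sqrt \<pi>\<close> gives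
\<open>1 / sqrt (\<pi> n)\<close> for its terms. This is where the constant \<open>\<pi>\<close> of the theorem comes from.
\<close>

lemma tauberian_sqrt:
  fixes a :: "nat \<Rightarrow> real"
  assumes a: "decseq a" "\<And>n. 0 \<le> a n"
    and lima: "(laplace a \<longlongrightarrow> B) (at_right 0)"
  shows "(\<lambda>n. sqrt (real n) * a n) \<longlonglongrightarrow> B / sqrt pi"
proof -
  define b :: "nat \<Rightarrow> real" where "b n = pochhammer (1/2) n / fact n" for n
  have gb: "(-1/2) gchoose n = (-1) ^ n * b n" for n
    by (simp add: gbinomial_pochhammer b_def)
  have b0: "0 \<le> b n" for n by (simp add: b_def pochhammer_nonneg)
  have bdec: "decseq b"
  proof (rule decseq_SucI)
    fix n
    have "b (Suc n) = b n * ((1/2 + real n) / (1 + real n))"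
      by (simp add: b_def pochhammer_Suc field_simps)
    also have "\<dots> \<le> b n * 1" by (rule mult_left_mono) (auto simp: b0)
    finally show "b (Suc n) \<le> b n" by simp
  qed
  have asy: "(\<lambda>n. sqrt (real n) * b n) \<longlonglongrightarrow> 1 / sqrt pi"
  proof (rule Lim_transform_eventually)
    show "(\<lambda>n. ((-1/2::real) gchoose n) / ((-1)^n / exp ((-1/2+1) * of_real (ln (real n))))) \<longlonglongrightarrow> 1 / sqrt pi"
      using gbinomial_asymptotic[of "-1/2::real"] by (simp add: Gamma_one_half_real inverse_eq_divide)
    show "eventually (\<lambda>n. ((-1/2::real) gchoose n) / ((-1)^n / exp ((-1/2+1) * of_real (ln (real n)))) = sqrt (real n) * b n) sequentially"
      using eventually_gt_at_top[of 0]
    proof eventually_elim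
      case (elim n)
      have "exp ((-1/2+1) * ln (real n)) = sqrt (real n)"
        using elim by (simp add: powr_half_sqrt[symmetric] powr_def)
      then show ?case unfolding gb by simp
    qed
  qed
  have gf: "(\<Sum>n. b n * exp (- eps * real n)) = (1 - exp (-eps)) powr (-1/2)" if "eps > 0" for eps :: real
  proof -
    have "(\<lambda>n. ((-1/2) gchoose n) * (- exp (-eps)) ^ n) sums (1 + - exp (-eps)) powr (-1/2)"
      by (rule gen_binomial_real) (use that in simp)
    moreover have "(\<lambda>n. ((-1/2) gchoose n) * (- exp (-eps)) ^ n) = (\<lambda>n. b n * exp (- eps * real n))"
    proof
      fix n
      have "(- exp (-eps)) ^ n = (-1) ^ n * exp (- eps * real n)"
        by (subst power_minus) (simp add: exp_of_nat_mult[symmetric] mult.commute)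
      then show "((-1/2) gchoose n) * (- exp (-eps)) ^ n = b n * exp (- eps * real n)"
        unfolding gb by (simp add: mult_ac power_mult_distrib[symmetric])
    qed
    ultimately show ?thesis by (simp add: sums_iff)
  qed
  have limb: "(laplace b \<longlongrightarrow> 1) (at_right 0)"
  proof (rule Lim_transform_eventually)
    show "((\<lambda>eps::real. sqrt eps * (1 - exp (-eps)) powr (-1/2)) \<longlongrightarrow> 1) (at_right 0)"
      by real_asymp
    show "eventually (\<lambda>eps. sqrt eps * (1 - exp (-eps)) powr (-1/2) = laplace b eps) (at_right 0)"
      using eventually_pos by eventually_elim (metis gf)
  qed
  have "B \<ge> 0"
  proof (rule tendsto_lowerbound[OF lima])
    show "eventually (\<lambda>eps. 0 \<le> laplace a eps) (at_right 0)"
      using eventually_pos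
    proof eventually_elim
      case (elim eps)
      have "\<bar>a n\<bar> \<le> a 0" for n using a by (auto simp: decseq_def)
      from summable_bounded_exp[OF this elim] show ?case
        using elim a by (intro mult_nonneg_nonneg suminf_nonneg) auto
    qed
  qed simp
  from tauberian_comparison[OF a bdec b0 this lima limb asy] show ?thesis by simp
qed

section \<open>Variational principles on a half-line\<close>

abbreviation has_mean :: "(nat \<Rightarrow> real) \<Rightarrow> real \<Rightarrow> bool" where
  "has_mean b \<beta> \<equiv> (\<lambda>n. (\<Sum>i<n. b i) / real n) \<longlonglongrightarrow> \<beta>"

lemma linear_bounds:
  fixes a :: "nat \<Rightarrow> real"
  assumes "(\<lambda>n. a n / real n) \<longlonglongrightarrow> \<alpha>" "\<delta> > 0"
  shows "\<exists>K\<ge>0. \<forall>n. (\<alpha> - \<delta>) * real n - K \<le> a n \<and> a n \<le> (\<alpha> + \<delta>) * real n + K"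
proof -
  obtain N where N: "\<And>n. n \<ge> N \<Longrightarrow> norm (a n / real n - \<alpha>) < \<delta>"
    using LIMSEQ_D[OF assms] by blast
  define K where "K = (\<Sum>i\<le>N. \<bar>a i\<bar> + \<bar>\<alpha> * real i\<bar>)"
  have K0: "K \<ge> 0" by (auto simp: K_def intro: sum_nonneg)
  have main: "\<bar>a n - \<alpha> * real n\<bar> \<le> \<delta> * real n + K" for n
  proof (cases "n \<le> N")
    case True
    have "\<bar>a n\<bar> + \<bar>\<alpha> * real n\<bar> \<le> K" unfolding K_def by (rule member_le_sum) (use True in auto)
    moreover have "0 \<le> \<delta> * real n" using assms by simp
    ultimately show ?thesis by linarith
  next
    case False
    then have n: "real n > 0" "N \<le> n" by auto
    have "a n - \<alpha> * real n = (a n / real n - \<alpha>) * real n"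
      using n by (simp add: field_simps)
    then have "\<bar>a n - \<alpha> * real n\<bar> = \<bar>a n / real n - \<alpha>\<bar> * real n"
      by (simp add: abs_mult)
    also have "\<dots> \<le> \<delta> * real n" using N[OF n(2)] n by (intro mult_right_mono) auto
    finally show ?thesis using K0 by simp
  qed
  have "(\<alpha> - \<delta>) * real n - K \<le> a n \<and> a n \<le> (\<alpha> + \<delta>) * real n + K" for n
    using main[of n] unfolding abs_le_iff left_diff_distrib distrib_right by linarith
  then show ?thesis using K0 by blast
qed

lemma linear_growth_at_top:
  fixes a :: "nat \<Rightarrow> real"
  assumes "(\<lambda>n. a n / real n) \<longlonglongrightarrow> \<alpha>" "\<alpha> > 0"
  shows "filterlim a at_top sequentially"
proof -
  obtain K where K: "\<And>n. (\<alpha> - \<alpha>/2) * real n - K \<le> a n"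
    using linear_bounds[OF assms(1) half_gt_zero[OF assms(2)]] by blast
  have "filterlim (\<lambda>n. - K + (\<alpha>/2) * real n) at_top sequentially"
    by (intro filterlim_tendsto_add_at_top[OF tendsto_const]
        filterlim_tendsto_pos_mult_at_top[OF tendsto_const _ filterlim_real_sequentially])
       (use assms in simp)
  then show ?thesis
  proof (rule filterlim_at_top_mono)
    have "- K + (\<alpha>/2) * real n \<le> a n" for n using K[of n] by simp
    then show "eventually (\<lambda>n. - K + (\<alpha>/2) * real n \<le> a n) sequentially" by simp
  qed
qed

text \<open>
Summation by parts, with the partial sums of \<open>b\<close> replaced by their linear bound.
\<close>

lemma weighted_sum_le:
  fixes b :: "nat \<Rightarrow> real"
  assumes B: "\<And>n. (\<Sum>i<n. b i) \<le> \<gamma> * real n + K" and z: "0 \<le> z" "z \<le> 1"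
  shows "(\<Sum>i<N. b i * z ^ i) \<le> K + \<gamma> * (\<Sum>i<N. z ^ i)"
proof -
  have parts: "(\<Sum>i<N. d i * z ^ i) = (\<Sum>i<N. d i) * z ^ N + (\<Sum>i<N. (\<Sum>j<Suc i. d j) * (z ^ i - z ^ Suc i))" for d :: "nat \<Rightarrow> real"
    by (induction N) (auto simp: algebra_simps)
  have z': "z ^ Suc i \<le> z ^ i" for i using z by (simp add: mult_left_le_one_le)
  have tel: "(\<Sum>i<N. z ^ i - z ^ Suc i) = 1 - z ^ N" by (induction N) auto
  have "(\<Sum>i<N. b i * z ^ i) \<le> ((\<Sum>i<N. \<gamma>) + K) * z ^ N + (\<Sum>i<N. ((\<Sum>j<Suc i. \<gamma>) + K) * (z ^ i - z ^ Suc i))"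
    unfolding parts
  proof (intro add_mono sum_mono mult_right_mono)
    show "(\<Sum>i<N. b i) \<le> (\<Sum>i<N. \<gamma>) + K" using B[of N] by (simp add: mult.commute)
    fix i show "(\<Sum>i<Suc i. b i) \<le> (\<Sum>i<Suc i. \<gamma>) + K" using B[of "Suc i"] by (simp add: mult.commute algebra_simps)
    show "0 \<le> z ^ i - z ^ Suc i" using z'[of i] by simp
  qed (use z in auto)
  also have "\<dots> = (\<Sum>i<N. \<gamma> * z ^ i) + K * (z ^ N + (\<Sum>i<N. z ^ i - z ^ Suc i))"
    unfolding parts[of "\<lambda>_. \<gamma>"] by (simp only: distrib_right sum.distrib sum_distrib_left distrib_left)
  also have "\<dots> = K + \<gamma> * (\<Sum>i<N. z ^ i)" unfolding tel by (simp add: sum_distrib_left)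
  finally show ?thesis .
qed

text \<open>
An Abelian estimate: if \<open>a n\<close> grows like \<open>\<alpha> n\<close> and \<open>b\<close> has mean \<open>\<beta>\<close>, then the sum behaves at most
like the integral of \<open>\<beta> exp (- eps \<alpha> t)\<close>. Bounding all finite sums avoids any discussion of
convergence.
\<close>

lemma laplace_upper_bound:
  fixes a b :: "nat \<Rightarrow> real"
  assumes b: "\<And>n. 0 \<le> b n" and a: "(\<lambda>n. a n / real n) \<longlonglongrightarrow> \<alpha>" "\<alpha> > 0"
    and B: "has_mean b \<beta>" and \<eta>: "\<eta> > 0"
  shows "eventually (\<lambda>eps. \<forall>N. eps * (\<Sum>i<N. b i * exp (- eps * a i)) \<le> \<beta> / \<alpha> + \<eta>) (at_right 0)"
proof -
  have b0: "\<beta> \<ge> 0" by (rule LIMSEQ_le_const[OF B]) (use b in \<open>auto intro!: divide_nonneg_nonneg sum_nonneg\<close>)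
  have "((\<lambda>\<delta>. (\<beta> + \<delta>) / (\<alpha> - \<delta>)) \<longlongrightarrow> (\<beta> + 0) / (\<alpha> - 0)) (at_right 0)"
    by (intro tendsto_intros) (use a in auto)
  then have "eventually (\<lambda>\<delta>. (\<beta> + \<delta>) / (\<alpha> - \<delta>) < \<beta> / \<alpha> + \<eta>) (at_right 0)"
    by (rule order_tendstoD) (use \<eta> in simp)
  moreover have "eventually (\<lambda>\<delta>. \<delta> \<in> {0<..<\<alpha>}) (at_right 0)"
    by (rule eventually_at_right_real) (use a in simp)
  ultimately have "eventually (\<lambda>\<delta>. (\<beta> + \<delta>) / (\<alpha> - \<delta>) < \<beta> / \<alpha> + \<eta> \<and> \<delta> \<in> {0<..<\<alpha>}) (at_right 0)"
    by (rule eventually_conj)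
  from eventually_happens'[OF trivial_limit_at_right_real this]
  obtain \<delta> where \<delta>: "(\<beta> + \<delta>) / (\<alpha> - \<delta>) < \<beta> / \<alpha> + \<eta>" "0 < \<delta>" "\<delta> < \<alpha>" by auto
  obtain K1 where K1: "K1 \<ge> 0" "\<And>n. (\<alpha> - \<delta>) * real n - K1 \<le> a n"
    using linear_bounds[OF a(1) \<delta>(2)] by blast
  obtain K2 where K2: "K2 \<ge> 0" "\<And>n. (\<Sum>i<n. b i) \<le> (\<beta> + \<delta>) * real n + K2"
    using linear_bounds[OF B \<delta>(2)] by blast
  define \<kappa> where "\<kappa> = \<alpha> - \<delta>"
  have \<kappa>: "\<kappa> > 0" using \<delta> by (simp add: \<kappa>_def)
  have "((\<lambda>eps. eps / (1 - exp (- (\<kappa> * eps)))) \<longlongrightarrow> inverse \<kappa>) (at_right 0)"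
    using \<kappa> by real_asymp
  then have "((\<lambda>eps. exp (eps * K1) * (eps * K2 + (\<beta> + \<delta>) * (eps / (1 - exp (- (\<kappa> * eps)))))) \<longlongrightarrow>
     exp (0 * K1) * (0 * K2 + (\<beta> + \<delta>) * inverse \<kappa>)) (at_right 0)"
    by (intro tendsto_intros)
  then have "eventually (\<lambda>eps. exp (eps * K1) * (eps * K2 + (\<beta> + \<delta>) * (eps / (1 - exp (- (\<kappa> * eps))))) < \<beta> / \<alpha> + \<eta>) (at_right 0)"
    by (rule order_tendstoD) (use \<delta> in \<open>simp add: \<kappa>_def divide_inverse\<close>)
  then show ?thesis using eventually_pos
  proof eventually_elim
    case (elim eps)
    define z where "z = exp (- (\<kappa> * eps))"
    have z: "0 < z" "z < 1" using \<kappa> elim by (auto simp: z_def)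
    show ?case
    proof
      fix N
      have "(\<Sum>i<N. b i * exp (- eps * a i)) \<le> (\<Sum>i<N. exp (eps * K1) * (b i * z ^ i))"
      proof (rule sum_mono)
        fix i
        have "- eps * a i \<le> - eps * (\<kappa> * real i - K1)"
          using K1(2)[of i] elim by (simp add: \<kappa>_def)
        then have "exp (- eps * a i) \<le> exp (eps * K1 + real i * (- (\<kappa> * eps)))" by (simp add: algebra_simps)
        also have "\<dots> = exp (eps * K1) * z ^ i" unfolding z_def exp_add exp_of_nat_mult ..
        finally show "b i * exp (- eps * a i) \<le> exp (eps * K1) * (b i * z ^ i)"
          using b[of i] by (metis mult.left_commute mult_left_mono)
      qed
      also have "\<dots> = exp (eps * K1) * (\<Sum>i<N. b i * z ^ i)" by (simp add: sum_distrib_left)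
      also have "\<dots> \<le> exp (eps * K1) * (K2 + (\<beta> + \<delta>) * (\<Sum>i<N. z ^ i))"
        by (intro mult_left_mono weighted_sum_le K2) (use z in auto)
      also have "\<dots> \<le> exp (eps * K1) * (K2 + (\<beta> + \<delta>) * (1 / (1 - z)))"
      proof -
        have "(\<Sum>i<N. z ^ i) = (1 - z ^ N) / (1 - z)" using z by (subst geometric_sum) (auto simp: field_simps)
        also have "\<dots> \<le> 1 / (1 - z)" using z by (intro divide_right_mono) auto
        finally show ?thesis using b0 \<delta> by (intro mult_left_mono add_left_mono) auto
      qed
      finally have "eps * (\<Sum>i<N. b i * exp (- eps * a i)) \<le> eps * (exp (eps * K1) * (K2 + (\<beta> + \<delta>) * (1 / (1 - z))))"
        using elim(2) by (intro mult_left_mono) auto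
      also have "\<dots> = exp (eps * K1) * (eps * K2 + (\<beta> + \<delta>) * (eps / (1 - z)))" by (simp add: algebra_simps)
      also have "\<dots> < \<beta> / \<alpha> + \<eta>" using elim(1) by (simp add: z_def)
      finally show "eps * (\<Sum>i<N. b i * exp (- eps * a i)) \<le> \<beta> / \<alpha> + \<eta>" by simp
    qed
  qed
qed

definition flux :: "(nat \<Rightarrow> real) \<Rightarrow> (nat \<Rightarrow> real) \<Rightarrow> nat \<Rightarrow> real" where
  "flux k u n = k n * (u n - u (Suc n))"

text \<open>
The restriction to a half-line of a solution of the resolvent equation with killing rate \<open>\<mu>\<close>:
\<open>u\<close> is a voltage, \<open>k n\<close> the conductance of the edge between the sites \<open>n\<close> and \<open>n + 1\<close>, and \<open>m n\<close> the
weight of site \<open>n + 1\<close>, through which current leaks at rate \<open>\<mu> * m n\<close>. The ratio \<open>flux k u 0 / u 0\<close>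
is the effective conductance of the half-line.
\<close>

definition resolvent_on_ray :: "(nat \<Rightarrow> real) \<Rightarrow> (nat \<Rightarrow> real) \<Rightarrow> real \<Rightarrow> (nat \<Rightarrow> real) \<Rightarrow> bool" where
  "resolvent_on_ray k m \<mu> u \<longleftrightarrow> 0 < u 0 \<and> (\<forall>n. 0 \<le> u n) \<and> (\<forall>n. 0 \<le> flux k u n) \<and>
     (\<forall>n. flux k u n - flux k u (Suc n) = \<mu> * m n * u (Suc n))"

lemma young_ineq:
  fixes a b :: real assumes "\<kappa> > 0" "w > 0"
  shows "2 * (a * b) \<le> \<kappa> * (b\<^sup>2 / w) + w * a\<^sup>2 / \<kappa>"
proof -
  have "0 \<le> (\<kappa> * b - w * a)\<^sup>2 / (\<kappa> * w)" using assms by simp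
  also have "\<dots> = \<kappa> * (b\<^sup>2 / w) + w * a\<^sup>2 / \<kappa> - 2 * (a * b)"
    using assms by (simp add: power2_eq_square field_simps)
  finally show ?thesis by simp
qed

lemma young_ineq':
  fixes a b :: real assumes "\<kappa> > 0" "w > 0"
  shows "2 * (w * a * b) \<le> \<kappa> * (w * b\<^sup>2) + w * a\<^sup>2 / \<kappa>"
  using young_ineq[OF assms, of a "w * b"] assms by (simp add: power2_eq_square mult_ac)

lemma sum_affine_combination:
  fixes A B :: "nat \<Rightarrow> real"
  shows "(\<Sum>n<N. \<kappa> * A n + B n / w) = \<kappa> * (\<Sum>n<N. A n) + (\<Sum>n<N. B n) / w"
  by (simp add: sum.distrib sum_distrib_left sum_divide_distrib)

context
  fixes k m :: "nat \<Rightarrow> real" and \<mu> :: real and u :: "nat \<Rightarrow> real"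
  assumes k: "\<And>n. 0 < k n" and m: "\<And>n. 0 < m n" and \<mu>: "0 < \<mu>"
    and u: "resolvent_on_ray k m \<mu> u"
begin

lemma ray_facts: "0 < u 0" "0 \<le> u n" "0 \<le> flux k u n"
  "flux k u n - flux k u (Suc n) = \<mu> * m n * u (Suc n)"
  using u by (auto simp: resolvent_on_ray_def)

lemma ray_flux_le: "flux k u n \<le> flux k u 0"
proof (induction n)
  case (Suc n)
  have "0 \<le> \<mu> * m n * u (Suc n)" using \<mu> m[of n] ray_facts(2)[of "Suc n"] by simp
  then show ?case using Suc ray_facts(4)[of n] by linarith
qed simp

lemma ray_u_le: "u n \<le> u 0"
proof (induction n)
  case (Suc n)
  have "0 \<le> u n - u (Suc n)" using ray_facts(3)[of n] k[of n] by (simp add: flux_def zero_le_mult_iff)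
  then show ?case using Suc by simp
qed simp

text \<open>
The sum telescopes to \<open>flux k u 0 * u 0 - flux k u N * u N\<close>.
\<close>

lemma ray_energy: "(\<Sum>n<N. k n * (u n - u (Suc n))\<^sup>2 + \<mu> * m n * (u (Suc n))\<^sup>2) \<le> flux k u 0 * u 0"
proof -
  have "(\<Sum>n<N. k n * (u n - u (Suc n))\<^sup>2 + \<mu> * m n * (u (Suc n))\<^sup>2) = flux k u 0 * u 0 - flux k u N * u N"
  proof (induction N)
    case (Suc N)
    have "k N * (u N - u (Suc N))\<^sup>2 = flux k u N * (u N - u (Suc N))"
      by (simp add: flux_def power2_eq_square)
    moreover have "\<mu> * m N * (u (Suc N))\<^sup>2 = (flux k u N - flux k u (Suc N)) * u (Suc N)"
      unfolding ray_facts(4) by (simp add: power2_eq_square)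
    ultimately show ?case using Suc by (simp add: algebra_simps)
  qed simp
  moreover have "0 \<le> flux k u N * u N" using ray_facts by simp
  ultimately show ?thesis by simp
qed

text \<open>
Dirichlet principle: every test voltage bounds the effective conductance from above. Pairing the
test function with the solution gives \<open>flux k u 0\<close> by summation by parts, and Young's inequality
with parameter \<open>u 0\<close> separates the two energies.
\<close>

lemma ray_dirichlet_principle:
  assumes f: "f 0 = 1" "f \<longlonglongrightarrow> 0"
    and D: "\<And>N. (\<Sum>n<N. k n * (f n - f (Suc n))\<^sup>2 + \<mu> * m n * (f (Suc n))\<^sup>2) \<le> D"
  shows "flux k u 0 \<le> D * u 0"
proof -
  let ?J = "flux k u"
  have "2 * (?J 0 - ?J N * f N) \<le> u 0 * D + ?J 0" for N
  proof -
    have "?J 0 - ?J N * f N = (\<Sum>n<N. ?J n * (f n - f (Suc n)) + (?J n - ?J (Suc n)) * f (Suc n))"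
      using f(1) by (induction N) (auto simp: algebra_simps)
    then have "2 * (?J 0 - ?J N * f N) = (\<Sum>n<N. 2 * (?J n * (f n - f (Suc n))) + 2 * ((?J n - ?J (Suc n)) * f (Suc n)))"
      by (simp add: sum_distrib_left distrib_left)
    also have "\<dots> \<le> (\<Sum>n<N. u 0 * (k n * (f n - f (Suc n))\<^sup>2 + \<mu> * m n * (f (Suc n))\<^sup>2)
        + (k n * (u n - u (Suc n))\<^sup>2 + \<mu> * m n * (u (Suc n))\<^sup>2) / u 0)"
    proof (rule sum_mono)
      fix n
      have 1: "2 * (?J n * (f n - f (Suc n))) \<le> u 0 * (k n * (f n - f (Suc n))\<^sup>2) + k n * (u n - u (Suc n))\<^sup>2 / u 0"
        using young_ineq'[OF ray_facts(1) k] unfolding flux_def .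
      have lm: "\<mu> * m n > 0" using \<mu> m by simp
      have 2: "2 * ((?J n - ?J (Suc n)) * f (Suc n)) \<le> u 0 * (\<mu> * m n * (f (Suc n))\<^sup>2) + \<mu> * m n * (u (Suc n))\<^sup>2 / u 0"
        unfolding ray_facts(4) by (rule young_ineq'[OF ray_facts(1) lm])
      show "2 * (?J n * (f n - f (Suc n))) + 2 * ((?J n - ?J (Suc n)) * f (Suc n)) \<le>
         u 0 * (k n * (f n - f (Suc n))\<^sup>2 + \<mu> * m n * (f (Suc n))\<^sup>2)
        + (k n * (u n - u (Suc n))\<^sup>2 + \<mu> * m n * (u (Suc n))\<^sup>2) / u 0"
        using 1 2 unfolding distrib_left add_divide_distrib by linarith
    qed
    also have "\<dots> = u 0 * (\<Sum>n<N. k n * (f n - f (Suc n))\<^sup>2 + \<mu> * m n * (f (Suc n))\<^sup>2)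
        + (\<Sum>n<N. k n * (u n - u (Suc n))\<^sup>2 + \<mu> * m n * (u (Suc n))\<^sup>2) / u 0"
      by (rule sum_affine_combination)
    also have "\<dots> \<le> u 0 * D + (?J 0 * u 0) / u 0"
      using D[of N] ray_energy[of N] ray_facts(1) by (intro add_mono mult_left_mono divide_right_mono) auto
    finally show ?thesis using ray_facts(1) by simp
  qed
  moreover have "(\<lambda>N. 2 * (?J 0 - ?J N * f N)) \<longlonglongrightarrow> 2 * (?J 0 - 0)"
  proof (intro tendsto_intros)
    have fb: "(\<lambda>N. ?J 0 * \<bar>f N\<bar>) \<longlonglongrightarrow> 0" using tendsto_mult_left[OF tendsto_rabs[OF f(2)], of "?J 0"] by simp
    show "(\<lambda>N. ?J N * f N) \<longlonglongrightarrow> 0"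
      by (rule Lim_null_comparison[OF _ fb])
         (auto intro!: always_eventually mult_right_mono ray_flux_le simp: abs_mult ray_facts)
  qed
  ultimately have "2 * (?J 0 - 0) \<le> u 0 * D + ?J 0" by (meson LIMSEQ_le_const2)
  then show ?thesis by (simp add: mult.commute)
qed

lemma ray_flux_pos: "0 < flux k u 0"
proof (rule ccontr)
  assume "\<not> 0 < flux k u 0"
  then have J0: "flux k u 0 = 0" using ray_facts(3)[of 0] by simp
  have "0 \<le> \<mu> * m 0 * u (Suc 0)" using \<mu> m[of 0] ray_facts(2)[of "Suc 0"] by simp
  then have "\<mu> * m 0 * u (Suc 0) = 0" using ray_facts(4)[of 0] J0 ray_facts(3)[of "Suc 0"] by linarith
  then have "u (Suc 0) = 0" using \<mu> m[of 0] by simp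
  then show False using J0 ray_facts(1) k[of 0] by (simp add: flux_def)
qed

text \<open>
Thomson principle, the dual bound: every test flow of unit strength bounds the effective resistance
from above. The current lost by the flow at a site is paid for as leakage there.
\<close>

lemma ray_thomson_principle:
  assumes \<theta>: "\<theta> 0 = 1" "\<theta> \<longlonglongrightarrow> 0"
    and E: "\<And>N. (\<Sum>n<N. (\<theta> n)\<^sup>2 / k n + (\<theta> n - \<theta> (Suc n))\<^sup>2 / (\<mu> * m n)) \<le> E"
  shows "u 0 \<le> E * flux k u 0"
proof -
  let ?J = "flux k u 0"
  have "2 * (u 0 - \<theta> N * u N) \<le> ?J * E + u 0" for N
  proof -
    have "u 0 - \<theta> N * u N = (\<Sum>n<N. (u n - u (Suc n)) * \<theta> n + u (Suc n) * (\<theta> n - \<theta> (Suc n)))"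
      using \<theta>(1) by (induction N) (auto simp: algebra_simps)
    then have "2 * (u 0 - \<theta> N * u N) = (\<Sum>n<N. 2 * ((u n - u (Suc n)) * \<theta> n) + 2 * (u (Suc n) * (\<theta> n - \<theta> (Suc n))))"
      by (simp add: sum_distrib_left distrib_left)
    also have "\<dots> \<le> (\<Sum>n<N. ?J * ((\<theta> n)\<^sup>2 / k n + (\<theta> n - \<theta> (Suc n))\<^sup>2 / (\<mu> * m n))
        + (k n * (u n - u (Suc n))\<^sup>2 + \<mu> * m n * (u (Suc n))\<^sup>2) / ?J)"
    proof (rule sum_mono)
      fix n
      have lm: "\<mu> * m n > 0" using \<mu> m by simp
      show "2 * ((u n - u (Suc n)) * \<theta> n) + 2 * (u (Suc n) * (\<theta> n - \<theta> (Suc n))) \<le>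
         ?J * ((\<theta> n)\<^sup>2 / k n + (\<theta> n - \<theta> (Suc n))\<^sup>2 / (\<mu> * m n))
        + (k n * (u n - u (Suc n))\<^sup>2 + \<mu> * m n * (u (Suc n))\<^sup>2) / ?J"
        using young_ineq[OF ray_flux_pos k, of "u n - u (Suc n)" "\<theta> n" n]
          young_ineq[OF ray_flux_pos lm, of "u (Suc n)" "\<theta> n - \<theta> (Suc n)"]
        unfolding distrib_left add_divide_distrib by linarith
    qed
    also have "\<dots> = ?J * (\<Sum>n<N. (\<theta> n)\<^sup>2 / k n + (\<theta> n - \<theta> (Suc n))\<^sup>2 / (\<mu> * m n))
        + (\<Sum>n<N. k n * (u n - u (Suc n))\<^sup>2 + \<mu> * m n * (u (Suc n))\<^sup>2) / ?J"
      by (rule sum_affine_combination)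
    also have "\<dots> \<le> ?J * E + (?J * u 0) / ?J"
      using E[of N] ray_energy[of N] ray_flux_pos by (intro add_mono mult_left_mono divide_right_mono) auto
    finally show ?thesis using ray_flux_pos by simp
  qed
  moreover have "(\<lambda>N. 2 * (u 0 - \<theta> N * u N)) \<longlonglongrightarrow> 2 * (u 0 - 0)"
  proof (intro tendsto_intros)
    have fb: "(\<lambda>N. \<bar>\<theta> N\<bar> * u 0) \<longlonglongrightarrow> 0" using tendsto_mult_right[OF tendsto_rabs[OF \<theta>(2)], of "u 0"] by simp
    show "(\<lambda>N. \<theta> N * u N) \<longlonglongrightarrow> 0"
      by (rule Lim_null_comparison[OF _ fb])
         (auto intro!: always_eventually mult_left_mono ray_u_le simp: abs_mult ray_facts)
  qed
  ultimately have "2 * (u 0 - 0) \<le> ?J * E + u 0" by (meson LIMSEQ_le_const2)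
  then show ?thesis by (simp add: mult.commute)
qed

end

lemma exp_drop_sq:
  fixes x y :: real assumes "0 \<le> x"
  shows "(exp (- y) - exp (- (y + x)))\<^sup>2 \<le> exp (- 2 * y) * x\<^sup>2"
proof -
  have "1 - exp (- x) \<le> x" using exp_ge_add_one_self[of "-x"] by simp
  moreover have "0 \<le> 1 - exp (-x)" using assms by simp
  ultimately have "(1 - exp (-x))\<^sup>2 \<le> x\<^sup>2" by (intro power_mono)
  then have "(exp (-y))\<^sup>2 * (1 - exp (-x))\<^sup>2 \<le> (exp (-y))\<^sup>2 * x\<^sup>2" by (intro mult_left_mono) auto
  moreover have "(exp (-y))\<^sup>2 = exp (- 2 * y)" by (simp add: power2_eq_square exp_add[symmetric])
  moreover have "exp (- y) - exp (- (y + x)) = exp (-y) * (1 - exp (-x))" by (simp add: right_diff_distrib exp_add[symmetric])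
  ultimately show ?thesis by (simp add: power_mult_distrib)
qed

lemma exp_linear_tendsto_0:
  fixes a :: "nat \<Rightarrow> real"
  assumes "(\<lambda>n. a n / real n) \<longlonglongrightarrow> \<alpha>" "\<alpha> > 0" "t > 0"
  shows "(\<lambda>n. exp (- (t * a n))) \<longlonglongrightarrow> 0"
proof -
  have "filterlim (\<lambda>n. t * a n) at_top sequentially"
    using linear_growth_at_top[OF assms(1,2)] assms(3)
    by (intro filterlim_tendsto_pos_mult_at_top[OF tendsto_const])
  then show ?thesis
    by (intro filterlim_compose[OF exp_at_bot] filterlim_uminus_at_top[THEN iffD1])
qed

text \<open>
The energy of an exponential test function whose exponent is proportional to \<open>sqrt \<mu>\<close>. The value of
\<open>\<kappa>\<close> is the minimizer of the limiting energy, as a function of \<open>\<kappa>\<close>, in both applications; there the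
two parts of the energy become equal, whence the mean \<open>2 * \<beta>\<close>.
\<close>

lemma scale_test_energy:
  fixes \<alpha> \<beta> :: real
  assumes b: "\<And>n. 0 \<le> b n" and a: "(\<lambda>n. a n / real n) \<longlonglongrightarrow> \<alpha>" "\<alpha> > 0"
    and B: "(\<lambda>n. (\<Sum>i<n. b i) / real n) \<longlonglongrightarrow> 2 * \<beta>" and \<beta>: "\<beta> > 0" and \<eta>: "\<eta> > 0"
  defines "\<kappa> \<equiv> sqrt (\<beta> / \<alpha>)"
  shows "eventually (\<lambda>\<mu>. \<forall>N. (\<Sum>i<N. b i * exp (- 2 * (\<kappa> * sqrt \<mu> * a i))) \<le> (\<kappa> + \<eta>) / sqrt \<mu>) (at_right 0)"
proof -
  have \<kappa>: "\<kappa> > 0" using a(2) \<beta> by (simp add: \<kappa>_def)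
  have k2: "\<beta> / \<alpha> = \<kappa> * \<kappa>" unfolding \<kappa>_def using a(2) \<beta> by simp
  have f: "filterlim (\<lambda>\<mu>. 2 * \<kappa> * sqrt \<mu>) (at_right 0) (at_right 0)"
    unfolding filterlim_at using \<kappa>
    by (auto intro!: tendsto_eq_intros eventually_at_rightI[of 0 1])
  have e: "\<eta> * (2 * \<kappa>) > 0" using \<kappa> \<eta> by simp
  from eventually_compose_filterlim[OF laplace_upper_bound[OF b a B e] f]
  show ?thesis using eventually_pos
  proof eventually_elim
    case (elim \<mu>)
    have s: "sqrt \<mu> > 0" using elim by simp
    show ?case
    proof
      fix N
      have "2 * \<kappa> * sqrt \<mu> * (\<Sum>i<N. b i * exp (- (2 * \<kappa> * sqrt \<mu>) * a i)) \<le> 2 * \<beta> / \<alpha> + \<eta> * (2 * \<kappa>)"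
        using elim(1) by blast
      also have "\<dots> = 2 * \<kappa> * (\<kappa> + \<eta>)"
        using arg_cong[OF k2, of "\<lambda>t. 2 * t"] by (simp add: algebra_simps)
      finally have "(2 * \<kappa>) * (sqrt \<mu> * (\<Sum>i<N. b i * exp (- (2 * \<kappa> * sqrt \<mu>) * a i))) \<le> (2 * \<kappa>) * (\<kappa> + \<eta>)"
        by (simp add: mult_ac)
      then have "sqrt \<mu> * (\<Sum>i<N. b i * exp (- (2 * \<kappa> * sqrt \<mu>) * a i)) \<le> \<kappa> + \<eta>"
        using \<kappa> by (simp only: mult_le_cancel_left_pos)
      then show "(\<Sum>i<N. b i * exp (- 2 * (\<kappa> * sqrt \<mu> * a i))) \<le> (\<kappa> + \<eta>) / sqrt \<mu>"
        using s by (simp add: field_simps)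
    qed
  qed
qed

text \<open>
The test voltage is \<open>exp (- \<kappa> sqrt \<mu> r n)\<close> with \<open>r n\<close> the resistance between \<open>0\<close> and \<open>n\<close>; to
leading order this is the solution for a homogeneous medium with the same means.
\<close>

lemma ray_flux_upper:
  fixes k m :: "nat \<Rightarrow> real"
  assumes k: "\<And>n. 0 < k n" and m: "\<And>n. 0 < m n"
    and R: "has_mean (\<lambda>i. 1 / k i) \<rho>" "\<rho> > 0"
    and A: "has_mean m M" "M > 0" and \<eta>: "\<eta> > 0"
  shows "eventually (\<lambda>\<mu>. \<forall>u. resolvent_on_ray k m \<mu> u \<longrightarrow>
           flux k u 0 \<le> sqrt \<mu> * (sqrt (M / \<rho>) + \<eta>) * u 0) (at_right 0)"
proof -
  define \<kappa> where "\<kappa> = sqrt (M / \<rho>)"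
  have \<kappa>: "\<kappa> > 0" "\<kappa>\<^sup>2 = M / \<rho>" using R(2) A(2) by (auto simp: \<kappa>_def)
  define r where "r n = (\<Sum>i<n. 1 / k i)" for n
  have b: "0 \<le> \<kappa>\<^sup>2 / k n + m n" for n using k[of n] m[of n] by (simp add: less_imp_le)
  have B: "(\<lambda>n. (\<Sum>i<n. \<kappa>\<^sup>2 / k i + m i) / real n) \<longlonglongrightarrow> 2 * M"
  proof -
    have "(\<lambda>n. \<kappa>\<^sup>2 * ((\<Sum>i<n. 1 / k i) / real n) + (\<Sum>i<n. m i) / real n) \<longlonglongrightarrow> \<kappa>\<^sup>2 * \<rho> + M"
      by (intro tendsto_intros R A)
    moreover have "\<kappa>\<^sup>2 * \<rho> + M = 2 * M" using \<kappa> R(2) by simp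
    ultimately show ?thesis
      by (simp add: sum.distrib add_divide_distrib sum_distrib_left)
  qed
  have r: "(\<lambda>n. r n / real n) \<longlonglongrightarrow> \<rho>" using R(1) by (simp add: r_def)
  show ?thesis
    using scale_test_energy[OF b r R(2) B A(2) \<eta>, folded \<kappa>_def] eventually_pos
  proof eventually_elim
    case (elim \<mu>)
    have s: "sqrt \<mu> > 0" using elim by simp
    define f where "f n = exp (- (\<kappa> * sqrt \<mu> * r n))" for n
    have E: "(\<Sum>n<N. k n * (f n - f (Suc n))\<^sup>2 + \<mu> * m n * (f (Suc n))\<^sup>2) \<le> sqrt \<mu> * (\<kappa> + \<eta>)" for N
    proof -
      have "(\<Sum>n<N. k n * (f n - f (Suc n))\<^sup>2 + \<mu> * m n * (f (Suc n))\<^sup>2)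
        \<le> (\<Sum>n<N. \<mu> * ((\<kappa>\<^sup>2 / k n + m n) * exp (- 2 * (\<kappa> * sqrt \<mu> * r n))))"
      proof (rule sum_mono)
        fix n
        define x where "x = \<kappa> * sqrt \<mu> * (1 / k n)"
        define e where "e = exp (- 2 * (\<kappa> * sqrt \<mu> * r n))"
        have x0: "0 \<le> x" using k[of n] \<kappa> s by (simp add: x_def less_imp_le)
        have fS: "f (Suc n) = exp (- (\<kappa> * sqrt \<mu> * r n + x))"
          by (simp add: f_def r_def x_def algebra_simps)
        have "(f n - f (Suc n))\<^sup>2 \<le> e * x\<^sup>2"
          using exp_drop_sq[OF x0] unfolding fS e_def by (simp add: f_def)
        then have "k n * (f n - f (Suc n))\<^sup>2 \<le> k n * (e * x\<^sup>2)"
          using k[of n] by (intro mult_left_mono) auto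
        also have "\<dots> = \<mu> * (\<kappa>\<^sup>2 / k n * e)"
        proof -
          have "x\<^sup>2 = \<kappa>\<^sup>2 * \<mu> / (k n)\<^sup>2"
            using elim(2) by (simp add: x_def power_mult_distrib power_divide)
          then show ?thesis using k[of n] by (simp add: power2_eq_square field_simps)
        qed
        finally have 1: "k n * (f n - f (Suc n))\<^sup>2 \<le> \<mu> * (\<kappa>\<^sup>2 / k n * e)" .
        have "(f (Suc n))\<^sup>2 = exp (- 2 * (\<kappa> * sqrt \<mu> * r n + x))"
          unfolding fS by (simp add: power2_eq_square exp_add[symmetric])
        also have "\<dots> \<le> e" unfolding e_def using x0 by simp
        finally have "\<mu> * m n * (f (Suc n))\<^sup>2 \<le> \<mu> * m n * e"
          using elim(2) m[of n] by (intro mult_left_mono) auto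
        then have "k n * (f n - f (Suc n))\<^sup>2 + \<mu> * m n * (f (Suc n))\<^sup>2 \<le> \<mu> * ((\<kappa>\<^sup>2 / k n + m n) * e)"
          using 1 by (simp add: distrib_left distrib_right mult_ac)
        then show "k n * (f n - f (Suc n))\<^sup>2 + \<mu> * m n * (f (Suc n))\<^sup>2
            \<le> \<mu> * ((\<kappa>\<^sup>2 / k n + m n) * exp (- 2 * (\<kappa> * sqrt \<mu> * r n)))"
          by (simp add: e_def)
      qed
      also have "\<dots> = \<mu> * (\<Sum>n<N. (\<kappa>\<^sup>2 / k n + m n) * exp (- 2 * (\<kappa> * sqrt \<mu> * r n)))"
        by (simp add: sum_distrib_left)
      also have "\<dots> \<le> \<mu> * ((\<kappa> + \<eta>) / sqrt \<mu>)"
        using elim by (intro mult_left_mono) auto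
      also have "\<dots> = (\<mu> / sqrt \<mu>) * (\<kappa> + \<eta>)" by simp
      also have "\<mu> / sqrt \<mu> = sqrt \<mu>" using elim(2) by (simp add: real_div_sqrt)
      finally show ?thesis .
    qed
    have f0: "f 0 = 1" by (simp add: f_def r_def)
    have fl: "f \<longlonglongrightarrow> 0"
      unfolding f_def by (rule exp_linear_tendsto_0[OF r R(2)]) (use \<kappa> s in simp)
    show ?case
      using ray_dirichlet_principle[OF k m elim(2) _ f0 fl E] unfolding \<kappa>_def by blast
  qed
qed

text \<open>
The test flow is \<open>exp (- \<kappa> sqrt \<mu> a n)\<close> with \<open>a n\<close> the accumulated weight. Flow lost in the amount
allowed by a smaller weight \<open>m'\<close> costs no more than with the true one; this allows truncated weights
when the weight itself has infinite mean.
\<close>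

lemma ray_flux_lower:
  fixes k m m' :: "nat \<Rightarrow> real"
  assumes k: "\<And>n. 0 < k n" and m: "\<And>n. 0 < m n" and m': "\<And>n. 0 \<le> m' n" "\<And>n. m' n \<le> m n"
    and R: "has_mean (\<lambda>i. 1 / k i) \<rho>" "\<rho> > 0"
    and A: "has_mean m' M" "M > 0" and \<eta>: "\<eta> > 0"
  shows "eventually (\<lambda>\<mu>. \<forall>u. resolvent_on_ray k m \<mu> u \<longrightarrow>
           u 0 \<le> (sqrt (\<rho> / M) + \<eta>) / sqrt \<mu> * flux k u 0) (at_right 0)"
proof -
  define \<kappa> where "\<kappa> = sqrt (\<rho> / M)"
  have \<kappa>: "\<kappa> > 0" "\<kappa>\<^sup>2 = \<rho> / M" using R(2) A(2) by (auto simp: \<kappa>_def)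
  define a where "a n = (\<Sum>i<n. m' i)" for n
  have b: "0 \<le> 1 / k n + \<kappa>\<^sup>2 * m' n" for n using k[of n] m'(1)[of n] by (simp add: less_imp_le)
  have B: "(\<lambda>n. (\<Sum>i<n. 1 / k i + \<kappa>\<^sup>2 * m' i) / real n) \<longlonglongrightarrow> 2 * \<rho>"
  proof -
    have "(\<lambda>n. (\<Sum>i<n. 1 / k i) / real n + \<kappa>\<^sup>2 * ((\<Sum>i<n. m' i) / real n)) \<longlonglongrightarrow> \<rho> + \<kappa>\<^sup>2 * M"
      by (intro tendsto_intros R A)
    moreover have "\<rho> + \<kappa>\<^sup>2 * M = 2 * \<rho>" using \<kappa> A(2) by simp
    ultimately show ?thesis
      by (simp add: sum.distrib add_divide_distrib sum_distrib_left)
  qed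
  have a: "(\<lambda>n. a n / real n) \<longlonglongrightarrow> M" using A(1) by (simp add: a_def)
  show ?thesis
    using scale_test_energy[OF b a A(2) B R(2) \<eta>, folded \<kappa>_def] eventually_pos
  proof eventually_elim
    case (elim \<mu>)
    have s: "sqrt \<mu> > 0" using elim by simp
    define f where "f n = exp (- (\<kappa> * sqrt \<mu> * a n))" for n
    have E: "(\<Sum>n<N. (f n)\<^sup>2 / k n + (f n - f (Suc n))\<^sup>2 / (\<mu> * m n)) \<le> (\<kappa> + \<eta>) / sqrt \<mu>" for N
    proof -
      have "(\<Sum>n<N. (f n)\<^sup>2 / k n + (f n - f (Suc n))\<^sup>2 / (\<mu> * m n))
        \<le> (\<Sum>n<N. (1 / k n + \<kappa>\<^sup>2 * m' n) * exp (- 2 * (\<kappa> * sqrt \<mu> * a n)))"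
      proof (rule sum_mono)
        fix n
        define x where "x = \<kappa> * sqrt \<mu> * m' n"
        define e where "e = exp (- 2 * (\<kappa> * sqrt \<mu> * a n))"
        have e0: "e > 0" by (simp add: e_def)
        have x0: "0 \<le> x" using m'(1)[of n] \<kappa> s by (simp add: x_def less_imp_le)
        have fS: "f (Suc n) = exp (- (\<kappa> * sqrt \<mu> * a n + x))"
          by (simp add: f_def a_def x_def algebra_simps)
        have mm: "\<mu> * m n > 0" using m[of n] elim(2) by simp
        have "(f n - f (Suc n))\<^sup>2 \<le> e * x\<^sup>2"
          using exp_drop_sq[OF x0] unfolding fS e_def by (simp add: f_def)
        then have "(f n - f (Suc n))\<^sup>2 / (\<mu> * m n) \<le> e * x\<^sup>2 / (\<mu> * m n)"
          using mm by (intro divide_right_mono) auto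
        also have "\<dots> = (\<kappa>\<^sup>2 * e) * (m' n * m' n / m n)"
        proof -
          have "x\<^sup>2 = \<kappa>\<^sup>2 * \<mu> * (m' n * m' n)"
            using elim(2) by (simp add: x_def power_mult_distrib power2_eq_square)
          then show ?thesis using elim(2) m[of n] by (simp add: field_simps)
        qed
        also have "\<dots> \<le> (\<kappa>\<^sup>2 * e) * m' n"
        proof (rule mult_left_mono)
          have "m' n * m' n \<le> m' n * m n" using m'(1)[of n] m'(2)[of n] by (rule mult_left_mono[rotated])
          then show "m' n * m' n / m n \<le> m' n" using m[of n] by (simp add: field_simps)
        qed (use e0 in simp)
        finally have 1: "(f n - f (Suc n))\<^sup>2 / (\<mu> * m n) \<le> \<kappa>\<^sup>2 * m' n * e" by (simp add: mult_ac)
        have "(f n)\<^sup>2 = e" unfolding f_def e_def by (simp add: power2_eq_square exp_add[symmetric])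
        then show "(f n)\<^sup>2 / k n + (f n - f (Suc n))\<^sup>2 / (\<mu> * m n)
            \<le> (1 / k n + \<kappa>\<^sup>2 * m' n) * exp (- 2 * (\<kappa> * sqrt \<mu> * a n))"
          using 1 unfolding e_def[symmetric] by (simp add: distrib_right)
      qed
      also have "\<dots> \<le> (\<kappa> + \<eta>) / sqrt \<mu>" using elim by blast
      finally show ?thesis .
    qed
    have f0: "f 0 = 1" by (simp add: f_def a_def)
    have fl: "f \<longlonglongrightarrow> 0"
      unfolding f_def by (rule exp_linear_tendsto_0[OF a A(2)]) (use \<kappa> s in simp)
    show ?case
      using ray_thomson_principle[OF k m elim(2) _ f0 fl E] unfolding \<kappa>_def by blast
  qed
qed

section \<open>The heat kernel of a walk among conductances\<close>

lemma sum_shift_int: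
  fixes h :: "int \<Rightarrow> real"
  assumes "finite S'" "(\<lambda>z. z + k) ` S \<subseteq> S'" "\<And>z. z \<notin> S \<Longrightarrow> h z = 0"
  shows "(\<Sum>y\<in>S'. h (y - k)) = (\<Sum>z\<in>S. h z)"
proof -
  have "(\<Sum>y\<in>S'. h (y - k)) = (\<Sum>y\<in>(\<lambda>z. z + k) ` S. h (y - k))"
  proof (rule sum.mono_neutral_right)
    show "\<forall>i\<in>S' - (\<lambda>z. z + k) ` S. h (i - k) = 0"
      using assms(3) by (metis DiffE diff_add_cancel image_eqI)
  qed (use assms in auto)
  also have "\<dots> = (\<Sum>z\<in>S. h z)" by (subst sum.reindex) (auto simp: inj_on_def)
  finally show ?thesis .
qed

text \<open>
A fixed environment; \<open>c x\<close> is the conductance of the edge between \<open>x\<close> and \<open>x + 1\<close>.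
\<close>

locale conductances =
  fixes c :: "int \<Rightarrow> real"
  assumes c_pos: "0 < c x"
begin

definition weight :: "int \<Rightarrow> real" where "weight x = c (x - 1) + c x"

definition transition :: "(int \<Rightarrow> real) \<Rightarrow> int \<Rightarrow> real" where
  "transition f x = (c (x - 1) * f (x - 1) + c x * f (x + 1)) / weight x"

definition dirac :: "int \<Rightarrow> int \<Rightarrow> real" where
  "dirac x y = (if y = x then 1 / weight x else 0)"

text \<open>
The transition probabilities divided by the weight of the endpoint. In this normalization the
kernel is symmetric and evolves under the self-adjoint operator \<open>transition\<close>.
\<close>

definition q :: "int \<Rightarrow> nat \<Rightarrow> int \<Rightarrow> real" where
  "q x n = (transition ^^ n) (dirac x)"

text \<open>
The inner product of \<open>f\<close> and \<open>g\<close> with respect to the weights. It is used with \<open>f\<close> of finite support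
and arbitrary \<open>g\<close>, which makes the sum finite.
\<close>

definition ip :: "(int \<Rightarrow> real) \<Rightarrow> (int \<Rightarrow> real) \<Rightarrow> real" where
  "ip f g = (\<Sum>y | f y \<noteq> 0. weight y * f y * g y)"

abbreviation fin_supp :: "(int \<Rightarrow> real) \<Rightarrow> bool" where
  "fin_supp f \<equiv> finite {y. f y \<noteq> 0}"

lemma weight_pos: "0 < weight x"
  using c_pos[of x] c_pos[of "x - 1"] by (simp add: weight_def)

lemma weight_step: "weight x * transition f x = c (x - 1) * f (x - 1) + c x * f (x + 1)"
  using weight_pos[of x] by (simp add: transition_def)

lemma ip_eq:
  assumes "finite S" "{y. f y \<noteq> 0} \<subseteq> S"
  shows "ip f g = (\<Sum>y\<in>S. weight y * f y * g y)"
  unfolding ip_def by (rule sum.mono_neutral_left) (use assms in auto)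

lemma ip_commute:
  assumes "fin_supp f" "fin_supp g" shows "ip f g = ip g f"
proof -
  let ?S = "{y. f y \<noteq> 0} \<union> {y. g y \<noteq> 0}"
  have "ip f g = (\<Sum>y\<in>?S. weight y * f y * g y)" "ip g f = (\<Sum>y\<in>?S. weight y * g y * f y)"
    using assms by (auto intro!: ip_eq)
  then show ?thesis by (simp add: mult_ac)
qed

definition nbhd :: "(int \<Rightarrow> real) \<Rightarrow> int set" where
  "nbhd f = (\<lambda>z. z + 1) ` {y. f y \<noteq> 0} \<union> (\<lambda>z. z + (-1)) ` {y. f y \<noteq> 0}"

lemma nbhd: "fin_supp f \<Longrightarrow> finite (nbhd f)" "{y. transition f y \<noteq> 0} \<subseteq> nbhd f"
proof -
  show "fin_supp f \<Longrightarrow> finite (nbhd f)" by (simp add: nbhd_def)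
  show "{y. transition f y \<noteq> 0} \<subseteq> nbhd f"
  proof
    fix y assume "y \<in> {y. transition f y \<noteq> 0}"
    then have "f (y - 1) \<noteq> 0 \<or> f (y + 1) \<noteq> 0" by (auto simp: transition_def)
    then show "y \<in> nbhd f"
    proof
      assume "f (y - 1) \<noteq> 0"
      then show ?thesis unfolding nbhd_def by (intro UnI1 image_eqI[of _ _ "y - 1"]) auto
    next
      assume "f (y + 1) \<noteq> 0"
      then show ?thesis unfolding nbhd_def by (intro UnI2 image_eqI[of _ _ "y + 1"]) auto
    qed
  qed
qed

lemma fin_supp_step: "fin_supp f \<Longrightarrow> fin_supp (transition f)"
  using nbhd finite_subset by blast

lemma sum_nbhd:
  assumes "fin_supp f" "\<And>z. f z = 0 \<Longrightarrow> h1 z = 0" "\<And>z. f z = 0 \<Longrightarrow> h2 z = 0"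
  shows "(\<Sum>y\<in>nbhd f. h1 (y - 1) + h2 (y + 1)) = (\<Sum>z | f z \<noteq> 0. h1 z + h2 z :: real)"
proof -
  have "(\<Sum>y\<in>nbhd f. h1 (y - 1)) = (\<Sum>z | f z \<noteq> 0. h1 z)"
    by (rule sum_shift_int) (use assms nbhd in \<open>auto simp: nbhd_def\<close>)
  moreover have "(\<Sum>y\<in>nbhd f. h2 (y - (-1))) = (\<Sum>z | f z \<noteq> 0. h2 z)"
    by (rule sum_shift_int) (use assms nbhd in \<open>auto simp: nbhd_def\<close>)
  ultimately show ?thesis by (simp add: sum.distrib)
qed

text \<open>
Reversibility of the walk: both sides pair \<open>f\<close> and \<open>g\<close> along edges, with the conductance as weight.
\<close>

lemma ip_step:
  assumes "fin_supp f" shows "ip (transition f) g = ip f (transition g)"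
proof -
  have "ip (transition f) g = (\<Sum>y\<in>nbhd f. weight y * transition f y * g y)"
    using assms nbhd by (intro ip_eq) auto
  also have "\<dots> = (\<Sum>y\<in>nbhd f. c (y - 1) * f (y - 1) * g ((y - 1) + 1) + c ((y + 1) - 1) * f (y + 1) * g ((y + 1) - 1))"
    unfolding weight_step by (simp add: algebra_simps)
  also have "\<dots> = (\<Sum>z | f z \<noteq> 0. c z * f z * g (z + 1) + c (z - 1) * f z * g (z - 1))"
    using sum_nbhd[OF assms, of "\<lambda>z. c z * f z * g (z + 1)" "\<lambda>z. c (z - 1) * f z * g (z - 1)"] by simp
  also have "\<dots> = (\<Sum>z | f z \<noteq> 0. f z * (weight z * transition g z))"
    unfolding weight_step by (simp add: algebra_simps)
  also have "\<dots> = ip f (transition g)" by (simp add: ip_def mult_ac)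
  finally show ?thesis .
qed

lemma step_sq_le: "weight y * (transition f y)\<^sup>2 \<le> c (y - 1) * (f (y - 1))\<^sup>2 + c y * (f (y + 1))\<^sup>2"
proof -
  define A where "A = c (y - 1)"
  define B where "B = c y"
  define a where "a = f (y - 1)"
  define b where "b = f (y + 1)"
  have pos: "A > 0" "B > 0" using c_pos by (auto simp: A_def B_def)
  have "(A * a + B * b)\<^sup>2 \<le> (A + B) * (A * a\<^sup>2 + B * b\<^sup>2)"
  proof -
    have "(A + B) * (A * a\<^sup>2 + B * b\<^sup>2) - (A * a + B * b)\<^sup>2 = A * B * (a - b)\<^sup>2"
      by (simp add: power2_eq_square algebra_simps)
    moreover have "A * B * (a - b)\<^sup>2 \<ge> 0" using pos by simp
    ultimately show ?thesis by linarith
  qed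
  then have "(A * a + B * b)\<^sup>2 / (A + B) \<le> A * a\<^sup>2 + B * b\<^sup>2" using pos by (simp add: field_simps)
  moreover have "weight y * (transition f y)\<^sup>2 = (A * a + B * b)\<^sup>2 / (A + B)"
    using pos by (simp add: transition_def weight_def A_def B_def a_def b_def power2_eq_square)
  ultimately show ?thesis by (simp add: A_def B_def a_def b_def)
qed

lemma ip_step_contraction:
  assumes "fin_supp f" shows "ip (transition f) (transition f) \<le> ip f f"
proof -
  have "ip (transition f) (transition f) = (\<Sum>y\<in>nbhd f. weight y * (transition f y)\<^sup>2)"
    using assms nbhd by (subst ip_eq[of "nbhd f"]) (auto simp: power2_eq_square mult_ac)
  also have "\<dots> \<le> (\<Sum>y\<in>nbhd f. c (y - 1) * (f (y - 1))\<^sup>2 + c ((y + 1) - 1) * (f (y + 1))\<^sup>2)"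
    using step_sq_le by (intro sum_mono) simp
  also have "\<dots> = (\<Sum>z | f z \<noteq> 0. c z * (f z)\<^sup>2 + c (z - 1) * (f z)\<^sup>2)"
    using sum_nbhd[OF assms, of "\<lambda>z. c z * (f z)\<^sup>2" "\<lambda>z. c (z - 1) * (f z)\<^sup>2"] by simp
  also have "\<dots> = ip f f"
    unfolding ip_def by (rule sum.cong) (auto simp: weight_def power2_eq_square algebra_simps)
  finally show ?thesis .
qed

lemma ip_add_le:
  assumes "fin_supp f" "fin_supp g"
  shows "ip f g \<le> (ip f f + ip g g) / 2"
proof -
  let ?S = "{y. f y \<noteq> 0} \<union> {y. g y \<noteq> 0}"
  have "ip f g = (\<Sum>y\<in>?S. weight y * f y * g y)" "ip f f = (\<Sum>y\<in>?S. weight y * f y * f y)"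
    "ip g g = (\<Sum>y\<in>?S. weight y * g y * g y)"
    using assms by (auto intro!: ip_eq)
  moreover have "2 * (\<Sum>y\<in>?S. weight y * f y * g y) \<le> (\<Sum>y\<in>?S. weight y * f y * f y) + (\<Sum>y\<in>?S. weight y * g y * g y)"
    unfolding sum_distrib_left sum.distrib[symmetric]
  proof (rule sum_mono)
    fix y
    have "weight y * f y * f y + weight y * g y * g y - 2 * (weight y * f y * g y) = weight y * (f y - g y)\<^sup>2"
      by (simp add: power2_eq_square algebra_simps)
    then show "2 * (weight y * f y * g y) \<le> weight y * f y * f y + weight y * g y * g y"
      using weight_pos[of y] by (smt (verit) zero_le_mult_iff zero_le_power2)
  qed
  ultimately show ?thesis by simp
qed

lemma q_0: "q x 0 = dirac x" by (simp add: q_def)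

lemma q_Suc: "q x (Suc n) = transition (q x n)" by (simp add: q_def)

lemma fin_supp_q: "fin_supp (q x n)"
proof (induction n)
  case 0
  have "{y. dirac x y \<noteq> 0} \<subseteq> {x}" by (auto simp: dirac_def)
  then show ?case unfolding q_0 by (rule finite_subset) simp
next
  case (Suc n) then show ?case unfolding q_Suc by (rule fin_supp_step)
qed

lemma q_nonneg: "0 \<le> q x n y"
proof (induction n arbitrary: y)
  case 0 then show ?case using weight_pos[of x] by (simp add: q_0 dirac_def)
next
  case (Suc n) then show ?case
    unfolding q_Suc transition_def using weight_pos[of y] c_pos[of y] c_pos[of "y-1"] by (simp add: less_imp_le)
qed

lemma q_outside: "int n < \<bar>y - x\<bar> \<Longrightarrow> q x n y = 0"
proof (induction n arbitrary: y)
  case 0 then show ?case by (auto simp: q_0 dirac_def)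
next
  case (Suc n)
  have "q x n (y - 1) = 0" "q x n (y + 1) = 0" using Suc.prems by (auto intro!: Suc.IH)
  then show ?case by (simp add: q_Suc transition_def)
qed

lemma q_parity: "odd (x + y + int n) \<Longrightarrow> q x n y = 0"
proof (induction n arbitrary: y)
  case 0 then show ?case by (auto simp: q_0 dirac_def)
next
  case (Suc n)
  have "q x n (y - 1) = 0" "q x n (y + 1) = 0" using Suc.prems by (auto intro!: Suc.IH)
  then show ?case by (simp add: q_Suc transition_def)
qed

lemma ip_dirac: "fin_supp f \<Longrightarrow> ip f (dirac y) = f y"
proof -
  assume "fin_supp f"
  then have "ip f (dirac y) = ip (dirac y) f"
    using fin_supp_q[of y 0] unfolding q_0 by (rule ip_commute)
  also have "\<dots> = (\<Sum>z\<in>{y}. weight z * dirac y z * f z)" by (rule ip_eq) (auto simp: dirac_def)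
  also have "\<dots> = f y" using weight_pos[of y] by (simp add: dirac_def)
  finally show ?thesis .
qed

lemma ip_q: "ip (q x m) (q y n) = q x (m + n) y"
proof (induction n arbitrary: m)
  case 0 then show ?case by (simp add: q_0 ip_dirac fin_supp_q)
next
  case (Suc n)
  have "ip (q x m) (q y (Suc n)) = ip (transition (q x m)) (q y n)"
    unfolding q_Suc by (rule ip_step[OF fin_supp_q, symmetric])
  also have "\<dots> = q x (Suc m + n) y" unfolding q_Suc[symmetric] by (rule Suc)
  finally show ?case by simp
qed

text \<open>
\<open>q x (2 * n) x\<close> is the squared norm of \<open>q x n\<close>, and \<open>transition\<close> is a contraction. This monotonicity is
what the Tauberian theorem needs.
\<close>

lemma q_return_decreasing: "q x (2 * Suc n) x \<le> q x (2 * n) x"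
proof -
  have "q x (2 * Suc n) x = ip (transition (q x n)) (transition (q x n))"
    using ip_q[of x "Suc n" x "Suc n"] by (simp add: q_Suc mult_2)
  also have "\<dots> \<le> ip (q x n) (q x n)" by (rule ip_step_contraction[OF fin_supp_q])
  also have "\<dots> = q x (2 * n) x" by (simp add: ip_q mult_2)
  finally show ?thesis .
qed

lemma q_le_returns: "q x (m + n) y \<le> (q x (2 * m) x + q y (2 * n) y) / 2"
  using ip_add_le[OF fin_supp_q fin_supp_q, of x m y n] by (simp add: ip_q mult_2)

lemma q_mass: "ip (q x n) (\<lambda>_. 1) = 1"
proof (induction n)
  case 0
  have "ip (dirac x) (\<lambda>_. 1) = (\<Sum>z\<in>{x}. weight z * dirac x z * 1)" by (rule ip_eq) (auto simp: dirac_def)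
  moreover have "weight x * dirac x x = 1" using weight_pos[of x] by (simp add: dirac_def)
  ultimately show ?case by (simp add: q_0)
next
  case (Suc n)
  have "transition (\<lambda>_. 1) = (\<lambda>_. 1)"
  proof
    fix y show "transition (\<lambda>_. 1) y = 1" using weight_pos[of y] by (simp add: transition_def weight_def)
  qed
  then show ?case using Suc ip_step[OF fin_supp_q, of x n "\<lambda>_. 1"] by (simp add: q_Suc)
qed

lemma weight_q_le_1: "weight y * q x n y \<le> 1"
proof -
  have "weight y * q x n y * 1 \<le> (\<Sum>z | q x n z \<noteq> 0. weight z * q x n z * 1)"
  proof (cases "q x n y = 0")
    case False
    then show ?thesis using fin_supp_q[of x n] q_nonneg[of x n] weight_pos
      by (intro member_le_sum) (auto simp: less_imp_le)
  next
    case True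
    have "0 \<le> (\<Sum>z | q x n z \<noteq> 0. weight z * q x n z * 1)"
      using q_nonneg[of x n] weight_pos by (intro sum_nonneg) (auto simp: less_imp_le)
    then show ?thesis using True by simp
  qed
  then show ?thesis using q_mass[of x n] by (simp add: ip_def)
qed

end

section \<open>The Green function on the diagonal\<close>

context conductances
begin

text \<open>
The generating function of the kernel, that is, the voltage for a unit current injected at \<open>x\<close>
(up to the factor \<open>s\<close>) when the walk is killed at rate \<open>1 / s - 1\<close>.
\<close>

definition green :: "real \<Rightarrow> int \<Rightarrow> int \<Rightarrow> real" where
  "green s x y = (\<Sum>n. s ^ n * q x n y)"

lemma q_bound: "\<bar>q x n y\<bar> \<le> 1 / weight y"
  using weight_q_le_1[of y x n] q_nonneg[of x n y] weight_pos[of y] by (simp add: field_simps)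

lemma green_summable:
  assumes "0 < s" "s < 1" shows "summable (\<lambda>n. s ^ n * q x n y)"
proof (rule summable_comparison_test')
  show "summable (\<lambda>n. s ^ n * (1 / weight y))"
    using assms by (intro summable_mult2 summable_geometric) simp
  fix n
  have "s ^ n * \<bar>q x n y\<bar> \<le> s ^ n * (1 / weight y)"
    using q_bound assms by (intro mult_left_mono) auto
  then show "norm (s ^ n * q x n y) \<le> s ^ n * (1 / weight y)" using assms by (simp add: abs_mult)
qed

lemma green_nonneg: "0 < s \<Longrightarrow> s < 1 \<Longrightarrow> 0 \<le> green s x y"
  unfolding green_def using green_summable q_nonneg by (intro suminf_nonneg) auto

lemma green_pos: "0 < s \<Longrightarrow> s < 1 \<Longrightarrow> 0 < green s x x"
proof -
  assume s: "0 < s" "s < 1"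
  have "sum (\<lambda>n. s ^ n * q x n x) {0} \<le> green s x x"
    unfolding green_def using green_summable[OF s] q_nonneg s by (intro sum_le_suminf) auto
  then show ?thesis using weight_pos[of x] by (simp add: q_0 dirac_def) (meson less_le_trans zero_less_divide_1_iff)
qed

lemma green_equation:
  assumes s: "0 < s" "s < 1"
  shows "weight y * green s x y =
    (if y = x then 1 else 0) + s * (c (y - 1) * green s x (y - 1) + c y * green s x (y + 1))"
proof -
  have "green s x y = q x 0 y + (\<Sum>n. s ^ Suc n * q x (Suc n) y)"
    unfolding green_def using suminf_split_head[OF green_summable[OF s, of x y]] by simp
  moreover have "weight y * q x 0 y = (if y = x then 1 else 0)"
    using weight_pos[of y] by (auto simp: q_0 dirac_def)
  moreover have "weight y * (\<Sum>n. s ^ Suc n * q x (Suc n) y) =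
      s * (c (y - 1) * green s x (y - 1) + c y * green s x (y + 1))"
  proof -
    have "(\<lambda>n. s * (c (y - 1) * (s ^ n * q x n (y - 1)) + c y * (s ^ n * q x n (y + 1)))) sums
      (s * (c (y - 1) * green s x (y - 1) + c y * green s x (y + 1)))"
      unfolding green_def by (intro sums_mult sums_add summable_sums green_summable s)
    moreover have "(\<lambda>n. s * (c (y - 1) * (s ^ n * q x n (y - 1)) + c y * (s ^ n * q x n (y + 1))))
        = (\<lambda>n. weight y * (s ^ Suc n * q x (Suc n) y))"
    proof
      fix n
      have "weight y * (s ^ Suc n * q x (Suc n) y) = s * s ^ n * (weight y * transition (q x n) y)"
        by (simp add: q_Suc)
      then show "s * (c (y - 1) * (s ^ n * q x n (y - 1)) + c y * (s ^ n * q x n (y + 1)))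
        = weight y * (s ^ Suc n * q x (Suc n) y)"
        unfolding weight_step by (simp add: algebra_simps)
    qed
    ultimately have A: "(\<lambda>n. weight y * (s ^ Suc n * q x (Suc n) y)) sums
      (s * (c (y - 1) * green s x (y - 1) + c y * green s x (y + 1)))" by simp
    have "summable (\<lambda>n. s ^ Suc n * q x (Suc n) y)"
      using green_summable[OF s, of x y] by (subst summable_Suc_iff)
    from suminf_mult[OF this, of "weight y"] sums_unique[OF A] show ?thesis by simp
  qed
  ultimately show ?thesis by (simp add: distrib_left)
qed

text \<open>
The walk needs \<open>\<bar>y - x\<bar>\<close> steps to reach \<open>y\<close>.
\<close>

lemma green_decay:
  assumes s: "0 < s" "s < 1"
  shows "weight y * green s x y \<le> s ^ nat \<bar>y - x\<bar> / (1 - s)"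
proof -
  define d where "d = nat \<bar>y - x\<bar>"
  have z: "(\<Sum>n<d. s ^ n * q x n y) = 0"
  proof (rule sum.neutral, rule ballI)
    fix n assume "n \<in> {..<d}"
    then have "q x n y = 0" by (intro q_outside) (auto simp: d_def)
    then show "s ^ n * q x n y = 0" by simp
  qed
  have "green s x y = (\<Sum>n. s ^ (n + d) * q x (n + d) y)"
    unfolding green_def using suminf_split_initial_segment[OF green_summable[OF s, of x y], of d] z by simp
  also have "\<dots> \<le> (\<Sum>n. s ^ d / weight y * s ^ n)"
  proof (rule suminf_le)
    show "s ^ (n + d) * q x (n + d) y \<le> s ^ d / weight y * s ^ n" for n
    proof -
      have "s ^ (n + d) * q x (n + d) y \<le> s ^ (n + d) * (1 / weight y)"
        using q_bound[of x "n + d" y] s by (intro mult_left_mono) auto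
      then show ?thesis by (simp add: power_add mult_ac)
    qed
    show "summable (\<lambda>n. s ^ (n + d) * q x (n + d) y)"
      using green_summable[OF s, of x y] by (subst summable_iff_shift)
    show "summable (\<lambda>n. s ^ d / weight y * s ^ n)"
      using s by (intro summable_mult summable_geometric) simp
  qed
  also have "\<dots> = s ^ d / weight y * (1 / (1 - s))"
    using s by (subst suminf_mult) (auto simp: suminf_geometric intro!: summable_geometric)
  finally have "weight y * green s x y \<le> weight y * (s ^ d / weight y * (1 / (1 - s)))"
    using weight_pos[of y] by (intro mult_left_mono) auto
  then show ?thesis using weight_pos[of y] by (simp add: d_def)
qed

text \<open>
The two half-lines starting at \<open>x\<close> are treated together: \<open>y\<close> enumerates the sites of the
half-line and \<open>k\<close> its edges. The current is nonincreasing along the half-line and tends to 0 by the decay of the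
Green function, hence it is nonnegative.
\<close>

lemma green_resolvent_on_ray:
  fixes y :: "nat \<Rightarrow> int" and k :: "nat \<Rightarrow> real"
  assumes s: "0 < s" "s < 1" and y0: "y 0 = x" and y: "\<And>n. \<bar>y n - x\<bar> = int n"
    and k: "\<And>n. 0 < k n" "\<And>n. k n \<le> weight (y n)" "\<And>n. k n \<le> weight (y (Suc n))"
    and eq: "\<And>n u. c (y (Suc n) - 1) * u (y (Suc n) - 1) + c (y (Suc n)) * u (y (Suc n) + 1)
         = k n * u (y n) + k (Suc n) * u (y (Suc (Suc n)))"
  shows "resolvent_on_ray k (\<lambda>n. weight (y (Suc n))) (1 / s - 1) (\<lambda>n. green s x (y n))"
proof -
  define u where "u n = green s x (y n)" for n
  define m where "m n = weight (y (Suc n))" for n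
  have u0: "0 \<le> u n" for n using green_nonneg[OF s] by (simp add: u_def)
  have mk: "m n = k n + k (Suc n)" for n
    using eq[of n "\<lambda>_. 1"] by (simp add: m_def weight_def)
  have rec: "flux k u n - flux k u (Suc n) = (1 / s - 1) * m n * u (Suc n)" for n
  proof -
    have "y (Suc n) \<noteq> x" using y[of "Suc n"] by auto
    then have "m n * u (Suc n) = s * (k n * u n + k (Suc n) * u (Suc (Suc n)))"
      using green_equation[OF s, of "y (Suc n)" x] unfolding eq by (simp add: m_def u_def)
    then have "(1 / s) * (m n * u (Suc n)) = k n * u n + k (Suc n) * u (Suc (Suc n))" using s by simp
    then show ?thesis by (simp add: flux_def mk algebra_simps)
  qed
  have up: "weight (y n) * u n \<le> s ^ n / (1 - s)" for n
    using green_decay[OF s, of "y n" x] y[of n] by (simp add: u_def)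
  have "\<bar>flux k u n\<bar> \<le> 2 / (1 - s) * s ^ n" for n
  proof -
    have "k n * u n \<le> weight (y n) * u n" "k n * u (Suc n) \<le> weight (y (Suc n)) * u (Suc n)"
      using k u0 by (auto intro!: mult_right_mono)
    moreover have "s ^ Suc n / (1 - s) \<le> s ^ n / (1 - s)"
      using s by (intro divide_right_mono) (auto simp: mult_left_le_one_le)
    ultimately have "k n * u n \<le> s ^ n / (1 - s)" "k n * u (Suc n) \<le> s ^ n / (1 - s)"
      using up[of n] up[of "Suc n"] by linarith+
    moreover have "0 \<le> k n * u n" "0 \<le> k n * u (Suc n)" using k(1)[of n] u0 by simp_all
    ultimately have "\<bar>k n * u n - k n * u (Suc n)\<bar> \<le> s ^ n / (1 - s) + s ^ n / (1 - s)" by linarith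
    then show ?thesis by (simp add: flux_def algebra_simps)
  qed
  moreover have "(\<lambda>n. 2 / (1 - s) * s ^ n) \<longlonglongrightarrow> 0"
    using tendsto_mult_left[OF LIMSEQ_power_zero[of s], of "2 / (1 - s)"] s by simp
  ultimately have lim: "flux k u \<longlonglongrightarrow> 0"
    by (intro Lim_null_comparison[of "flux k u"]) auto
  have "decseq (flux k u)"
  proof (rule decseq_SucI)
    fix n
    have "0 \<le> (1 / s - 1) * m n * u (Suc n)"
      using s u0[of "Suc n"] weight_pos[of "y (Suc n)"] by (simp add: m_def less_imp_le)
    then show "flux k u (Suc n) \<le> flux k u n" using rec[of n] by linarith
  qed
  then have "0 \<le> flux k u n" for n using lim by (rule decseq_ge)
  moreover have "0 < u 0" using green_pos[OF s, of x] by (simp add: u_def y0)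
  ultimately show ?thesis
    unfolding u_def[symmetric] m_def[symmetric]
    using u0 rec unfolding resolvent_on_ray_def by (simp add: u_def[abs_def] m_def[abs_def])
qed

abbreviation (input) "edges_right x \<equiv> \<lambda>n. c (x + int n)"
abbreviation (input) "edges_left x \<equiv> \<lambda>n. c (x - 1 - int n)"
abbreviation (input) "sites_right x \<equiv> \<lambda>n. weight (x + 1 + int n)"
abbreviation (input) "sites_left x \<equiv> \<lambda>n. weight (x - 1 - int n)"

lemma green_right:
  assumes s: "0 < s" "s < 1"
  shows "resolvent_on_ray (edges_right x) (sites_right x) (1 / s - 1)
           (\<lambda>n. green s x (x + int n))"
proof -
  have "resolvent_on_ray (edges_right x) (\<lambda>n. weight (x + int (Suc n))) (1 / s - 1)
           (\<lambda>n. green s x (x + int n))"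
    by (rule green_resolvent_on_ray[OF s]) (auto simp: c_pos weight_def less_imp_le algebra_simps)
  then show ?thesis by (simp add: algebra_simps)
qed

lemma green_left:
  assumes s: "0 < s" "s < 1"
  shows "resolvent_on_ray (edges_left x) (sites_left x) (1 / s - 1)
           (\<lambda>n. green s x (x - int n))"
proof -
  have "resolvent_on_ray (edges_left x) (\<lambda>n. weight (x - int (Suc n))) (1 / s - 1)
           (\<lambda>n. green s x (x - int n))"
    by (rule green_resolvent_on_ray[OF s]) (auto simp: c_pos weight_def less_imp_le algebra_simps)
  then show ?thesis by (simp add: algebra_simps)
qed

text \<open>
The injected current leaves \<open>x\<close> through the two half-lines, except for the part that leaks at \<open>x\<close>.
Bounds on the two effective conductances therefore determine \<open>green s x x\<close>.
\<close>

lemma green_flux_balance: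
  assumes s: "0 < s" "s < 1"
  shows "flux (edges_right x) (\<lambda>n. green s x (x + int n)) 0 +
         flux (edges_left x) (\<lambda>n. green s x (x - int n)) 0
       = 1 / s - (1 / s - 1) * weight x * green s x x"
proof -
  have "weight x * green s x x = 1 + s * (c (x - 1) * green s x (x - 1) + c x * green s x (x + 1))"
    using green_equation[OF s, of x x] by simp
  then have "c (x - 1) * green s x (x - 1) + c x * green s x (x + 1) = (weight x * green s x x - 1) / s"
    using s by (simp add: field_simps)
  then show ?thesis using s by (simp add: flux_def weight_def field_simps)
qed

end

lemma filterlim_half: "filterlim (\<lambda>n::nat. n div 2) at_top sequentially" "filterlim (\<lambda>n::nat. Suc n div 2) at_top sequentially"
proof -
  have 1: "eventually (\<lambda>n::nat. Z \<le> n div 2) sequentially" for Z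
    using eventually_ge_at_top[of "2 * Z"] by eventually_elim linarith
  have 2: "eventually (\<lambda>n::nat. Z \<le> Suc n div 2) sequentially" for Z
    using eventually_ge_at_top[of "2 * Z"] by eventually_elim linarith
  show "filterlim (\<lambda>n::nat. n div 2) at_top sequentially" "filterlim (\<lambda>n::nat. Suc n div 2) at_top sequentially"
    unfolding filterlim_at_top using 1 2 by auto
qed

lemma sqrt_half_index:
  fixes a :: "nat \<Rightarrow> real"
  assumes a: "(\<lambda>n. sqrt (2 * real n) * a n) \<longlonglongrightarrow> L"
  shows "(\<lambda>n. sqrt (real n) * a (n div 2)) \<longlonglongrightarrow> L" "(\<lambda>n. sqrt (real n) * a (Suc n div 2)) \<longlonglongrightarrow> L"
proof -
  have main: "(\<lambda>n. sqrt (real n) * a (h n)) \<longlonglongrightarrow> L"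
    if h: "filterlim h at_top sequentially" and b: "\<And>n. \<bar>real n - 2 * real (h n)\<bar> \<le> 1" for h
  proof -
    have "(\<lambda>n. 1 / real (h n)) \<longlonglongrightarrow> 0" by (rule filterlim_compose[OF lim_1_over_n h])
    have "(\<lambda>n. real n / (2 * real (h n)) - 1) \<longlonglongrightarrow> 0"
    proof (rule Lim_null_comparison)
      show "(\<lambda>n. 1 / real (h n)) \<longlonglongrightarrow> 0" by fact
      show "eventually (\<lambda>n. norm (real n / (2 * real (h n)) - 1) \<le> 1 / real (h n)) sequentially"
        using filterlim_at_top[THEN iffD1, OF h, THEN spec, of 1]
      proof eventually_elim
        case (elim n)
        then have "real n / (2 * real (h n)) - 1 = (real n - 2 * real (h n)) / (2 * real (h n))"
          by (simp add: field_simps)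
        moreover have "\<bar>(real n - 2 * real (h n)) / (2 * real (h n))\<bar> \<le> 1 / (2 * real (h n))"
          using b[of n] elim by (simp add: abs_divide divide_right_mono)
        moreover have "1 / (2 * real (h n)) \<le> 1 / real (h n)" using elim by (simp add: field_simps)
        ultimately show ?case by simp
      qed
    qed
    then have "(\<lambda>n. real n / (2 * real (h n))) \<longlonglongrightarrow> 1" by (rule LIM_zero_cancel)
    then have "(\<lambda>n. sqrt (real n / (2 * real (h n))) * (sqrt (2 * real (h n)) * a (h n))) \<longlonglongrightarrow> sqrt 1 * L"
      by (intro tendsto_mult tendsto_real_sqrt filterlim_compose[OF a h])
    moreover have "eventually (\<lambda>n. sqrt (real n / (2 * real (h n))) * (sqrt (2 * real (h n)) * a (h n)) = sqrt (real n) * a (h n)) sequentially"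
      using filterlim_at_top[THEN iffD1, OF h, THEN spec, of 1]
      by eventually_elim (simp add: real_sqrt_divide)
    ultimately show ?thesis by (simp add: Lim_transform_eventually)
  qed
  show "(\<lambda>n. sqrt (real n) * a (n div 2)) \<longlonglongrightarrow> L"
    by (rule main[OF filterlim_half(1)]) linarith
  show "(\<lambda>n. sqrt (real n) * a (Suc n div 2)) \<longlonglongrightarrow> L"
    by (rule main[OF filterlim_half(2)]) linarith
qed

text \<open>
A maximum principle in the limit: neither sequence can exceed the common bound asymptotically, so
neither can stay below it without pulling the average below it as well.
\<close>

lemma limit_of_extremal_average:
  fixes f g :: "nat \<Rightarrow> real"
  assumes A: "0 < A" and B: "0 < B" and f: "\<And>n. f n \<le> f' n" "f' \<longlonglongrightarrow> L"
    and g: "\<And>n. g n \<le> g' n" "g' \<longlonglongrightarrow> L"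
    and avg: "(\<lambda>n. A * f n + B * g n) \<longlonglongrightarrow> (A + B) * L"
  shows "g \<longlonglongrightarrow> L"
proof (rule tendsto_sandwich[OF _ _ _ g(2)])
  have "((A * f n + B * g n) - A * f' n) / B \<le> g n" for n
    using mult_left_mono[OF f(1)[of n] less_imp_le[OF A]] B by (simp add: field_simps)
  then show "eventually (\<lambda>n. ((A * f n + B * g n) - A * f' n) / B \<le> g n) sequentially" by simp
  have "(\<lambda>n. ((A * f n + B * g n) - A * f' n) / B) \<longlonglongrightarrow> ((A + B) * L - A * L) / B"
    by (intro tendsto_intros avg f) (use B in simp)
  then show "(\<lambda>n. ((A * f n + B * g n) - A * f' n) / B) \<longlonglongrightarrow> L" using B by (simp add: algebra_simps)
qed (use g in simp)

context conductances
begin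

lemma green_upper:
  assumes R: "two_sided_mean (\<lambda>y. 1 / c y) \<rho>" "\<rho> > 0"
    and m': "\<And>y. 0 \<le> m' y" "\<And>y. m' y \<le> weight y"
    and A: "two_sided_mean m' M" "M > 0" and \<eta>: "\<eta> > 0"
  shows "eventually (\<lambda>\<mu>. sqrt \<mu> * green (1 / (1 + \<mu>)) x x \<le> (sqrt (\<rho> / M) + \<eta>) / 2 * (1 + \<mu>)) (at_right 0)"
proof -
  have right: "eventually (\<lambda>\<mu>. \<forall>u. resolvent_on_ray (edges_right x) (sites_right x) \<mu> u \<longrightarrow>
           u 0 \<le> (sqrt (\<rho> / M) + \<eta>) / sqrt \<mu> * flux (edges_right x) u 0) (at_right 0)"
    by (rule ray_flux_lower[where m' = "\<lambda>n. m' (x + 1 + int n)"])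
       (use c_pos weight_pos m' R A \<eta> in \<open>auto simp: two_sided_mean_def\<close>)
  have left: "eventually (\<lambda>\<mu>. \<forall>u. resolvent_on_ray (edges_left x) (sites_left x) \<mu> u \<longrightarrow>
           u 0 \<le> (sqrt (\<rho> / M) + \<eta>) / sqrt \<mu> * flux (edges_left x) u 0) (at_right 0)"
    by (rule ray_flux_lower[where m' = "\<lambda>n. m' (x - 1 - int n)"])
       (use c_pos weight_pos m' R A \<eta> in \<open>auto simp: two_sided_mean_def\<close>)
  show ?thesis using right left eventually_pos
  proof eventually_elim
    case (elim \<mu>)
    define s where "s = 1 / (1 + \<mu>)"
    have s: "0 < s" "s < 1" "1 / s - 1 = \<mu>" "1 / s = 1 + \<mu>" using elim by (auto simp: s_def)
    define K where "K = sqrt (\<rho> / M) + \<eta>"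
    have K: "K > 0" using \<eta> R(2) A(2) by (simp add: K_def add_nonneg_pos)
    let ?JR = "flux (edges_right x) (\<lambda>n. green s x (x + int n)) 0"
    let ?JL = "flux (edges_left x) (\<lambda>n. green s x (x - int n)) 0"
    have r: "green s x x \<le> K / sqrt \<mu> * ?JR"
      using elim(1)[rule_format, OF green_right[OF s(1,2), unfolded s(3)]] by (simp add: K_def)
    have l: "green s x x \<le> K / sqrt \<mu> * ?JL"
      using elim(2)[rule_format, OF green_left[OF s(1,2), unfolded s(3)]] by (simp add: K_def)
    have "?JR + ?JL = 1 + \<mu> - \<mu> * weight x * green s x x"
      using green_flux_balance[OF s(1,2), of x] unfolding s(3) unfolding s(4) .
    moreover have "0 \<le> \<mu> * weight x * green s x x"
      using elim(3) weight_pos[of x] green_nonneg[OF s(1,2), of x x] by simp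
    ultimately have J: "?JR + ?JL \<le> 1 + \<mu>" by linarith
    have sm: "sqrt \<mu> > 0" using elim by simp
    have "2 * green s x x \<le> K / sqrt \<mu> * (?JR + ?JL)"
      using r l by (simp add: distrib_left)
    also have "\<dots> \<le> K / sqrt \<mu> * (1 + \<mu>)"
      using J K sm by (intro mult_left_mono) auto
    finally have "green s x x * 2 * sqrt \<mu> \<le> K * (1 + \<mu>)" using sm by (simp add: field_simps)
    then show ?case unfolding s_def[symmetric] K_def[symmetric] by (simp add: mult_ac)
  qed
qed

lemma green_lower:
  assumes R: "two_sided_mean (\<lambda>y. 1 / c y) \<rho>" "\<rho> > 0"
    and A: "two_sided_mean weight M" "M > 0" and \<eta>: "\<eta> > 0"
  shows "eventually (\<lambda>\<mu>. 1 / (2 * (sqrt (M / \<rho>) + \<eta>) + sqrt \<mu> * weight x) \<le> sqrt \<mu> * green (1 / (1 + \<mu>)) x x) (at_right 0)"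
proof -
  have right: "eventually (\<lambda>\<mu>. \<forall>u. resolvent_on_ray (edges_right x) (sites_right x) \<mu> u \<longrightarrow>
           flux (edges_right x) u 0 \<le> sqrt \<mu> * (sqrt (M / \<rho>) + \<eta>) * u 0) (at_right 0)"
    by (rule ray_flux_upper)
       (use c_pos weight_pos R A \<eta> in \<open>auto simp: two_sided_mean_def\<close>)
  have left: "eventually (\<lambda>\<mu>. \<forall>u. resolvent_on_ray (edges_left x) (sites_left x) \<mu> u \<longrightarrow>
           flux (edges_left x) u 0 \<le> sqrt \<mu> * (sqrt (M / \<rho>) + \<eta>) * u 0) (at_right 0)"
    by (rule ray_flux_upper)
       (use c_pos weight_pos R A \<eta> in \<open>auto simp: two_sided_mean_def\<close>)
  show ?thesis using right left eventually_pos
  proof eventually_elim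
    case (elim \<mu>)
    define s where "s = 1 / (1 + \<mu>)"
    have s: "0 < s" "s < 1" "1 / s - 1 = \<mu>" "1 / s = 1 + \<mu>" using elim by (auto simp: s_def)
    define K where "K = sqrt (M / \<rho>) + \<eta>"
    have K: "K > 0" using \<eta> R(2) A(2) by (simp add: K_def add_nonneg_pos)
    let ?JR = "flux (edges_right x) (\<lambda>n. green s x (x + int n)) 0"
    let ?JL = "flux (edges_left x) (\<lambda>n. green s x (x - int n)) 0"
    have r: "?JR \<le> sqrt \<mu> * K * green s x x"
      using elim(1)[rule_format, OF green_right[OF s(1,2), unfolded s(3)]] by (simp add: K_def)
    have l: "?JL \<le> sqrt \<mu> * K * green s x x"
      using elim(2)[rule_format, OF green_left[OF s(1,2), unfolded s(3)]] by (simp add: K_def)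
    have b: "?JR + ?JL = 1 + \<mu> - \<mu> * weight x * green s x x"
      using green_flux_balance[OF s(1,2), of x] unfolding s(3) unfolding s(4) .
    have sm: "sqrt \<mu> > 0" "\<mu> = sqrt \<mu> * sqrt \<mu>" using elim by auto
    have "1 \<le> sqrt \<mu> * K * green s x x + sqrt \<mu> * K * green s x x + (sqrt \<mu> * sqrt \<mu>) * weight x * green s x x"
      using r l b elim(3) unfolding sm(2)[symmetric] by linarith
    also have "\<dots> = (2 * K + sqrt \<mu> * weight x) * (sqrt \<mu> * green s x x)"
      by (simp only: algebra_simps)
    finally have 1: "1 \<le> (2 * K + sqrt \<mu> * weight x) * (sqrt \<mu> * green s x x)" .
    have "2 * K + sqrt \<mu> * weight x > 0" using K sm weight_pos[of x] by (simp add: add_pos_pos)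
    then have "1 / (2 * K + sqrt \<mu> * weight x) \<le> sqrt \<mu> * green s x x"
      using 1 by (simp add: pos_divide_le_eq mult.commute)
    then show ?case unfolding s_def[symmetric] K_def[symmetric] .
  qed
qed

text \<open>
Here \<open>\<mu> = 1 / s - 1\<close>. The hypotheses \<open>up\<close> and \<open>lo\<close> cover the two cases with finite mean resistance
at once: for weights of finite mean \<open>M\<close> one takes \<open>A = sqrt (\<rho> / M)\<close>, and for weights of infinite
mean \<open>A = 0\<close>, with truncated weights in \<open>up\<close>.
\<close>

lemma green_limit:
  assumes R: "two_sided_mean (\<lambda>y. 1 / c y) \<rho>" "\<rho> > 0"
    and up: "\<And>\<delta>. \<delta> > A \<Longrightarrow> \<exists>m' M. (\<forall>y. 0 \<le> m' y \<and> m' y \<le> weight y) \<and> two_sided_mean m' M \<and> M > 0 \<and> sqrt (\<rho> / M) < \<delta>"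
    and lo: "A = 0 \<or> (\<exists>M>0. two_sided_mean weight M \<and> A = sqrt (\<rho> / M))"
  shows "((\<lambda>\<mu>. sqrt \<mu> * green (1 / (1 + \<mu>)) x x) \<longlongrightarrow> A / 2) (at_right 0)"
proof (rule order_tendstoI)
  fix y assume "A / 2 < y"
  then have "2 * y > A" by simp
  from up[OF this] obtain m' M where m: "\<And>z. 0 \<le> m' z" "\<And>z. m' z \<le> weight z" "two_sided_mean m' M" "M > 0" "sqrt (\<rho> / M) < 2 * y"
    by blast
  define \<eta> where "\<eta> = (2 * y - sqrt (\<rho> / M)) / 2"
  have \<eta>: "\<eta> > 0" "(sqrt (\<rho> / M) + \<eta>) / 2 < y" using m(5) by (auto simp: \<eta>_def field_simps)
  have "((\<lambda>\<mu>::real. (sqrt (\<rho> / M) + \<eta>) / 2 * (1 + \<mu>)) \<longlongrightarrow> (sqrt (\<rho> / M) + \<eta>) / 2 * (1 + 0)) (at_right 0)"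
    by (intro tendsto_intros)
  then have "eventually (\<lambda>\<mu>. (sqrt (\<rho> / M) + \<eta>) / 2 * (1 + \<mu>) < y) (at_right 0)"
    by (rule order_tendstoD) (use \<eta> in simp)
  with green_upper[OF R m(1,2,3,4) \<eta>(1), of x]
  show "eventually (\<lambda>\<mu>. sqrt \<mu> * green (1 / (1 + \<mu>)) x x < y) (at_right 0)"
    by eventually_elim linarith
next
  fix y assume y: "y < A / 2"
  from lo show "eventually (\<lambda>\<mu>. y < sqrt \<mu> * green (1 / (1 + \<mu>)) x x) (at_right 0)"
  proof
    assume "A = 0"
    show ?thesis using eventually_pos
    proof eventually_elim
      case (elim \<mu>)
      then have "0 \<le> green (1 / (1 + \<mu>)) x x" by (intro green_nonneg) auto
      then have "0 \<le> sqrt \<mu> * green (1 / (1 + \<mu>)) x x" using elim by simp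
      then show ?case using y \<open>A = 0\<close> by simp
    qed
  next
    assume "\<exists>M>0. two_sided_mean weight M \<and> A = sqrt (\<rho> / M)"
    then obtain M where M: "M > 0" "two_sided_mean weight M" "A = sqrt (\<rho> / M)" by blast
    have pos: "sqrt (M / \<rho>) > 0" using M R by simp
    have A2: "1 / (2 * (sqrt (M / \<rho>) + 0) + 0) = A / 2"
      using M R(2) by (simp add: real_sqrt_divide)
    have "((\<lambda>\<eta>. 1 / (2 * (sqrt (M / \<rho>) + \<eta>) + 0)) \<longlongrightarrow> 1 / (2 * (sqrt (M / \<rho>) + 0) + 0)) (at_right 0)"
      by (intro tendsto_intros) (use pos in auto)
    then have "eventually (\<lambda>\<eta>. y < 1 / (2 * (sqrt (M / \<rho>) + \<eta>) + 0)) (at_right 0)"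
      unfolding A2 by (rule order_tendstoD) (use y in simp)
    from eventually_happens'[OF trivial_limit_at_right_real eventually_conj[OF this eventually_pos]]
    obtain \<eta> where \<eta>: "\<eta> > 0" "y < 1 / (2 * (sqrt (M / \<rho>) + \<eta>) + 0)" by auto
    have pos2: "0 < 2 * (sqrt (M / \<rho>) + \<eta>) + sqrt 0 * weight x"
      unfolding real_sqrt_zero mult_zero_left add_0_right
      by (intro mult_pos_pos add_pos_pos pos \<eta>(1)) simp
    have "((\<lambda>\<mu>. 1 / (2 * (sqrt (M / \<rho>) + \<eta>) + sqrt \<mu> * weight x)) \<longlongrightarrow> 1 / (2 * (sqrt (M / \<rho>) + \<eta>) + sqrt 0 * weight x)) (at_right 0)"
      by (intro tendsto_intros less_imp_neq[OF pos2, THEN not_sym])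
    then have "eventually (\<lambda>\<mu>. y < 1 / (2 * (sqrt (M / \<rho>) + \<eta>) + sqrt \<mu> * weight x)) (at_right 0)"
      by (rule order_tendstoD) (use \<eta> in simp)
    with green_lower[OF R M(2,1) \<eta>(1), of x] show ?thesis by eventually_elim linarith
  qed
qed

lemma return_series:
  assumes "0 < eps"
  shows "(\<Sum>n. q x (2 * n) x * exp (- eps * real n)) = green (exp (- eps / 2)) x x"
proof -
  define s where "s = exp (- eps / 2)"
  have s: "0 < s" "s < 1" using assms by (auto simp: s_def)
  have "(\<lambda>n. s ^ (2 * n) * q x (2 * n) x) sums green s x x"
  proof (rule sums_mono_reindex[THEN iffD2])
    show "strict_mono ((*) (2::nat))" by (simp add: strict_mono_def)
    show "s ^ n * q x n x = 0" if "n \<notin> range ((*) (2::nat))" for n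
    proof -
      have "odd n" using that by (auto simp: image_def elim!: evenE)
      then show ?thesis using q_parity[of x x n] by simp
    qed
    show "(\<lambda>n. s ^ n * q x n x) sums green s x x"
      unfolding green_def using green_summable[OF s] by (rule summable_sums)
  qed
  moreover have "s ^ (2 * n) = exp (- eps * real n)" for n
    unfolding s_def exp_of_nat_mult[symmetric] by simp
  ultimately show ?thesis unfolding s_def[symmetric] by (simp add: sums_iff mult.commute)
qed

text \<open>
Only even times contribute to the Green function on the diagonal, so with \<open>s = exp (- eps / 2)\<close> it is
the Laplace sum of the return kernel at rate \<open>eps\<close>; the rates are related by \<open>\<mu> = exp (eps / 2) - 1\<close>.
\<close>

lemma return_asymptotics:
  assumes "((\<lambda>\<mu>. sqrt \<mu> * green (1 / (1 + \<mu>)) x x) \<longlongrightarrow> A / 2) (at_right 0)"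
  shows "(\<lambda>n. sqrt (2 * real n) * q x (2 * n) x) \<longlonglongrightarrow> A / sqrt pi"
proof -
  have fl: "filterlim (\<lambda>eps::real. exp (eps / 2) - 1) (at_right 0) (at_right 0)"
    unfolding filterlim_at by (auto intro!: tendsto_eq_intros eventually_at_rightI[of 0 1])
  have r: "((\<lambda>eps::real. sqrt (eps / (exp (eps / 2) - 1))) \<longlongrightarrow> sqrt 2) (at_right 0)"
    by (intro tendsto_real_sqrt) real_asymp
  have "((\<lambda>eps. sqrt eps * (\<Sum>n. q x (2 * n) x * exp (- eps * real n))) \<longlongrightarrow> sqrt 2 * (A / 2)) (at_right 0)"
  proof (rule Lim_transform_eventually)
    show "((\<lambda>eps. sqrt (eps / (exp (eps / 2) - 1)) * (sqrt (exp (eps / 2) - 1) * green (1 / (1 + (exp (eps / 2) - 1))) x x)) \<longlongrightarrow> sqrt 2 * (A / 2)) (at_right 0)"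
      by (intro tendsto_mult r filterlim_compose[OF assms fl])
    show "eventually (\<lambda>eps. sqrt (eps / (exp (eps / 2) - 1)) * (sqrt (exp (eps / 2) - 1) * green (1 / (1 + (exp (eps / 2) - 1))) x x)
       = sqrt eps * (\<Sum>n. q x (2 * n) x * exp (- eps * real n))) (at_right 0)"
      using eventually_pos
    proof eventually_elim
      case (elim eps)
      have "1 / (1 + (exp (eps / 2) - 1)) = exp (- eps / 2)" by (simp add: exp_minus inverse_eq_divide)
      moreover have "sqrt (exp (eps / 2) - 1) > 0" using elim by simp
      ultimately show ?case unfolding return_series[OF elim] by (simp add: real_sqrt_divide)
    qed
  qed
  moreover have "decseq (\<lambda>n. q x (2 * n) x)" by (rule decseq_SucI) (rule q_return_decreasing)
  ultimately have "(\<lambda>n. sqrt (real n) * q x (2 * n) x) \<longlonglongrightarrow> (sqrt 2 * (A / 2)) / sqrt pi"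
    using q_nonneg by (intro tauberian_sqrt) auto
  from tendsto_mult_left[OF this, of "sqrt 2"]
  show ?thesis by (simp add: real_sqrt_mult mult_ac)
qed

text \<open>
From returns to all endpoints. Let \<open>W n z\<close> be \<open>sqrt n\<close> times the sum of the kernel at the times \<open>n\<close>
and \<open>n + 1\<close>, only one of which is nonzero. By symmetry and Cauchy--Schwarz, \<open>W n z\<close> is at most an
average of return kernels at \<open>x\<close> and at \<open>z\<close>, so its upper limit is at most \<open>L\<close> at every \<open>z\<close>. At
\<open>z = x\<close> it converges to \<open>L\<close>. Where it converges to \<open>L\<close>, so does the average of its values at the
two neighbours, and neither neighbour can exceed \<open>L\<close> in the limit; hence both converge to \<open>L\<close>.
\<close>

lemma local_limit_of_returns:
  assumes ret: "\<And>x. (\<lambda>n. sqrt (2 * real n) * q x (2 * n) x) \<longlonglongrightarrow> L"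
    and ev: "even (y - x)"
  shows "(\<lambda>n. sqrt (2 * real n) * q x (2 * n) y) \<longlonglongrightarrow> L"
proof -
  define v where "v n z = q x n z + q x (Suc n) z" for n z
  define W where "W n z = sqrt (real n) * v n z" for n z
  define b where "b n z = (sqrt (real n) * q x (2 * (n div 2)) x + sqrt (real n) * q z (2 * (n div 2)) z) / 2" for n z
  have dec: "decseq (\<lambda>n. q z (2 * n) z)" for z by (rule decseq_SucI) (rule q_return_decreasing)
  have b_lim: "(\<lambda>n. b n z) \<longlonglongrightarrow> L" for z
  proof -
    have "(\<lambda>n. b n z) \<longlonglongrightarrow> (L + L) / 2" unfolding b_def
      by (intro tendsto_divide tendsto_add tendsto_const
          sqrt_half_index(1)[OF ret[of x]] sqrt_half_index(1)[OF ret[of z]]) auto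
    then show ?thesis by simp
  qed
  have W_le: "W n z \<le> b n z" for n z
  proof -
    have half: "q x (p + r) z \<le> (q x (2 * (n div 2)) x + q z (2 * (n div 2)) z) / 2"
      if "n div 2 \<le> p" "n div 2 \<le> r" for p r
      using q_le_returns[of x p r z] decseqD[OF dec[of x] that(1)] decseqD[OF dec[of z] that(2)] by simp
    have "v n z \<le> (q x (2 * (n div 2)) x + q z (2 * (n div 2)) z) / 2"
    proof (cases "even (x + z + int n)")
      case True
      then have "v n z = q x n z" unfolding v_def using q_parity[of x z "Suc n"] by simp
      then show ?thesis using half[of "n div 2" "n - n div 2"] by simp
    next
      case False
      then have "v n z = q x (Suc n) z" unfolding v_def using q_parity[of x z n] by simp
      then show ?thesis using half[of "n div 2" "Suc n - n div 2"] by simp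
    qed
    then have "sqrt (real n) * v n z \<le> sqrt (real n) * ((q x (2 * (n div 2)) x + q z (2 * (n div 2)) z) / 2)"
      by (rule mult_left_mono) simp
    then show ?thesis by (simp add: W_def b_def distrib_left)
  qed
  have W_x: "(\<lambda>n. W n x) \<longlonglongrightarrow> L"
  proof -
    have "v n x = q x (2 * (Suc n div 2)) x" for n
    proof (cases "even n")
      case True
      then show ?thesis unfolding v_def using q_parity[of x x "Suc n"] by simp
    next
      case False
      then have "2 * (Suc n div 2) = Suc n" by simp
      then show ?thesis unfolding v_def using q_parity[of x x n] False by simp
    qed
    then show ?thesis using sqrt_half_index(2)[OF ret[of x]] by (simp add: W_def)
  qed
  have X: "(\<lambda>n. c (z - 1) * W n (z - 1) + c z * W n (z + 1)) \<longlonglongrightarrow> weight z * L" if "(\<lambda>n. W n z) \<longlonglongrightarrow> L" for z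
  proof (rule Lim_transform_eventually)
    have "(\<lambda>n. sqrt (real n / real (Suc n))) \<longlonglongrightarrow> sqrt 1"
      by (intro tendsto_real_sqrt LIMSEQ_n_over_Suc_n)
    moreover have "(\<lambda>n. W (Suc n) z) \<longlonglongrightarrow> L" using that by (rule LIMSEQ_Suc)
    ultimately show "(\<lambda>n. weight z * (sqrt (real n / real (Suc n)) * W (Suc n) z)) \<longlonglongrightarrow> weight z * L"
      by (simp only: real_sqrt_one) (drule (1) tendsto_mult, drule tendsto_mult_left[where c = "weight z"], simp)
    have "weight z * (sqrt (real n / real (Suc n)) * W (Suc n) z) = c (z - 1) * W n (z - 1) + c z * W n (z + 1)" for n
    proof -
      have 1: "weight z * v (Suc n) z = c (z - 1) * v n (z - 1) + c z * v n (z + 1)"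
        unfolding v_def q_Suc distrib_left weight_step by simp
      have 2: "sqrt (real n / real (Suc n)) * W (Suc n) z = sqrt (real n) * v (Suc n) z"
        by (simp add: W_def real_sqrt_divide del: of_nat_Suc)
      have "weight z * (sqrt (real n / real (Suc n)) * W (Suc n) z) = sqrt (real n) * (weight z * v (Suc n) z)"
        unfolding 2 by (simp only: mult.left_commute)
      then show ?thesis unfolding 1 by (simp add: W_def algebra_simps)
    qed
    then show "eventually (\<lambda>n. weight z * (sqrt (real n / real (Suc n)) * W (Suc n) z)
        = c (z - 1) * W n (z - 1) + c z * W n (z + 1)) sequentially" by simp
  qed
  have right: "(\<lambda>n. W n (z + 1)) \<longlonglongrightarrow> L" if "(\<lambda>n. W n z) \<longlonglongrightarrow> L" for z
    using X[OF that] unfolding weight_def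
    by (rule limit_of_extremal_average[OF c_pos c_pos W_le b_lim W_le b_lim])
  have left: "(\<lambda>n. W n (z - 1)) \<longlonglongrightarrow> L" if "(\<lambda>n. W n z) \<longlonglongrightarrow> L" for z
  proof (rule limit_of_extremal_average[OF c_pos c_pos W_le b_lim W_le b_lim])
    show "(\<lambda>n. c z * W n (z + 1) + c (z - 1) * W n (z - 1)) \<longlonglongrightarrow> (c z + c (z - 1)) * L"
      using X[OF that] by (simp add: weight_def add.commute)
  qed
  have "(\<lambda>n. W n y) \<longlonglongrightarrow> L"
  proof (induction y rule: int_induct[of _ x])
    case base show ?case by (rule W_x)
  next
    case (step1 i) then show ?case using right by simp
  next
    case (step2 i) then show ?case using left by simp
  qed
  from LIMSEQ_subseq_LIMSEQ[OF this, of "(*) (2::nat)"]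
  have "(\<lambda>n. W (2 * n) y) \<longlonglongrightarrow> L" by (simp add: strict_mono_def o_def)
  moreover have "W (2 * n) y = sqrt (2 * real n) * q x (2 * n) y" for n
    using q_parity[of x y "Suc (2 * n)"] ev by (simp add: W_def v_def)
  ultimately show ?thesis by simp
qed

end

section \<open>Resistances of infinite mean\<close>

lemma half_ratio: "(\<lambda>n. real (n div 2) / real n) \<longlonglongrightarrow> 1 / 2"
proof (rule LIM_zero_cancel, rule Lim_null_comparison[OF _ lim_1_over_n])
  show "eventually (\<lambda>n. norm (real (n div 2) / real n - 1 / 2) \<le> 1 / real n) sequentially"
    using eventually_gt_at_top[of 0]
  proof eventually_elim
    case (elim n)
    have "\<bar>real (n div 2) - real n / 2\<bar> \<le> 1" by linarith
    then have "\<bar>real (n div 2) - real n / 2\<bar> / real n \<le> 1 / real n" by (rule divide_right_mono) simp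
    moreover have "real (n div 2) / real n - 1 / 2 = (real (n div 2) - real n / 2) / real n"
      using elim by (simp add: field_simps)
    ultimately show ?case by simp
  qed
qed

lemma mean_at_half:
  fixes a :: "nat \<Rightarrow> real"
  assumes "(\<lambda>n. a n / real n) \<longlonglongrightarrow> \<alpha>"
  shows "(\<lambda>n. a (n div 2) / real n) \<longlonglongrightarrow> \<alpha> / 2"
proof -
  note h = filterlim_half(1)
  have "(\<lambda>n. a (n div 2) / real (n div 2) * (real (n div 2) / real n)) \<longlonglongrightarrow> \<alpha> * (1 / 2)"
    by (intro tendsto_mult half_ratio filterlim_compose[OF assms h])
  moreover have "eventually (\<lambda>n. a (n div 2) / real (n div 2) * (real (n div 2) / real n) = a (n div 2) / real n) sequentially"
    using filterlim_at_top[THEN iffD1, OF h, THEN spec, of 1] by eventually_elim simp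
  ultimately show ?thesis by (simp add: Lim_transform_eventually)
qed

text \<open>
Half of the indices \<open>y\<close> already suffice: for \<open>y\<close> between \<open>n / 2\<close> and \<open>n\<close> the inner sum is of order
\<open>n\<close>, and the truncated resistances on this range add up to an arbitrarily large multiple of \<open>n\<close>.
\<close>

lemma superquadratic_growth:
  fixes r m :: "nat \<Rightarrow> real"
  assumes r: "\<And>n. 0 \<le> r n" and m: "\<And>n. 0 \<le> m n"
    and A: "has_mean m M" "M > 0"
    and R: "\<And>K. \<exists>r' \<rho>. (\<forall>n. 0 \<le> r' n \<and> r' n \<le> r n) \<and> has_mean r' \<rho> \<and> \<rho> > K"
  shows "eventually (\<lambda>n. K * (real n)\<^sup>2 \<le> (\<Sum>y<n. r y * (\<Sum>i<y. m i))) sequentially"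
proof -
  obtain r' \<rho> where r': "\<And>n. 0 \<le> r' n" "\<And>n. r' n \<le> r n" and \<rho>: "has_mean r' \<rho>" "\<rho> > 4 * K / M"
    using R[of "4 * K / M"] by blast
  define S where "S n = (\<Sum>i<n. m i)" for n
  define P where "P n = (\<Sum>i<n. r' i)" for n
  have Smono: "S a \<le> S b" if "a \<le> b" for a b
    unfolding S_def using that m by (intro sum_mono2) auto
  have S0: "0 \<le> S n" for n unfolding S_def using m by (intro sum_nonneg) auto
  have lim: "(\<lambda>n. (S (n div 2) / real n) * (P n / real n - P (n div 2) / real n)) \<longlonglongrightarrow> M / 2 * (\<rho> - \<rho> / 2)"
    using A(1) \<rho>(1) unfolding S_def P_def by (intro tendsto_mult tendsto_diff mean_at_half)
  have "K < M / 2 * (\<rho> - \<rho> / 2)" using \<rho>(2) A(2) by (simp add: field_simps)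
  from order_tendstoD(1)[OF lim this] eventually_gt_at_top[of 0]
  have "eventually (\<lambda>n. K * (real n)\<^sup>2 \<le> (\<Sum>y<n. r y * S y)) sequentially"
  proof eventually_elim
    case (elim n)
    define h where "h = n div 2"
    have split: "(\<Sum>i<n. f i) = (\<Sum>i<h. f i) + (\<Sum>i=h..<n. f i)" for f :: "nat \<Rightarrow> real"
    proof -
      have "{..<n} = {..<h} \<union> {h..<n}" by (auto simp: h_def)
      then show ?thesis by (simp add: sum.union_disjoint ivl_disj_int)
    qed
    have "S h * (P n - P h) = (\<Sum>i=h..<n. r' i * S h)"
      unfolding P_def split[of r'] by (simp add: sum_distrib_left mult.commute)
    also have "\<dots> \<le> (\<Sum>i=h..<n. r i * S i)"
      using r' r S0 Smono by (intro sum_mono mult_mono) auto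
    also have "\<dots> \<le> (\<Sum>i<n. r i * S i)"
      unfolding split[of "\<lambda>i. r i * S i"] using r S0 by (simp add: sum_nonneg)
    finally have 1: "S h * (P n - P h) \<le> (\<Sum>i<n. r i * S i)" .
    have "K * (real n)\<^sup>2 \<le> ((S h / real n) * (P n / real n - P h / real n)) * (real n)\<^sup>2"
      using elim(1) by (intro mult_right_mono) (auto simp: h_def)
    also have "\<dots> = S h * (P n - P h)" using elim(2) by (simp add: power2_eq_square field_simps)
    finally show ?case using 1 by linarith
  qed
  then show ?thesis by (simp add: S_def)
qed

context conductances
begin

text \<open>
One half of a solution of the Poisson equation \<open>transition poisson = poisson + 1\<close> away from the origin, obtained by
integrating the equation twice outwards from 0.
\<close>

definition ray_poisson :: "(nat \<Rightarrow> real) \<Rightarrow> (nat \<Rightarrow> real) \<Rightarrow> nat \<Rightarrow> real" where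
  "ray_poisson k m n = (\<Sum>y<n. 1 / k y * (\<Sum>i<y. m i))"

lemma ray_poisson_second_difference:
  assumes "0 < k j" "0 < k (Suc j)"
  shows "k (Suc j) * (ray_poisson k m (Suc (Suc j)) - ray_poisson k m (Suc j))
       - k j * (ray_poisson k m (Suc j) - ray_poisson k m j) = m j"
  using assms by (simp add: ray_poisson_def)

abbreviation "poisson_right \<equiv> ray_poisson (\<lambda>n. c (int n)) (\<lambda>n. weight (1 + int n))"
abbreviation "poisson_left \<equiv> ray_poisson (\<lambda>n. c (- 1 - int n)) (\<lambda>n. weight (- 1 - int n))"

definition poisson :: "int \<Rightarrow> real" where
  "poisson z = (if 0 \<le> z then poisson_right (nat z) else poisson_left (nat (- z)))"

lemma poisson_of_nat: "poisson (int n) = poisson_right n" "poisson (- int n) = poisson_left n"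
  by (auto simp: poisson_def ray_poisson_def)

lemma poisson_step: "weight z * transition poisson z \<le> weight z * (poisson z + 1)"
proof -
  have eq: "weight z * transition poisson z \<le> weight z * (poisson z + 1)"
    if "c z * (poisson (z + 1) - poisson z) - c (z - 1) * (poisson z - poisson (z - 1)) = weight z"
    using that unfolding weight_step by (simp add: weight_def algebra_simps)
  show ?thesis
  proof (cases z rule: int_cases3)
    case zero
    have "poisson 1 = 0" "poisson (- 1) = 0" "poisson 0 = 0"
      using poisson_of_nat[of 1] poisson_of_nat[of 0] by (auto simp: ray_poisson_def)
    then show ?thesis using weight_pos[of 0] by (simp add: weight_step zero)
  next
    case (pos n)
    then obtain j where j: "n = Suc j" by (cases n) auto
    have z: "z - 1 = int j" "z = int (Suc j)" "z + 1 = int (Suc (Suc j))" "weight z = weight (1 + int j)"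
      using pos j by auto
    show ?thesis
      by (rule eq, unfold z(1,3,4), unfold z(2) poisson_of_nat, rule ray_poisson_second_difference) (rule c_pos)+
  next
    case (neg n)
    then obtain j where j: "n = Suc j" by (cases n) auto
    have z: "z + 1 = - int j" "z = - int (Suc j)" "z - 1 = - int (Suc (Suc j))" using neg j by auto
    have cz: "c z = c (- 1 - int j)" "c (z - 1) = c (- 1 - int (Suc j))" "weight z = weight (- 1 - int j)"
      using z by (auto intro!: arg_cong[where f = c] arg_cong[where f = weight])
    have "c (- 1 - int (Suc j)) * (poisson (z - 1) - poisson z) - c (- 1 - int j) * (poisson z - poisson (z + 1)) = weight (- 1 - int j)"
      by (unfold z(1,3), unfold z(2) poisson_of_nat, rule ray_poisson_second_difference) (rule c_pos)+
    then show ?thesis unfolding cz[symmetric] by (intro eq) (simp add: algebra_simps)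
  qed
qed

text \<open>
By the Poisson equation the expectation of \<open>poisson\<close> at the position of the walk grows by at most 1 in
each unit of time. It replaces the second moment: \<open>poisson\<close> grows faster than quadratically exactly because the
resistances have infinite mean, so the walk stays within \<open>o(sqrt n)\<close> of its starting point.
\<close>

lemma poisson_expectation: "ip (q 0 n) poisson \<le> real n"
proof (induction n)
  case 0
  have "ip (q 0 0) poisson = (\<Sum>y\<in>{0}. weight y * q 0 0 y * poisson y)"
    by (rule ip_eq) (auto simp: q_0 dirac_def)
  also have "\<dots> = 0" using poisson_of_nat(1)[of 0] by (simp add: ray_poisson_def)
  finally show ?case by simp
next
  case (Suc n)
  have "ip (q 0 (Suc n)) poisson = ip (q 0 n) (transition poisson)"
    unfolding q_Suc by (rule ip_step[OF fin_supp_q])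
  also have "\<dots> \<le> ip (q 0 n) (\<lambda>z. poisson z + 1)"
    unfolding ip_def
  proof (rule sum_mono)
    fix z
    have "q 0 n z * (weight z * transition poisson z) \<le> q 0 n z * (weight z * (poisson z + 1))"
      by (rule mult_left_mono[OF poisson_step q_nonneg])
    then show "weight z * q 0 n z * transition poisson z \<le> weight z * q 0 n z * (poisson z + 1)" by (simp add: mult_ac)
  qed
  also have "\<dots> = ip (q 0 n) poisson + ip (q 0 n) (\<lambda>_. 1)"
    by (simp add: ip_def sum.distrib distrib_left)
  finally show ?case using Suc q_mass[of 0 n] by simp
qed

lemma ray_poisson_mono:
  assumes "\<And>n. 0 < k n" "\<And>n. 0 < m n" "a \<le> b"
  shows "ray_poisson k m a \<le> ray_poisson k m b"
  unfolding ray_poisson_def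
  by (rule sum_mono2) (use assms in \<open>auto intro!: divide_nonneg_nonneg sum_nonneg mult_nonneg_nonneg simp: less_imp_le\<close>)

lemma poisson_outside:
  assumes "B \<le> poisson_right R" "B \<le> poisson_left R" "int R \<le> \<bar>z\<bar>"
  shows "B \<le> poisson z"
proof (cases "0 \<le> z")
  case True
  then have "R \<le> nat z" using assms by linarith
  then show ?thesis using True assms c_pos weight_pos ray_poisson_mono[of "\<lambda>n. c (int n)" "\<lambda>n. weight (1 + int n)" R "nat z"] by (simp add: poisson_def)
next
  case False
  then have "R \<le> nat (- z)" using assms by linarith
  then show ?thesis using False assms c_pos weight_pos ray_poisson_mono[of "\<lambda>n. c (- 1 - int n)" "\<lambda>n. weight (- 1 - int n)" R "nat (- z)"] by (simp add: poisson_def)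
qed

lemma poisson_nonneg: "0 \<le> poisson z"
  by (rule poisson_outside[of 0 0]) (auto simp: ray_poisson_def)

text \<open>
Markov's inequality for \<open>poisson\<close> shows that at time \<open>n\<close> the walk is in the window \<open>S\<close> with probability at
least 1/2, and then Cauchy--Schwarz, in the linearized form with parameter \<open>t\<close>, bounds the squared
norm of \<open>q 0 n\<close> from below.
\<close>

lemma return_lower_bound:
  assumes B: "(\<Sum>z\<in>{- int R<..<int R}. weight z) \<le> B" "B > 0"
    and H: "2 * real n \<le> poisson_right R" "2 * real n \<le> poisson_left R" and n: "n > 0"
  shows "1 / (4 * B) \<le> q 0 (2 * n) 0"
proof -
  define S where "S = {- int R<..<int R}"
  define F where "F = {z. q 0 n z \<noteq> 0} \<union> S"
  have F: "finite F" "{z. q 0 n z \<noteq> 0} \<subseteq> F" "S \<subseteq> F" using fin_supp_q by (auto simp: F_def S_def)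
  have w: "0 \<le> weight z * q 0 n z" for z using weight_pos[of z] q_nonneg[of 0 n z] by simp
  have ip: "ip (q 0 n) g = (\<Sum>z\<in>F. weight z * q 0 n z * g z)" for g by (rule ip_eq[OF F(1,2)])
  have split: "(\<Sum>z\<in>F. f z) = (\<Sum>z\<in>F - S. f z) + (\<Sum>z\<in>S. f z)" for f :: "int \<Rightarrow> real"
    by (rule sum.subset_diff[OF F(3,1)])
  have "2 * real n * (\<Sum>z\<in>F - S. weight z * q 0 n z) = (\<Sum>z\<in>F - S. weight z * q 0 n z * (2 * real n))"
    by (simp add: sum_distrib_left sum_distrib_right mult_ac)
  also have "\<dots> \<le> (\<Sum>z\<in>F - S. weight z * q 0 n z * poisson z)"
  proof (rule sum_mono)
    fix z assume "z \<in> F - S"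
    then have "int R \<le> \<bar>z\<bar>" by (auto simp: S_def)
    from mult_left_mono[OF poisson_outside[OF H this] w[of z]]
    show "weight z * q 0 n z * (2 * real n) \<le> weight z * q 0 n z * poisson z" .
  qed
  also have "\<dots> \<le> (\<Sum>z\<in>F. weight z * q 0 n z * poisson z)"
    using F(1) by (intro sum_mono2 mult_nonneg_nonneg w poisson_nonneg) auto
  also have "\<dots> \<le> real n" using poisson_expectation[of n] ip by simp
  finally have "(\<Sum>z\<in>F - S. weight z * q 0 n z) \<le> 1 / 2" using n by (simp add: field_simps)
  then have half: "(\<Sum>z\<in>S. weight z * q 0 n z) \<ge> 1 / 2"
    using q_mass[of 0 n] split[of "\<lambda>z. weight z * q 0 n z"] ip[of "\<lambda>_. 1"] by simp
  \<comment> \<open>The value of \<open>t\<close> maximizes \<open>t - t\<^sup>2 * B\<close>.\<close>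
  define t where "t = 1 / (2 * B)"
  have t: "t > 0" using B by (simp add: t_def)
  have "1 / (4 * B) = 2 * t * (1 / 2) - t\<^sup>2 * B" using B by (simp add: t_def power2_eq_square field_simps)
  also have "\<dots> \<le> 2 * t * (\<Sum>z\<in>S. weight z * q 0 n z) - t\<^sup>2 * (\<Sum>z\<in>S. weight z)"
    using half B t by (intro diff_mono mult_left_mono) (auto simp: S_def)
  also have "\<dots> = (\<Sum>z\<in>S. weight z * (2 * t * q 0 n z - t\<^sup>2))"
    by (simp add: sum_distrib_left sum_distrib_right right_diff_distrib sum_subtractf mult_ac)
  also have "\<dots> \<le> (\<Sum>z\<in>S. weight z * q 0 n z * q 0 n z)"
  proof (rule sum_mono)
    fix z
    have "0 \<le> (q 0 n z - t)\<^sup>2" by simp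
    then have "2 * t * q 0 n z - t\<^sup>2 \<le> q 0 n z * q 0 n z" by (simp add: power2_eq_square algebra_simps)
    then have "weight z * (2 * t * q 0 n z - t\<^sup>2) \<le> weight z * (q 0 n z * q 0 n z)"
      using weight_pos[of z] by (intro mult_left_mono) auto
    then show "weight z * (2 * t * q 0 n z - t\<^sup>2) \<le> weight z * q 0 n z * q 0 n z" by (simp add: mult_ac)
  qed
  also have "\<dots> \<le> (\<Sum>z\<in>F. weight z * q 0 n z * q 0 n z)"
    using F by (intro sum_mono2 mult_nonneg_nonneg w q_nonneg) auto
  also have "\<dots> = q 0 (2 * n) 0" using ip[of "q 0 n"] ip_q[of 0 n 0 n] by (simp add: mult_2)
  finally show ?thesis .
qed

text \<open>
The window of radius \<open>eps sqrt n\<close> has weight of order \<open>eps sqrt n\<close>, which is small compared with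
\<open>sqrt n\<close>; hence the lower bound beats every multiple of \<open>1 / sqrt n\<close>.
\<close>

lemma return_divergence:
  assumes A: "two_sided_mean weight M" "M > 0"
    and R: "\<And>K. \<exists>r' \<rho>. (\<forall>z. 0 \<le> r' z \<and> r' z \<le> 1 / c z) \<and> two_sided_mean r' \<rho> \<and> \<rho> > K"
  shows "filterlim (\<lambda>n. sqrt (2 * real n) * q 0 (2 * n) 0) at_top sequentially"
proof -
  have nn: "0 \<le> 1 / c z" "0 \<le> weight z" for z using c_pos[of z] weight_pos[of z] by (auto simp: less_imp_le)
  have gr: "eventually (\<lambda>n. K * (real n)\<^sup>2 \<le> poisson_right n) sequentially" for K
    unfolding ray_poisson_def
  proof (rule superquadratic_growth)
    show "has_mean (\<lambda>i. weight (1 + int i)) M" using A by (simp add: two_sided_mean_def)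
    fix K
    obtain r' \<rho> where "\<forall>z. 0 \<le> r' z \<and> r' z \<le> 1 / c z" "two_sided_mean r' \<rho>" "\<rho> > K" using R by blast
    moreover from this have "has_mean (\<lambda>i. r' (0 + int i)) \<rho>"
      unfolding two_sided_mean_def by blast
    ultimately show "\<exists>r' \<rho>. (\<forall>n. 0 \<le> r' n \<and> r' n \<le> 1 / c (int n)) \<and> has_mean r' \<rho> \<and> \<rho> > K"
      by (intro exI[of _ "\<lambda>n. r' (int n)"] exI[of _ \<rho>]) simp
  qed (use nn A in auto)
  have gl: "eventually (\<lambda>n. K * (real n)\<^sup>2 \<le> poisson_left n) sequentially" for K
    unfolding ray_poisson_def
  proof (rule superquadratic_growth)
    show "has_mean (\<lambda>i. weight (- 1 - int i)) M" using A by (simp add: two_sided_mean_def)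
    fix K
    obtain r' \<rho> where "\<forall>z. 0 \<le> r' z \<and> r' z \<le> 1 / c z" "two_sided_mean r' \<rho>" "\<rho> > K" using R by blast
    then show "\<exists>r' \<rho>. (\<forall>n. 0 \<le> r' n \<and> r' n \<le> 1 / c (- 1 - int n)) \<and> has_mean r' \<rho> \<and> \<rho> > K"
      by (intro exI[of _ "\<lambda>n. r' (- 1 - int n)"] exI[of _ \<rho>]) (simp add: two_sided_mean_def)
  qed (use nn A in auto)
  obtain K1 where K1: "K1 \<ge> 0" "\<And>n. (\<Sum>i<n. weight (0 + int i)) \<le> (M + 1) * real n + K1"
    using linear_bounds[of "\<lambda>n. \<Sum>i<n. weight (0 + int i)" M 1] A unfolding two_sided_mean_def by (metis zero_less_one)
  obtain K2 where K2: "K2 \<ge> 0" "\<And>n. (\<Sum>i<n. weight (0 - int i)) \<le> (M + 1) * real n + K2"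
    using linear_bounds[of "\<lambda>n. \<Sum>i<n. weight (0 - int i)" M 1] A unfolding two_sided_mean_def by (metis zero_less_one)
  define C where "C = 2 * (M + 1) + K1 + K2"
  have C: "C > 0" using A K1 K2 by (simp add: C_def)
  have window: "(\<Sum>z\<in>{- int R<..<int R}. weight z) \<le> C * real R" if "R \<ge> 1" for R
  proof -
    have "{- int R<..<int R} \<subseteq> (\<lambda>i. 0 + int i) ` {..<R} \<union> (\<lambda>i. 0 - int i) ` {..<R}"
    proof
      fix z assume z: "z \<in> {- int R<..<int R}"
      show "z \<in> (\<lambda>i. 0 + int i) ` {..<R} \<union> (\<lambda>i. 0 - int i) ` {..<R}"
      proof (cases "0 \<le> z")
        case True
        then show ?thesis using z by (intro UnI1 image_eqI[of _ _ "nat z"]) auto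
      next
        case False
        then show ?thesis using z by (intro UnI2 image_eqI[of _ _ "nat (- z)"]) auto
      qed
    qed
    then have "(\<Sum>z\<in>{- int R<..<int R}. weight z) \<le> (\<Sum>z\<in>(\<lambda>i. 0 + int i) ` {..<R} \<union> (\<lambda>i. 0 - int i) ` {..<R}. weight z)"
      using nn by (intro sum_mono2) auto
    also have "\<dots> \<le> (\<Sum>z\<in>(\<lambda>i. 0 + int i) ` {..<R}. weight z) + (\<Sum>z\<in>(\<lambda>i. 0 - int i) ` {..<R}. weight z)"
      by (subst sum_Un) (auto simp: nn intro!: sum_nonneg)
    also have "\<dots> = (\<Sum>i<R. weight (0 + int i)) + (\<Sum>i<R. weight (0 - int i))"
      by (subst (1 2) sum.reindex) (auto simp: inj_on_def)
    also have "\<dots> \<le> 2 * (M + 1) * real R + K1 * 1 + K2 * 1" using K1(2)[of R] K2(2)[of R] by (simp add: algebra_simps)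
    also have "\<dots> \<le> 2 * (M + 1) * real R + K1 * real R + K2 * real R"
      using that K1(1) K2(1) by (intro add_mono mult_left_mono order_refl) auto
    also have "\<dots> = C * real R" by (simp add: C_def algebra_simps)
    finally show ?thesis .
  qed
  show ?thesis
    unfolding filterlim_at_top_gt[where c = 0]
  proof (intro allI impI)
    fix K :: real assume K: "0 < K"
    \<comment> \<open>A window of radius at most \<open>2 eps sqrt n\<close> has weight at most \<open>2 C eps sqrt n\<close>; four times this is \<open>sqrt n / K\<close>.\<close>
    define eps where "eps = 1 / (8 * C * K)"
    have eps: "eps > 0" using C K by (simp add: eps_def)
    define R where "R n = nat \<lceil>eps * sqrt (real n)\<rceil>" for n
    have Rlow: "eps * sqrt (real n) \<le> real (R n)" for n unfolding R_def by linarith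
    have Rup: "real (R n) \<le> eps * sqrt (real n) + 1" for n
    proof -
      have "0 \<le> eps * sqrt (real n)" using eps by simp
      then show ?thesis unfolding R_def by linarith
    qed
    have es: "filterlim (\<lambda>n. eps * sqrt (real n)) at_top sequentially"
      by (intro filterlim_tendsto_pos_mult_at_top[OF tendsto_const eps]
          filterlim_compose[OF sqrt_at_top filterlim_real_sequentially])
    have "filterlim (\<lambda>n. real (R n)) at_top sequentially"
      by (rule filterlim_at_top_mono[OF es]) (simp add: Rlow)
    then have Rt: "filterlim R at_top sequentially"
      by (simp add: filterlim_sequentially_iff_filterlim_real)
    show "eventually (\<lambda>n. K \<le> sqrt (2 * real n) * q 0 (2 * n) 0) sequentially"
      using eventually_compose_filterlim[OF gr[of "2 / eps\<^sup>2"] Rt] eventually_compose_filterlim[OF gl[of "2 / eps\<^sup>2"] Rt]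
        filterlim_at_top[THEN iffD1, OF Rt, THEN spec, of 1] filterlim_at_top[THEN iffD1, OF es, THEN spec, of 1]
        eventually_gt_at_top[of 0]
    proof eventually_elim
      case (elim n)
      have "2 * real n = 2 / eps\<^sup>2 * (eps * sqrt (real n))\<^sup>2" using eps by (simp add: power_mult_distrib)
      also have "\<dots> \<le> 2 / eps\<^sup>2 * (real (R n))\<^sup>2" using Rlow[of n] eps by (intro mult_left_mono power_mono) auto
      finally have H: "2 * real n \<le> poisson_right (R n)" "2 * real n \<le> poisson_left (R n)" using elim(1,2) by linarith+
      have R0: "C * real (R n) > 0" using C elim(3) by simp
      have "1 / (4 * (C * real (R n))) \<le> q 0 (2 * n) 0"
        by (rule return_lower_bound[OF window[OF elim(3)] R0 H elim(5)])
      moreover have "1 / (4 * (C * (2 * (eps * sqrt (real n))))) \<le> 1 / (4 * (C * real (R n)))"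
      proof (rule divide_left_mono)
        show "4 * (C * real (R n)) \<le> 4 * (C * (2 * (eps * sqrt (real n))))"
          using Rup[of n] elim(4) C by (intro mult_left_mono) auto
        show "0 < 4 * (C * (2 * (eps * sqrt (real n)))) * (4 * (C * real (R n)))"
          using R0 C eps elim(3,5) by (intro mult_pos_pos) auto
      qed simp
      moreover have "1 / (4 * (C * (2 * (eps * sqrt (real n))))) = K / sqrt (real n)"
        using C K by (simp add: eps_def field_simps)
      ultimately have "K / sqrt (real n) \<le> q 0 (2 * n) 0" by linarith
      then have "K \<le> sqrt (real n) * q 0 (2 * n) 0" using elim(5) by (simp add: field_simps)
      also have "\<dots> \<le> sqrt (2 * real n) * q 0 (2 * n) 0"
        by (intro mult_right_mono q_nonneg) simp
      finally show ?case .
    qed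
  qed
qed

text \<open>
The kernel at \<open>y\<close> dominates a fixed multiple of the kernel at \<open>x\<close> at an earlier time, because the
walk may go straight from \<open>x\<close> to \<open>y\<close>.
\<close>

lemma q_propagation:
  "\<exists>\<kappa>>0. \<forall>n. \<kappa> * q x n x \<le> q x (n + j) (x + int j)"
  "\<exists>\<kappa>>0. \<forall>n. \<kappa> * q x n x \<le> q x (n + j) (x - int j)"
proof -
  have up: "c z / weight (z + 1) * q x n z \<le> q x (Suc n) (z + 1)" for n z
  proof -
    have "0 \<le> c (z + 1) * q x n (z + 1 + 1)"
      using c_pos[of "z + 1"] q_nonneg[of x n "z + 1 + 1"] by (intro mult_nonneg_nonneg) auto
    then have "c z * q x n z / weight (z + 1) \<le> (c (z + 1 - 1) * q x n (z + 1 - 1) + c (z + 1) * q x n (z + 1 + 1)) / weight (z + 1)"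
      using weight_pos[of "z + 1"] by (intro divide_right_mono) auto
    then show ?thesis unfolding q_Suc transition_def by simp
  qed
  have down: "c (z - 1) / weight (z - 1) * q x n z \<le> q x (Suc n) (z - 1)" for n z
  proof -
    have "0 \<le> c (z - 1 - 1) * q x n (z - 1 - 1)"
      using c_pos[of "z - 1 - 1"] q_nonneg[of x n "z - 1 - 1"] by (intro mult_nonneg_nonneg) auto
    then have "c (z - 1) * q x n z / weight (z - 1) \<le> (c (z - 1 - 1) * q x n (z - 1 - 1) + c (z - 1) * q x n (z - 1 + 1)) / weight (z - 1)"
      using weight_pos[of "z - 1"] by (intro divide_right_mono) auto
    then show ?thesis unfolding q_Suc transition_def by simp
  qed
  show "\<exists>\<kappa>>0. \<forall>n. \<kappa> * q x n x \<le> q x (n + j) (x + int j)"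
  proof (induction j)
    case 0 then show ?case by (intro exI[of _ 1]) simp
  next
    case (Suc j)
    then obtain \<kappa> where \<kappa>: "\<kappa> > 0" "\<And>n. \<kappa> * q x n x \<le> q x (n + j) (x + int j)" by blast
    let ?w = "c (x + int j) / weight (x + int j + 1)"
    have w: "?w > 0" using c_pos weight_pos by simp
    have "?w * \<kappa> * q x n x \<le> q x (n + Suc j) (x + int (Suc j))" for n
      using mult_left_mono[OF \<kappa>(2)[of n] less_imp_le[OF w]] up[of "x + int j" "n + j"]
      by (simp add: mult.assoc add_ac)
    moreover have "?w * \<kappa> > 0" using w \<kappa>(1) by (rule mult_pos_pos)
    ultimately show ?case by blast
  qed
  show "\<exists>\<kappa>>0. \<forall>n. \<kappa> * q x n x \<le> q x (n + j) (x - int j)"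
  proof (induction j)
    case 0 then show ?case by (intro exI[of _ 1]) simp
  next
    case (Suc j)
    then obtain \<kappa> where \<kappa>: "\<kappa> > 0" "\<And>n. \<kappa> * q x n x \<le> q x (n + j) (x - int j)" by blast
    let ?w = "c (x - int j - 1) / weight (x - int j - 1)"
    have w: "?w > 0" using c_pos weight_pos by simp
    have e: "x - int j - 1 = x - int (Suc j)" by simp
    have "?w * \<kappa> * q x n x \<le> q x (n + Suc j) (x - int (Suc j))" for n
      using mult_left_mono[OF \<kappa>(2)[of n] less_imp_le[OF w]] down[of "x - int j" "n + j"]
      unfolding e by (simp add: mult.assoc)
    moreover have "?w * \<kappa> > 0" using w \<kappa>(1) by (rule mult_pos_pos)
    ultimately show ?case by blast
  qed
qed

lemma local_divergence:
  assumes ret: "filterlim (\<lambda>n. sqrt (2 * real n) * q 0 (2 * n) 0) at_top sequentially"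
    and ev: "even (y :: int)"
  shows "filterlim (\<lambda>n. sqrt (2 * real n) * q 0 (2 * n) y) at_top sequentially"
proof -
  obtain k where "y = 2 * k" using ev by (rule evenE)
  then have "nat \<bar>y\<bar> = 2 * nat \<bar>k\<bar>" by (simp add: abs_mult nat_mult_distrib)
  then obtain i where i: "nat \<bar>y\<bar> = 2 * i" by blast
  have "\<exists>\<kappa>>0. \<forall>n. \<kappa> * q 0 n 0 \<le> q 0 (n + nat \<bar>y\<bar>) y"
    using q_propagation(1)[of 0 "nat \<bar>y\<bar>"] q_propagation(2)[of 0 "nat \<bar>y\<bar>"] by (cases "0 \<le> y") auto
  then obtain \<kappa> where \<kappa>: "\<kappa> > 0" "\<And>n. \<kappa> * q 0 n 0 \<le> q 0 (n + 2 * i) y" unfolding i by blast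
  have dec: "decseq (\<lambda>n. q 0 (2 * n) 0)" by (rule decseq_SucI) (rule q_return_decreasing)
  show ?thesis
  proof (rule filterlim_at_top_mono)
    show "filterlim (\<lambda>n. \<kappa> * (sqrt (2 * real n) * q 0 (2 * n) 0)) at_top sequentially"
      by (rule filterlim_tendsto_pos_mult_at_top[OF tendsto_const \<kappa>(1) ret])
    show "eventually (\<lambda>n. \<kappa> * (sqrt (2 * real n) * q 0 (2 * n) 0) \<le> sqrt (2 * real n) * q 0 (2 * n) y) sequentially"
      using eventually_ge_at_top[of i]
    proof eventually_elim
      case (elim n)
      have "\<kappa> * q 0 (2 * n) 0 \<le> \<kappa> * q 0 (2 * (n - i)) 0"
        using decseqD[OF dec, of "n - i" n] \<kappa>(1) by simp
      also have "\<dots> \<le> q 0 (2 * n) y" using \<kappa>(2)[of "2 * (n - i)"] elim by (simp add: algebra_simps)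
      finally have "sqrt (2 * real n) * (\<kappa> * q 0 (2 * n) 0) \<le> sqrt (2 * real n) * q 0 (2 * n) y"
        by (rule mult_left_mono) simp
      then show ?case by (simp add: mult_ac)
    qed
  qed
qed

end

section \<open>Marginals of the Markov chain\<close>

lemma markov_chain_sets:
  assumes "markov_chain P S x0 p"
  shows "{w \<in> space P. S i w = z} \<in> sets P"
proof -
  have "S i \<in> measurable P (count_space UNIV)" using assms by (simp add: markov_chain_def)
  from measurable_sets[OF this, of "{z}"] show ?thesis
    by (simp add: vimage_def Int_def conj_commute)
qed

text \<open>
The Markov property of \<open>markov_chain\<close> conditions on complete histories. Summing over the countably
many histories that end at \<open>x\<close> gives the one-step relation between marginals.
\<close>

lemma markov_chain_joint:
  fixes S :: "nat \<Rightarrow> 'p \<Rightarrow> 's :: countable"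
  assumes mc: "markov_chain P S x0 p" and p: "0 \<le> p x y"
  shows "emeasure P {w \<in> space P. S n w = x \<and> S (Suc n) w = y}
       = emeasure P {w \<in> space P. S n w = x} * ennreal (p x y)"
proof -
  interpret prob_space P using mc by (simp add: markov_chain_def)
  note m = markov_chain_sets[OF mc]
  define H where "H l = {w \<in> space P. \<forall>i\<le>n. S i w = l ! i}" for l
  define F where "F = {w \<in> space P. S (Suc n) w = y}"
  define L where "L = {l :: 's list. length l = Suc n \<and> l ! n = x}"
  have Fm: "F \<in> sets P" unfolding F_def by (rule m)
  have Hm: "H l \<in> sets P" for l
  proof -
    have "H l = (\<Inter>i\<in>{..n}. {w \<in> space P. S i w = l ! i})" by (auto simp: H_def)
    also have "\<dots> \<in> sets P" using m by (intro sets.finite_INT) auto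
    finally show ?thesis .
  qed
  have disj: "disjoint_family_on H L"
    unfolding disjoint_family_on_def
  proof (intro ballI impI)
    fix l l' assume l: "l \<in> L" "l' \<in> L" "l \<noteq> l'"
    show "H l \<inter> H l' = {}"
    proof (rule ccontr)
      assume "H l \<inter> H l' \<noteq> {}"
      then obtain w where "\<forall>i\<le>n. S i w = l ! i" "\<forall>i\<le>n. S i w = l' ! i" by (auto simp: H_def)
      then have "l = l'" using l by (intro nth_equalityI) (auto simp: L_def less_Suc_eq_le)
      then show False using l by simp
    qed
  qed
  have un: "(\<Union>l\<in>L. H l) = {w \<in> space P. S n w = x}"
  proof (intro equalityI subsetI)
    fix w assume w: "w \<in> {w \<in> space P. S n w = x}"
    define l where "l = map (\<lambda>i. S i w) [0..<Suc n]"
    have li: "l ! i = S i w" if "i \<le> n" for i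
      unfolding l_def using that by (subst nth_map) (auto simp del: upt_Suc)
    have "length l = Suc n" by (simp add: l_def)
    then have "l \<in> L" "w \<in> H l" using w li by (auto simp: L_def H_def)
    then show "w \<in> (\<Union>l\<in>L. H l)" by blast
  qed (auto simp: H_def L_def)
  have step: "emeasure P (H l \<inter> F) = emeasure P (H l) * ennreal (p x y)" if l: "l \<in> L" for l
  proof (cases "prob (H l) = 0")
    case True
    then have "emeasure P (H l) = 0" by (simp add: emeasure_eq_measure)
    moreover from this have "emeasure P (H l \<inter> F) = 0"
      using emeasure_mono[of "H l \<inter> F" "H l" P] Hm by simp
    ultimately show ?thesis by simp
  next
    case False
    then have pos: "prob (H l) > 0" by (simp add: zero_less_measure_iff)
    then have "\<P>(w in P. \<forall>i\<le>n. S i w = l ! i) > 0" by (simp add: H_def)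
    then have "\<P>(w in P. S (Suc n) w = y \<bar> \<forall>i\<le>n. S i w = l ! i) = p x y"
      using mc l unfolding markov_chain_def L_def by auto
    then have "prob {w \<in> space P. S (Suc n) w = y \<and> (\<forall>i\<le>n. S i w = l ! i)} / prob (H l) = p x y"
      by (simp add: cond_prob_def H_def)
    moreover have "{w \<in> space P. S (Suc n) w = y \<and> (\<forall>i\<le>n. S i w = l ! i)} = H l \<inter> F"
      by (auto simp: H_def F_def)
    ultimately have "prob (H l \<inter> F) = prob (H l) * p x y" using pos by (simp add: field_simps)
    then show ?thesis using p by (simp add: emeasure_eq_measure ennreal_mult)
  qed
  have cL: "countable L" by (rule countableI_type)
  have "{w \<in> space P. S n w = x \<and> S (Suc n) w = y} = (\<Union>l\<in>L. H l \<inter> F)"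
    using un by (auto simp: F_def)
  then have "emeasure P {w \<in> space P. S n w = x \<and> S (Suc n) w = y} = (\<integral>\<^sup>+ l. emeasure P (H l \<inter> F) \<partial>count_space L)"
    using disj Hm Fm cL by (subst emeasure_UN_countable[symmetric]) (auto simp: disjoint_family_on_def)
  also have "\<dots> = (\<integral>\<^sup>+ l. emeasure P (H l) * ennreal (p x y) \<partial>count_space L)"
    by (rule nn_integral_cong) (simp add: step)
  also have "\<dots> = (\<integral>\<^sup>+ l. emeasure P (H l) \<partial>count_space L) * ennreal (p x y)"
    by (rule nn_integral_multc) simp
  also have "(\<integral>\<^sup>+ l. emeasure P (H l) \<partial>count_space L) = emeasure P {w \<in> space P. S n w = x}"
    unfolding un[symmetric] using disj Hm cL by (subst emeasure_UN_countable) auto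
  finally show ?thesis .
qed

lemma (in conductances) walk_distribution:
  fixes S :: "nat \<Rightarrow> 'p \<Rightarrow> int"
  assumes mc: "markov_chain P S x p"
    and p: "\<And>u v. p u v = (if v = u + 1 then c u else if v = u - 1 then c v else 0) / weight u"
  shows "\<P>(w in P. S n w = y) = weight y * q x n y"
proof (induction n arbitrary: y)
  case 0
  interpret prob_space P using mc by (simp add: markov_chain_def)
  have ae: "AE w in P. S 0 w = x" using mc by (simp add: markov_chain_def)
  note ev = markov_chain_sets[OF mc, of 0 y]
  have "\<P>(w in P. S 0 w = y) = (if y = x then 1 else 0)"
  proof (cases "y = x")
    case True
    have "AE w in P. S 0 w = y" using ae True by simp
    then show ?thesis using True prob_Collect_eq_1[OF ev] by simp
  next
    case False
    have "AE w in P. S 0 w \<noteq> y" using ae by eventually_elim (use False in simp)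
    then show ?thesis using False prob_Collect_eq_0[OF ev] by simp
  qed
  then show ?case using weight_pos[of x] by (simp add: q_0 dirac_def)
next
  case (Suc n)
  interpret prob_space P using mc by (simp add: markov_chain_def)
  note m = markov_chain_sets[OF mc]
  have p0: "0 \<le> p u v" for u v using c_pos weight_pos by (simp add: p less_imp_le)
  define E where "E u = {w \<in> space P. S n w = u \<and> S (Suc n) w = y}" for u
  have Em: "E u \<in> sets P" for u
  proof -
    have "E u = {w \<in> space P. S n w = u} \<inter> {w \<in> space P. S (Suc n) w = y}" by (auto simp: E_def)
    then show ?thesis using m by simp
  qed
  have E: "emeasure P (E u) = ennreal (weight u * q x n u * p u y)" for u
    unfolding E_def markov_chain_joint[OF mc p0]
    using Suc[of u] weight_pos[of u] q_nonneg[of x n u] p0 by (simp add: emeasure_eq_measure ennreal_mult)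
  have "{w \<in> space P. S (Suc n) w = y} = (\<Union>u. E u)" by (auto simp: E_def)
  then have "emeasure P {w \<in> space P. S (Suc n) w = y} = (\<integral>\<^sup>+ u. emeasure P (E u) \<partial>count_space UNIV)"
    using Em by (subst emeasure_UN_countable[symmetric]) (auto simp: disjoint_family_on_def E_def)
  also have "\<dots> = (\<Sum>u\<in>{y - 1, y + 1}. emeasure P (E u))"
    by (rule nn_integral_count_space') (auto simp: E p)
  also have "\<dots> = ennreal (weight (y - 1) * q x n (y - 1) * p (y - 1) y) + ennreal (weight (y + 1) * q x n (y + 1) * p (y + 1) y)"
    by (simp add: E)
  also have "\<dots> = ennreal (weight (y - 1) * q x n (y - 1) * p (y - 1) y + weight (y + 1) * q x n (y + 1) * p (y + 1) y)"
    using weight_pos p0 q_nonneg by (intro ennreal_plus[symmetric] mult_nonneg_nonneg) (auto simp: less_imp_le)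
  also have "weight (y - 1) * q x n (y - 1) * p (y - 1) y + weight (y + 1) * q x n (y + 1) * p (y + 1) y = weight y * q x (Suc n) y"
    using weight_pos[of "y - 1"] weight_pos[of "y + 1"] unfolding q_Suc weight_step by (simp add: p mult_ac)
  finally have "ennreal (prob {w \<in> space P. S (Suc n) w = y}) = ennreal (weight y * q x (Suc n) y)"
    by (simp add: emeasure_eq_measure)
  then show ?case using weight_pos[of y] q_nonneg[of x "Suc n" y] by (simp add: less_imp_le)
qed

section \<open>The local limit theorem in random environment\<close>

context prob_space
begin

lemma integral_pos_of_pos:
  fixes g :: "'a \<Rightarrow> real"
  assumes g: "integrable M g" and pos: "\<And>w. w \<in> space M \<Longrightarrow> 0 < g w"
  shows "0 < (\<integral>w. g w \<partial>M)"
proof -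
  have ae: "AE w in M. 0 \<le> g w" using pos by (intro AE_I2) (simp add: less_imp_le)
  have "(\<integral>w. g w \<partial>M) \<noteq> 0"
  proof
    assume "(\<integral>w. g w \<partial>M) = 0"
    then have "AE w in M. g w = 0" using integral_nonneg_eq_0_iff_AE[OF g ae] by simp
    with AE_space have "AE w in M. False" by eventually_elim (use pos in force)
    then show False by simp
  qed
  moreover have "0 \<le> (\<integral>w. g w \<partial>M)" using ae by (rule integral_nonneg_AE)
  ultimately show ?thesis by simp
qed

lemma integrable_min_const:
  fixes g :: "'a \<Rightarrow> real"
  assumes [measurable]: "g \<in> borel_measurable M" and nn: "\<And>w. w \<in> space M \<Longrightarrow> 0 \<le> g w"
  shows "integrable M (\<lambda>w. min (g w) (real j))"
  by (rule integrable_const_bound[where B = "real j"]) (use nn in \<open>auto intro!: AE_I2\<close>)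

text \<open>
Truncation at integer levels is what lets the ergodic theorem for integrable functions be applied
to functions of infinite integral.
\<close>

lemma truncated_integral_unbounded:
  fixes g :: "'a \<Rightarrow> real"
  assumes g[measurable]: "g \<in> borel_measurable M" and nn: "\<And>w. w \<in> space M \<Longrightarrow> 0 \<le> g w"
    and inf: "(\<integral>\<^sup>+w. ennreal (g w) \<partial>M) = \<infinity>"
  shows "\<exists>j. K < (\<integral>w. min (g w) (real j) \<partial>M)"
proof (rule ccontr)
  assume "\<not> ?thesis"
  then have le: "(\<integral>w. min (g w) (real j) \<partial>M) \<le> K" for j by (simp add: not_less)
  have "(\<integral>\<^sup>+w. ennreal (g w) \<partial>M) = (\<integral>\<^sup>+w. (SUP j. ennreal (min (g w) (real j))) \<partial>M)"
  proof (rule nn_integral_cong)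
    fix w assume "w \<in> space M"
    obtain j0 where j0: "g w \<le> real j0" using real_arch_simple by blast
    show "ennreal (g w) = (SUP j. ennreal (min (g w) (real j)))"
    proof (rule antisym)
      have "ennreal (g w) = ennreal (min (g w) (real j0))" using j0 by simp
      also have "\<dots> \<le> (SUP j. ennreal (min (g w) (real j)))" by (rule SUP_upper) simp
      finally show "ennreal (g w) \<le> (SUP j. ennreal (min (g w) (real j)))" .
      show "(SUP j. ennreal (min (g w) (real j))) \<le> ennreal (g w)"
        by (rule SUP_least) (auto intro: ennreal_leI)
    qed
  qed
  also have "\<dots> = (SUP j. \<integral>\<^sup>+w. ennreal (min (g w) (real j)) \<partial>M)"
    by (rule nn_integral_monotone_convergence_SUP) (auto intro!: incseq_SucI le_funI ennreal_leI)
  also have "\<dots> \<le> ennreal K"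
  proof (rule SUP_least)
    fix j
    have "(\<integral>\<^sup>+w. ennreal (min (g w) (real j)) \<partial>M) = ennreal (\<integral>w. min (g w) (real j) \<partial>M)"
      by (rule nn_integral_eq_integral[OF integrable_min_const[OF g nn]]) (use nn in \<open>auto intro!: AE_I2\<close>)
    then show "(\<integral>\<^sup>+w. ennreal (min (g w) (real j)) \<partial>M) \<le> ennreal K" using le[of j] by (simp add: ennreal_leI)
  qed
  finally show False using inf by (simp add: top_unique)
qed

end

theorem mainTheorem1:
  fixes M :: "'a measure" and T :: "'a \<Rightarrow> 'a" and c :: "'a \<Rightarrow> real"
    and P :: "'a \<Rightarrow> int \<Rightarrow> 'p measure" and S :: "nat \<Rightarrow> 'p \<Rightarrow> int"
  assumes "ergodic_system M T"
    and "c \<in> borel_measurable M"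
    and "\<And>\<omega>. \<omega> \<in> space M \<Longrightarrow> 0 < c \<omega>"
    and "\<And>\<omega> x0. \<omega> \<in> space M \<Longrightarrow> markov_chain (P \<omega> x0) S x0 (walk_trans M T c \<omega>)"
    and "integrable M (cbar M T c 0) \<or> integrable M (\<lambda>\<omega>. 1 / c \<omega>)"
  shows "AE \<omega> in M. \<forall>x::int. even x \<longrightarrow>
    (integrable M (cbar M T c 0) \<and> integrable M (\<lambda>\<omega>. 1 / c \<omega>) \<longrightarrow>
      (\<lambda>n. sqrt (2 * real n) * (\<P>(w in P \<omega> 0. S (2 * n) w = x) / cbar M T c x \<omega>))
        \<longlonglongrightarrow> 1 / sqrt pi *
          sqrt ((\<integral>\<omega>'. 1 / c \<omega>' \<partial>M) / (\<integral>\<omega>'. cbar M T c 0 \<omega>' \<partial>M))) \<and>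
    (integrable M (\<lambda>\<omega>. 1 / c \<omega>) \<and> (\<integral>\<^sup>+\<omega>'. ennreal (cbar M T c 0 \<omega>') \<partial>M) = \<infinity> \<longrightarrow>
      (\<lambda>n. sqrt (2 * real n) * (\<P>(w in P \<omega> 0. S (2 * n) w = x) / cbar M T c x \<omega>))
        \<longlonglongrightarrow> 0) \<and>
    ((\<integral>\<^sup>+\<omega>'. ennreal (1 / c \<omega>') \<partial>M) = \<infinity> \<and> integrable M (cbar M T c 0) \<longrightarrow>
      filterlim
        (\<lambda>n. sqrt (2 * real n) * (\<P>(w in P \<omega> 0. S (2 * n) w = x) / cbar M T c x \<omega>))
        at_top sequentially)"
proof -
  interpret ergodic_system M T by fact
  note c_meas[measurable] = assms(2) and c_pos = assms(3) and chain = assms(4)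
  define g where "g = cbar M T c 0"
  define r where "r \<omega> = 1 / c \<omega>" for \<omega>
  have g_eq: "g \<omega> = c (iterate M T (- 1) \<omega>) + c (iterate M T 0 \<omega>)" for \<omega>
    by (simp add: g_def cbar_def conductance_def)
  have g_pos: "0 < g \<omega>" and r_pos: "0 < r \<omega>" if "\<omega> \<in> space M" for \<omega>
    using c_pos iterate_space[OF that] that by (auto simp: g_eq r_def intro!: add_pos_pos)
  have g_meas[measurable]: "g \<in> borel_measurable M"
    unfolding g_eq[abs_def] using measurable_compose[OF iterate_preserving(1) c_meas] by measurable
  have r_meas[measurable]: "r \<in> borel_measurable M" unfolding r_def[abs_def] by measurable
  have g_nn: "0 \<le> g \<omega>" and r_nn: "0 \<le> r \<omega>" if "\<omega> \<in> space M" for \<omega>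
    using g_pos[OF that] r_pos[OF that] by auto
  define orb where "orb h \<omega> = (\<lambda>y. h (iterate M T y \<omega>))" for h :: "'a \<Rightarrow> real" and \<omega>
  have means: "AE \<omega> in M. (integrable M h \<longrightarrow> two_sided_mean (orb h \<omega>) (\<integral>\<omega>. h \<omega> \<partial>M))" for h :: "'a \<Rightarrow> real"
    using AE_two_sided_mean[of h] by (cases "integrable M h") (simp_all add: orb_def)
  have trunc: "AE \<omega> in M. \<forall>j. two_sided_mean (\<lambda>y. min (orb h \<omega> y) (real j)) (\<integral>\<omega>. min (h \<omega>) (real j) \<partial>M)"
    if "h \<in> borel_measurable M" "\<And>\<omega>. \<omega> \<in> space M \<Longrightarrow> 0 \<le> h \<omega>" for h :: "'a \<Rightarrow> real"
    using AE_two_sided_mean[OF integrable_min_const[OF that]] unfolding AE_all_countable orb_def by blast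
  have trunc_g: "AE \<omega> in M. \<forall>j. two_sided_mean (\<lambda>y. min (orb g \<omega> y) (real j)) (\<integral>\<omega>. min (g \<omega>) (real j) \<partial>M)"
    using g_meas g_nn by (rule trunc)
  have trunc_r: "AE \<omega> in M. \<forall>j. two_sided_mean (\<lambda>y. min (orb r \<omega> y) (real j)) (\<integral>\<omega>. min (r \<omega>) (real j) \<partial>M)"
    using r_meas r_nn by (rule trunc)
  show ?thesis
    using means[of g] means[of r] trunc_g trunc_r AE_space
  proof eventually_elim
    case (elim \<omega>)
    note means_g = elim(1) and means_r = elim(2) and trunc_g = elim(3) and trunc_r = elim(4) and \<omega> = elim(5)
    interpret env: conductances "orb c \<omega>"
      by standard (simp add: orb_def c_pos iterate_space[OF \<omega>])
    have cbar: "cbar M T c y \<omega> = env.weight y" for y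
      unfolding env.weight_def by (simp add: cbar_def conductance_def orb_def)
    \<comment> \<open>The weight of a site is the function \<open>g\<close> along the orbit, so the ergodic theorem applies to it.\<close>
    have weight: "env.weight y = orb g \<omega> y" for y
    proof -
      have sp: "iterate M T y \<omega> \<in> space M" by (rule iterate_space[OF \<omega>])
      have "iterate M T (- 1) (iterate M T y \<omega>) = Tinv (iterate M T y \<omega>)"
        using iterate_pred[OF sp, of 0] by (simp add: iterate_0)
      then show ?thesis
        using iterate_pred[OF \<omega>, of y] unfolding env.weight_def by (simp add: orb_def g_eq iterate_0)
    qed
    have weight': "env.weight = orb g \<omega>" using weight by (rule ext)
    have res: "(\<lambda>y. 1 / orb c \<omega> y) = orb r \<omega>" by (simp add: orb_def r_def)
    have dist: "\<P>(w in P \<omega> 0. S (2 * n) w = y) / cbar M T c y \<omega> = env.q 0 (2 * n) y" for n y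
    proof -
      have "\<P>(w in P \<omega> 0. S (2 * n) w = y) = env.weight y * env.q 0 (2 * n) y"
        by (rule env.walk_distribution[OF chain[OF \<omega>]])
           (simp add: walk_trans_def conductance_def cbar orb_def)
      then show ?thesis using env.weight_pos[of y] by (simp add: cbar)
    qed
    show ?case unfolding dist
    proof (intro allI impI conjI)
      fix x :: int
      assume x: "even x"
      { assume I: "integrable M (cbar M T c 0) \<and> integrable M (\<lambda>\<omega>. 1 / c \<omega>)"
        define m where "m = (\<integral>\<omega>. g \<omega> \<partial>M)"
        define \<rho> where "\<rho> = (\<integral>\<omega>. r \<omega> \<partial>M)"
        have Ig: "integrable M g" and Ir: "integrable M r" using I by (auto simp: g_def r_def[abs_def])
        have m: "m > 0" "two_sided_mean env.weight m"
          using integral_pos_of_pos[OF Ig g_pos] means_g Ig by (auto simp: m_def weight')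
        have \<rho>: "\<rho> > 0" "two_sided_mean (\<lambda>y. 1 / orb c \<omega> y) \<rho>"
          using integral_pos_of_pos[OF Ir r_pos] means_r Ir by (auto simp: \<rho>_def res)
        have "((\<lambda>\<mu>. sqrt \<mu> * env.green (1 / (1 + \<mu>)) y y) \<longlongrightarrow> sqrt (\<rho> / m) / 2) (at_right 0)" for y
        proof (rule env.green_limit[OF \<rho>(2,1)])
          have "\<forall>y. 0 \<le> env.weight y \<and> env.weight y \<le> env.weight y" using env.weight_pos by (simp add: less_imp_le)
          then show "\<exists>m' N. (\<forall>y. 0 \<le> m' y \<and> m' y \<le> env.weight y) \<and> two_sided_mean m' N \<and> N > 0 \<and> sqrt (\<rho> / N) < \<delta>"
            if "\<delta> > sqrt (\<rho> / m)" for \<delta>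
            using m that by blast
          show "sqrt (\<rho> / m) = 0 \<or> (\<exists>N>0. two_sided_mean env.weight N \<and> sqrt (\<rho> / m) = sqrt (\<rho> / N))"
            using m by blast
        qed
        then have "(\<lambda>n. sqrt (2 * real n) * env.q 0 (2 * n) x) \<longlonglongrightarrow> sqrt (\<rho> / m) / sqrt pi"
          using x by (intro env.local_limit_of_returns[OF env.return_asymptotics]) simp_all
        then show "(\<lambda>n. sqrt (2 * real n) * env.q 0 (2 * n) x) \<longlonglongrightarrow>
            1 / sqrt pi * sqrt ((\<integral>\<omega>'. 1 / c \<omega>' \<partial>M) / (\<integral>\<omega>'. cbar M T c 0 \<omega>' \<partial>M))"
          by (simp add: \<rho>_def m_def r_def g_def) }
      { assume I: "integrable M (\<lambda>\<omega>. 1 / c \<omega>) \<and> (\<integral>\<^sup>+\<omega>'. ennreal (cbar M T c 0 \<omega>') \<partial>M) = \<infinity>"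
        define \<rho> where "\<rho> = (\<integral>\<omega>. r \<omega> \<partial>M)"
        have Ir: "integrable M r" and inf: "(\<integral>\<^sup>+\<omega>. ennreal (g \<omega>) \<partial>M) = \<infinity>"
          using I by (auto simp: g_def r_def[abs_def])
        have \<rho>: "\<rho> > 0" "two_sided_mean (\<lambda>y. 1 / orb c \<omega> y) \<rho>"
          using integral_pos_of_pos[OF Ir r_pos] means_r Ir by (auto simp: \<rho>_def res)
        \<comment> \<open>A truncation level whose mean weight exceeds \<open>\<rho> / \<delta>\<^sup>2\<close> makes the bound \<open>sqrt (\<rho> / N)\<close> less than \<open>\<delta>\<close>.\<close>
        have up: "\<exists>m' N. (\<forall>y. 0 \<le> m' y \<and> m' y \<le> env.weight y) \<and> two_sided_mean m' N \<and> N > 0 \<and> sqrt (\<rho> / N) < \<delta>"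
          if \<delta>: "\<delta> > 0" for \<delta>
        proof -
          obtain j where j: "\<rho> / \<delta>\<^sup>2 < (\<integral>\<omega>. min (g \<omega>) (real j) \<partial>M)"
            using truncated_integral_unbounded[OF g_meas g_nn inf] by blast
          define N where "N = (\<integral>\<omega>. min (g \<omega>) (real j) \<partial>M)"
          have "0 < \<rho> / \<delta>\<^sup>2" using \<rho> \<delta> by simp
          then have N: "N > 0" "\<rho> / \<delta>\<^sup>2 < N" using j by (auto simp: N_def)
          have "\<rho> / N < \<delta>\<^sup>2" using N \<delta> by (simp add: field_simps)
          then have "sqrt (\<rho> / N) < \<delta>" using \<delta> by (intro real_less_lsqrt) auto
          moreover have "two_sided_mean (\<lambda>y. min (env.weight y) (real j)) N" using trunc_g by (simp add: weight' N_def)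
          ultimately show ?thesis using N env.weight_pos
            by (intro exI[of _ "\<lambda>y. min (env.weight y) (real j)"] exI[of _ N]) (simp add: less_imp_le)
        qed
        have "((\<lambda>\<mu>. sqrt \<mu> * env.green (1 / (1 + \<mu>)) y y) \<longlongrightarrow> 0 / 2) (at_right 0)" for y
          by (rule env.green_limit[OF \<rho>(2,1) up]) simp_all
        then have "(\<lambda>n. sqrt (2 * real n) * env.q 0 (2 * n) x) \<longlonglongrightarrow> 0 / sqrt pi"
          using x by (intro env.local_limit_of_returns[OF env.return_asymptotics]) simp_all
        then show "(\<lambda>n. sqrt (2 * real n) * env.q 0 (2 * n) x) \<longlonglongrightarrow> 0" by simp }
      { assume I: "(\<integral>\<^sup>+\<omega>'. ennreal (1 / c \<omega>') \<partial>M) = \<infinity> \<and> integrable M (cbar M T c 0)"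
        have Ig: "integrable M g" and inf: "(\<integral>\<^sup>+\<omega>. ennreal (r \<omega>) \<partial>M) = \<infinity>"
          using I by (auto simp: g_def r_def[abs_def])
        have m: "(\<integral>\<omega>. g \<omega> \<partial>M) > 0" "two_sided_mean env.weight (\<integral>\<omega>. g \<omega> \<partial>M)"
          using integral_pos_of_pos[OF Ig g_pos] means_g Ig by (auto simp: weight')
        have "\<exists>r' \<rho>. (\<forall>z. 0 \<le> r' z \<and> r' z \<le> 1 / orb c \<omega> z) \<and> two_sided_mean r' \<rho> \<and> \<rho> > K" for K
        proof -
          obtain j where j: "K < (\<integral>\<omega>. min (r \<omega>) (real j) \<partial>M)"
            using truncated_integral_unbounded[OF r_meas r_nn inf] by blast
          have e: "1 / orb c \<omega> z = orb r \<omega> z" for z by (simp add: orb_def r_def)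
          have "0 \<le> orb r \<omega> z" for z using env.c_pos[of z] unfolding e[symmetric] by simp
          then show ?thesis using trunc_r j unfolding e
            by (intro exI[of _ "\<lambda>y. min (orb r \<omega> y) (real j)"] exI[of _ "\<integral>\<omega>. min (r \<omega>) (real j) \<partial>M"]) simp
        qed
        then show "filterlim (\<lambda>n. sqrt (2 * real n) * env.q 0 (2 * n) x) at_top sequentially"
          by (rule env.local_divergence[OF env.return_divergence[OF m(2,1)] x]) }
    qed
  qed
qed

end
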